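(* Let $\phi\in\mathcal S_d$ satisfy all hypotheses of the main local limit theorem stated in the context, with $\Omega_i(\phi)\ne\emptyset$ and common drift $\alpha$ of the points of $\Omega_i(\phi)$. Then for each compact $K\subseteq\mathbb{R}^d$ there exist $C'>0$ and a nested increasing sequence of compact sets $K_n$, each containing $K$, with $\bigcup_nK_n=\mathbb{R}^d$, such that $|\phi^{(n)}(x)|\le C'n^{-\mu_\phi}$ for all $n\in\mathbb{N}_+$ and $x\in(n\alpha+K_n)\cap\mathbb{Z}^d$. Moreover, there is $C>0$ such that $Cn^{-\mu_\phi}\le\sup_{x\in\mathbb{Z}^d}|\phi^{(n)}(x)|$ for all $n\in\mathbb{N}_+$.
   Context: Hypotheses (of the main local limit theorem): $\sup_\xi|\widehat\phi(\xi)|=1$; every point of $\Omega(\phi)$ is of positive or imaginary homogeneous type for $\widehat\phi$; with $\Omega_i(\phi)$ the points of imaginary homogeneous type and $\mu_\phi=\min_{\xi\in\Omega(\phi)}\mu_\xi$: (i) $\mu_\xi<1$ for all $\xi\in\Omega_i(\phi)$; (ii) $\mu_\xi=\mu_\phi$ for some $\xi\in\Omega_i(\phi)$; (iii) all $\xi\in\Omega_i(\phi)$ share the same drift $\alpha_\xi=\alpha$. Definitions: $t^E:=\exp(\log(t)E)$. $P$ homogeneous w.r.t. $E$: $P(t^E\xi)=tP(\xi)$; $\mathrm{Exp}(P)$ = set of such $E$. Positive homogeneous: real, continuous, positive definite ($\ge0$, zero only at $0$), $\mathrm{Exp}(P)\ne\emptyset$, $\{P=1\}$ compact; homogeneous order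 $\mu_P=\mathrm{tr}E$, $E\in\mathrm{Exp}(P)$. Subhomogeneous w.r.t. $E$ (with $\|t^E\|\to0$ as $t\to0$): for each $\epsilon>0$, compact $K$ there is $\tau>0$ with $|\widetilde P(t^E\xi)|\le\epsilon t$, $0<t<\tau$, $\xi\in K$; strongly subhomogeneous of order $l$: $C^l$ near $0$, $|t^k\partial_t^k\widetilde P(t^E\xi)|\le\epsilon t$ for $k\le l$. $\mathcal S_d$ = $\phi:\mathbb{Z}^d\to\mathbb{C}$ with all $\sum_x|x^\beta\phi(x)|<\infty$; $\widehat\phi(\xi)=\sum_x\phi(x)e^{ix\cdot\xi}$; $\phi^{(n)}$ the $n$-fold convolution power; $\Omega(\phi)=\{\xi\in(-\pi,\pi]^d:|\widehat\phi(\xi)|=1\}$. For $\xi_0\in\Omega(\phi)$, $\Gamma_{\xi_0}(\xi)=\log(\widehat\phi(\xi+\xi_0)/\widehat\phi(\xi_0))$ near $0$ written $i\alpha\cdot\xi-i(Q+\widetilde Q)-(R+\widetilde R)$ ($\alpha\in\mathbb{R}^d$; $Q,R$ real polynomials vanishing at $0$ without linear terms; $\widetilde Q,\widetilde R$ real smooth vanishing at $0$). Positive homogeneous type: $R$ positive homogeneous, some $E\in\mathrm{Exp}(R)$ with $Q$ homogeneous w.r.t. $E$ and $\widetilde Q,\widetilde R$ subhomogeneous w.r.t. $E$; $\mu_{\xi_0}=\mu_R$. Imaginary homogeneous type: $|Q|,R$ positive homogeneous, some $E\in\mathrm{Exp}(|Q|)$, $k>1$ with $R$ homogeneous w.r.t.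 $E/k$, $\widetilde Q$ strongly subhomogeneous w.r.t. $E$ of order 2, $\widetilde R$ strongly subhomogeneous w.r.t. $E/k$ of order 1; $\mu_{\xi_0}=\mu_{|Q|}$. Drift $\alpha_{\xi_0}=\alpha$. *)

theory Defs
  imports "HOL-Analysis.Analysis"
begin

definition zvec :: "int^'d \<Rightarrow> real^'d" where
  "zvec x = (\<chi> j. real_of_int (x$j))"

definition zmono :: "int^'d \<Rightarrow> ('d \<Rightarrow> nat) \<Rightarrow> real" where
  "zmono x \<beta> = (\<Prod>j\<in>UNIV. (real_of_int (x$j)) ^ (\<beta> j))"

definition rmono :: "real^'d \<Rightarrow> ('d \<Rightarrow> nat) \<Rightarrow> real" where
  "rmono \<xi> \<beta> = (\<Prod>j\<in>UNIV. (\<xi>$j) ^ (\<beta> j))"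

definition in_Sd :: "(int^'d::finite \<Rightarrow> complex) \<Rightarrow> bool" where
  "in_Sd \<phi> \<longleftrightarrow> (\<forall>\<beta>::'d \<Rightarrow> nat. (\<lambda>x. \<bar>zmono x \<beta>\<bar> * norm (\<phi> x)) summable_on UNIV)"

definition fhat :: "(int^'d::finite \<Rightarrow> complex) \<Rightarrow> real^'d \<Rightarrow> complex" where
  "fhat \<phi> \<xi> = (\<Sum>\<^sub>\<infinity>x. \<phi> x * cis (zvec x \<bullet> \<xi>))"

primrec conv_pow :: "(int^'d::finite \<Rightarrow> complex) \<Rightarrow> nat \<Rightarrow> int^'d \<Rightarrow> complex" where
  "conv_pow \<phi> 0 = (\<lambda>x. if x = 0 then 1 else 0)"
| "conv_pow \<phi> (Suc n) = (\<lambda>x. \<Sum>\<^sub>\<infinity>y. conv_pow \<phi> n (x - y) * \<phi> y)"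

definition Omega :: "(int^'d::finite \<Rightarrow> complex) \<Rightarrow> (real^'d) set" where
  "Omega \<phi> = {\<xi>. (\<forall>j. - pi < \<xi>$j \<and> \<xi>$j \<le> pi) \<and> norm (fhat \<phi> \<xi>) = 1}"

primrec matpow :: "real^'d^'d \<Rightarrow> nat \<Rightarrow> real^'d^'d" where
  "matpow A 0 = mat 1"
| "matpow A (Suc k) = matpow A k ** A"

definition mexp :: "real^'d::finite^'d \<Rightarrow> real^'d^'d" where
  "mexp A = (\<Sum>k. (1 / fact k) *\<^sub>R matpow A k)"

definition mpow :: "real \<Rightarrow> real^'d::finite^'d \<Rightarrow> real^'d \<Rightarrow> real^'d" where
  "mpow t E \<xi> = mexp (ln t *\<^sub>R E) *v \<xi>"

definition homogeneous_wrt :: "(real^'d::finite \<Rightarrow> real) \<Rightarrow> real^'d^'d \<Rightarrow> bool" where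
  "homogeneous_wrt P E \<longleftrightarrow> (\<forall>t>0. \<forall>\<xi>. P (mpow t E \<xi>) = t * P \<xi>)"

definition ExpSet :: "(real^'d::finite \<Rightarrow> real) \<Rightarrow> (real^'d^'d) set" where
  "ExpSet P = {E. homogeneous_wrt P E}"

definition positive_homogeneous :: "(real^'d::finite \<Rightarrow> real) \<Rightarrow> bool" where
  "positive_homogeneous P \<longleftrightarrow>
     continuous_on UNIV P \<and> (\<forall>\<xi>. 0 \<le> P \<xi>) \<and> (\<forall>\<xi>. P \<xi> = 0 \<longleftrightarrow> \<xi> = 0)
     \<and> ExpSet P \<noteq> {} \<and> compact {\<xi>. P \<xi> = 1}"

definition hom_order :: "(real^'d::finite \<Rightarrow> real) \<Rightarrow> real" where
  "hom_order P = trace (SOME E. E \<in> ExpSet P)"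

definition contracting :: "real^'d::finite^'d \<Rightarrow> bool" where
  "contracting E \<longleftrightarrow> ((\<lambda>t. norm (mexp (ln t *\<^sub>R E))) \<longlongrightarrow> 0) (at_right 0)"

definition subhomogeneous :: "(real^'d::finite \<Rightarrow> real) \<Rightarrow> real^'d^'d \<Rightarrow> bool" where
  "subhomogeneous P E \<longleftrightarrow> contracting E \<and>
     (\<forall>\<epsilon>>0. \<forall>K. compact K \<longrightarrow>
        (\<exists>\<tau>>0. \<forall>t. 0 < t \<and> t < \<tau> \<longrightarrow> (\<forall>\<xi>\<in>K. \<bar>P (mpow t E \<xi>)\<bar> \<le> \<epsilon> * t)))"

primrec Ck_on :: "nat \<Rightarrow> (real^'d::finite) set \<Rightarrow> (real^'d \<Rightarrow> real) \<Rightarrow> bool" where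
  "Ck_on 0 U f = continuous_on U f"
| "Ck_on (Suc k) U f = (continuous_on U f \<and> (\<forall>x\<in>U. f differentiable (at x)) \<and>
      (\<forall>j. Ck_on k U (\<lambda>x. frechet_derivative f (at x) (axis j 1))))"

definition smooth_near0 :: "(real^'d::finite \<Rightarrow> real) \<Rightarrow> bool" where
  "smooth_near0 f \<longleftrightarrow> (\<exists>U. open U \<and> 0 \<in> U \<and> (\<forall>k. Ck_on k U f))"

definition strongly_subhomogeneous :: "(real^'d::finite \<Rightarrow> real) \<Rightarrow> real^'d^'d \<Rightarrow> nat \<Rightarrow> bool" where
  "strongly_subhomogeneous P E l \<longleftrightarrow> contracting E \<and>
     (\<exists>U. open U \<and> 0 \<in> U \<and> Ck_on l U P) \<and>
     (\<forall>\<epsilon>>0. \<forall>K. compact K \<longrightarrow>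
        (\<exists>\<tau>>0. \<forall>t. 0 < t \<and> t < \<tau> \<longrightarrow>
           (\<forall>\<xi>\<in>K. \<forall>k\<le>l. \<bar>t ^ k * (deriv ^^ k) (\<lambda>s. P (mpow s E \<xi>)) t\<bar> \<le> \<epsilon> * t)))"

definition poly_nolin :: "(real^'d::finite \<Rightarrow> real) \<Rightarrow> bool" where
  "poly_nolin P \<longleftrightarrow> (\<exists>B c. finite B \<and> (\<forall>\<beta>\<in>B. 2 \<le> sum \<beta> UNIV) \<and>
      (\<forall>\<xi>. P \<xi> = (\<Sum>\<beta>\<in>B. c \<beta> * rmono \<xi> \<beta>)))"

definition Gamma_rep ::
  "(int^'d::finite \<Rightarrow> complex) \<Rightarrow> real^'d \<Rightarrow> real^'d \<Rightarrow> (real^'d \<Rightarrow> real) \<Rightarrow> (real^'d \<Rightarrow> real)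
     \<Rightarrow> (real^'d \<Rightarrow> real) \<Rightarrow> (real^'d \<Rightarrow> real) \<Rightarrow> bool" where
  "Gamma_rep \<phi> \<xi>0 \<alpha> Q R Qt Rt \<longleftrightarrow>
     (\<exists>r>0. \<forall>\<xi>\<in>ball 0 r.
        Ln (fhat \<phi> (\<xi> + \<xi>0) / fhat \<phi> \<xi>0) =
          \<i> * complex_of_real (\<alpha> \<bullet> \<xi>) - \<i> * complex_of_real (Q \<xi> + Qt \<xi>)
          - complex_of_real (R \<xi> + Rt \<xi>))
     \<and> poly_nolin Q \<and> poly_nolin R \<and> smooth_near0 Qt \<and> smooth_near0 Rt \<and> Qt 0 = 0 \<and> Rt 0 = 0"

definition pos_type :: "(int^'d::finite \<Rightarrow> complex) \<Rightarrow> real^'d \<Rightarrow> real^'d \<Rightarrow> real \<Rightarrow> bool" where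
  "pos_type \<phi> \<xi>0 \<alpha> \<mu> \<longleftrightarrow> (\<exists>Q R Qt Rt E.
     Gamma_rep \<phi> \<xi>0 \<alpha> Q R Qt Rt \<and> positive_homogeneous R \<and> E \<in> ExpSet R \<and>
     homogeneous_wrt Q E \<and> subhomogeneous Qt E \<and> subhomogeneous Rt E \<and> \<mu> = hom_order R)"

definition imag_type :: "(int^'d::finite \<Rightarrow> complex) \<Rightarrow> real^'d \<Rightarrow> real^'d \<Rightarrow> real \<Rightarrow> bool" where
  "imag_type \<phi> \<xi>0 \<alpha> \<mu> \<longleftrightarrow> (\<exists>Q R Qt Rt E (k::real).
     Gamma_rep \<phi> \<xi>0 \<alpha> Q R Qt Rt \<and> positive_homogeneous (\<lambda>\<xi>. \<bar>Q \<xi>\<bar>) \<and>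
     positive_homogeneous R \<and> E \<in> ExpSet (\<lambda>\<xi>. \<bar>Q \<xi>\<bar>) \<and> 1 < k \<and>
     homogeneous_wrt R ((1 / k) *\<^sub>R E) \<and> strongly_subhomogeneous Qt E 2 \<and>
     strongly_subhomogeneous Rt ((1 / k) *\<^sub>R E) 1 \<and> \<mu> = hom_order (\<lambda>\<xi>. \<bar>Q \<xi>\<bar>))"

definition hom_type :: "(int^'d::finite \<Rightarrow> complex) \<Rightarrow> real^'d \<Rightarrow> bool" where
  "hom_type \<phi> \<xi>0 \<longleftrightarrow> (\<exists>\<alpha> \<mu>. pos_type \<phi> \<xi>0 \<alpha> \<mu> \<or> imag_type \<phi> \<xi>0 \<alpha> \<mu>)"

definition Omega_i :: "(int^'d::finite \<Rightarrow> complex) \<Rightarrow> (real^'d) set" where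
  "Omega_i \<phi> = {\<xi>\<in>Omega \<phi>. \<exists>\<alpha> \<mu>. imag_type \<phi> \<xi> \<alpha> \<mu>}"

definition type_order :: "(int^'d::finite \<Rightarrow> complex) \<Rightarrow> real^'d \<Rightarrow> real" where
  "type_order \<phi> \<xi>0 = (SOME \<mu>. \<exists>\<alpha>. pos_type \<phi> \<xi>0 \<alpha> \<mu> \<or> imag_type \<phi> \<xi>0 \<alpha> \<mu>)"

definition drift :: "(int^'d::finite \<Rightarrow> complex) \<Rightarrow> real^'d \<Rightarrow> real^'d" where
  "drift \<phi> \<xi>0 = (SOME \<alpha>. \<exists>\<mu>. pos_type \<phi> \<xi>0 \<alpha> \<mu> \<or> imag_type \<phi> \<xi>0 \<alpha> \<mu>)"

definition mu_phi :: "(int^'d::finite \<Rightarrow> complex) \<Rightarrow> real" where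
  "mu_phi \<phi> = Inf (type_order \<phi> ` Omega \<phi>)"

end

theory Submission
  imports Defs
begin


text \<open>
  Fourier inversion turns \<open>\<phi>\<^sup>(\<^sup>n\<^sup>)(x)\<close> into an integral of \<open>fhat \<phi> \<xi> ^ n * cis (- (x \<bullet> \<xi>))\<close> over a period box,
  of which only small neighbourhoods of the finitely many points with \<open>|fhat \<phi>| = 1\<close> contribute more than an
  exponentially small amount. At a point of positive type the modulus of the integrand is at most
  \<open>exp (- n R / 2)\<close>, which gives \<open>n powr (- \<mu>)\<close> by scaling. At a point of imaginary type, write \<open>\<xi> = e\<^bsup>sE\<^esup> \<eta>\<close> with
  \<open>\<eta>\<close> in the shell \<open>{1 \<le> |Q| \<le> e}\<close>: for fixed \<open>\<eta>\<close> this leaves a one-dimensional integral with amplitude at most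
  \<open>e\<^bsup>\<mu>s\<^esup>\<close> and phase \<open>\<approx> n e\<^sup>s\<close>. The part \<open>n e\<^sup>s \<le> const\<close> is \<open>O(n powr (- \<mu>))\<close> trivially, and one integration by parts
  handles the rest because \<open>\<mu> < 1\<close>. Since \<open>Q\<close> has no linear terms, \<open>e\<^bsup>sE\<^esup>\<close> grows at most like \<open>e\<^bsup>s/2\<^esup>\<close>,
  so the linear phase \<open>(x - n \<alpha>) \<bullet> \<xi>\<close> is a harmless perturbation as long as \<open>|x - n \<alpha>|\<close> is at most a constant plus a
  small power of \<open>n\<close>.

  For the lower bound, pair \<open>\<phi>\<^sup>(\<^sup>n\<^sup>)\<close> with the squared Fourier coefficients of the indicator of \<open>n\<^bsup>-E\<^esup> B\<close> for a small
  ball \<open>B\<close>. Bessel's inequality bounds their sum by a multiple of the volume of \<open>n\<^bsup>-E\<^esup> B\<close>, which is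
  proportional to \<open>n powr (- \<mu>)\<close>, while the pairing is a double integral over \<open>n\<^bsup>-E\<^esup> B\<close> whose integrand stays close to
  a constant of modulus one.
\<close>

section \<open>One-parameter groups of matrices\<close>

text \<open>Three obstacles shape the development. First, the compact sets must exhaust the space,
  so it is not enough to absorb linear phases of bounded size: they have to be absorbed up to size
  n^a for one fixed a > 0, and this a is the contraction rate of the dilations. Second, homogeneous
  order, order of a point and drift are values picked by \<open>SOME\<close>, while a point may be
  represented in several ways. The trace is shown to be independent of the exponent and the drift
  independent of the representation; for the order of a point it suffices that the picked value
  belongs to some representation, which then carries its own estimates. Third, \<open>Omega\<close>
  lives in a half-open box and may meet its faces, where a point has no full neighbourhood inside
  the box. By periodicity all points of modulus one can be treated alike, and the period box is
  shifted until its boundary misses them.\<close>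

lemma bounded_bilinear_matrix_matrix_mult:
  "bounded_bilinear ((**) :: real^'n::finite^'m::finite \<Rightarrow> real^'p::finite^'n \<Rightarrow> real^'p^'m)"
  unfolding bilinear_conv_bounded_bilinear[symmetric] bilinear_def
  by (auto intro!: linearI simp: vec_eq_iff matrix_matrix_mult_def sum.distrib algebra_simps sum_distrib_left)

lemma bounded_bilinear_matrix_vector_mult:
  "bounded_bilinear ((*v) :: real^'n::finite^'m::finite \<Rightarrow> real^'n \<Rightarrow> real^'m)"
  unfolding bilinear_conv_bounded_bilinear[symmetric] bilinear_def
  by (auto intro!: linearI simp: vec_eq_iff matrix_vector_mult_def sum.distrib algebra_simps sum_distrib_left)

lemma matpow_scaleR: "matpow (s *\<^sub>R E) k = s ^ k *\<^sub>R matpow E k"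
  by (induction k) (auto simp: vec_eq_iff matrix_matrix_mult_def sum_distrib_left algebra_simps)

lemma matpow_commute: "matpow E k ** E = E ** matpow E k"
  by (induction k) (auto simp: matrix_mul_assoc[symmetric])

lemma norm_matpow_le:
  fixes E :: "real^'d::finite^'d"
  obtains M b where "\<And>k. norm (matpow E k) \<le> M * b ^ k"
proof -
  obtain K where K: "K > 0" "\<And>(A :: real^'d^'d) (B :: real^'d^'d). norm (A ** B) \<le> norm A * norm B * K"
    using bounded_bilinear.pos_bounded[OF bounded_bilinear_matrix_matrix_mult] by blast
  have "norm (matpow E k) \<le> norm (mat 1 :: real^'d^'d) * (norm E * K) ^ k" for k
  proof (induction k)
    case (Suc k)
    have "norm (matpow E (Suc k)) \<le> norm (matpow E k) * (norm E * K)"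
      using K(2)[of "matpow E k" E] by (simp add: mult_ac)
    also have "\<dots> \<le> (norm (mat 1 :: real^'d^'d) * (norm E * K) ^ k) * (norm E * K)"
      using Suc K by (intro mult_right_mono) auto
    finally show ?case by (simp add: mult_ac)
  qed simp
  thus ?thesis by (rule that)
qed

lemma summable_mexp:
  fixes E :: "real^'d::finite^'d"
  shows "summable (\<lambda>k. (1 / fact k) *\<^sub>R matpow (s *\<^sub>R E) k)"
proof -
  obtain M b where Mb: "\<And>k. norm (matpow E k) \<le> M * b ^ k"
    using norm_matpow_le by blast
  show ?thesis
  proof (rule summable_comparison_test')
    show "summable (\<lambda>k. M * (inverse (fact k) * (\<bar>s\<bar> * b) ^ k))"
      by (intro summable_mult summable_exp)
    show "norm ((1 / fact k) *\<^sub>R matpow (s *\<^sub>R E) k) \<le> M * (inverse (fact k) * (\<bar>s\<bar> * b) ^ k)" for k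
      using mult_left_mono[OF Mb[of k], of "\<bar>s\<bar> ^ k / fact k"]
      by (simp add: matpow_scaleR power_abs field_simps)
  qed
qed

lemma mexp_scaleR_nth:
  fixes E :: "real^'d::finite^'d"
  shows "(\<lambda>k. matpow E k $ i $ j / fact k * s ^ k) sums (mexp (s *\<^sub>R E) $ i $ j)"
proof -
  have "(\<lambda>k. (1 / fact k) *\<^sub>R matpow (s *\<^sub>R E) k) sums mexp (s *\<^sub>R E)"
    unfolding mexp_def by (rule summable_sums[OF summable_mexp])
  from sums_vec_nth[OF sums_vec_nth[OF this], of i j]
  show ?thesis by (simp add: matpow_scaleR mult_ac)
qed

lemma has_vector_derivative_matrix_componentwise:
  fixes f :: "real \<Rightarrow> real^'n^'m"
  assumes "\<And>i j. ((\<lambda>x. f x $ i $ j) has_real_derivative f' $ i $ j) (at s)"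
  shows "(f has_vector_derivative f') (at s)"
  unfolding has_vector_derivative_def
  by (subst has_derivative_componentwise_within)
     (use assms in \<open>auto simp: Basis_vec_def inner_axis has_field_derivative_def mult.commute[of _ "f' $ _ $ _"]\<close>)

lemma mexp_has_vector_derivative:
  fixes E :: "real^'d::finite^'d"
  shows "((\<lambda>s. mexp (s *\<^sub>R E)) has_vector_derivative mexp (s *\<^sub>R E) ** E) (at s)"
proof (rule has_vector_derivative_matrix_componentwise)
  fix i j
  let ?c = "\<lambda>k. matpow E k $ i $ j / fact k"
  have eq: "mexp (s *\<^sub>R E) $ i $ j = (\<Sum>k. ?c k * s ^ k)" for s
    using mexp_scaleR_nth[of E i j s] by (simp add: sums_iff)
  \<comment> \<open>\<open>diffs\<close> shifts the index by one: (n+1) E^(n+1) / (n+1)! equals E^n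
    E / n!, which supplies the factor E of the derivative.\<close>
  have d: "diffs ?c n = (matpow E n ** E) $ i $ j / fact n" for n
    by (simp add: diffs_def fact_Suc field_simps del: of_nat_Suc)
  have "((\<lambda>x. \<Sum>k. ?c k * x ^ k) has_real_derivative (\<Sum>k. diffs ?c k * s ^ k)) (at s)"
    using mexp_scaleR_nth[of E i j] by (intro termdiffs_strong_converges_everywhere) (auto simp: sums_iff)
  moreover have "(\<lambda>k. diffs ?c k * s ^ k) sums (mexp (s *\<^sub>R E) ** E) $ i $ j"
  proof -
    have "(\<lambda>k. \<Sum>l\<in>UNIV. (matpow E k $ i $ l / fact k * s ^ k) * E $ l $ j) sums
        (\<Sum>l\<in>UNIV. mexp (s *\<^sub>R E) $ i $ l * E $ l $ j)"
      by (intro sums_sum sums_mult2 mexp_scaleR_nth)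
    thus ?thesis
      unfolding d by (simp add: matrix_matrix_mult_def sum_distrib_left sum_distrib_right sum_divide_distrib mult_ac)
  qed
  ultimately show "((\<lambda>x. mexp (x *\<^sub>R E) $ i $ j) has_real_derivative (mexp (s *\<^sub>R E) ** E) $ i $ j) (at s)"
    unfolding eq by (simp add: sums_iff)
qed

lemma mexp_0 [simp]: "mexp (0 :: real^'d::finite^'d) = mat 1"
proof -
  have "matpow (0::real^'d^'d) k = (if k = 0 then mat 1 else 0)" for k
    by (cases k) (auto simp: vec_eq_iff matrix_matrix_mult_def)
  hence "(\<lambda>k. (1 / fact k) *\<^sub>R matpow (0::real^'d^'d) k) = (\<lambda>k. if k = 0 then mat 1 else 0)"
    by auto
  moreover have "(\<lambda>k. if k = 0 then mat 1 else 0) sums (mat 1 :: real^'d^'d)"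
    using sums_single[of 0 "\<lambda>_. mat 1 :: real^'d^'d"] by simp
  ultimately show ?thesis unfolding mexp_def by (simp add: sums_iff)
qed

lemma mexp_commute:
  fixes E :: "real^'d::finite^'d"
  shows "mexp (s *\<^sub>R E) ** E = E ** mexp (s *\<^sub>R E)"
proof -
  have s: "(\<lambda>k. (1 / fact k) *\<^sub>R matpow (s *\<^sub>R E) k) sums mexp (s *\<^sub>R E)"
    unfolding mexp_def by (rule summable_sums[OF summable_mexp])
  note bb = bounded_bilinear_matrix_matrix_mult
  have "(\<lambda>k. ((1 / fact k) *\<^sub>R matpow (s *\<^sub>R E) k) ** E) sums (mexp (s *\<^sub>R E) ** E)"
    by (rule bounded_linear.sums[OF bounded_bilinear.bounded_linear_left[OF bb] s])
  moreover have "(\<lambda>k. E ** ((1 / fact k) *\<^sub>R matpow (s *\<^sub>R E) k)) sums (E ** mexp (s *\<^sub>R E))"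
    by (rule bounded_linear.sums[OF bounded_bilinear.bounded_linear_right[OF bb] s])
  moreover have "((1 / fact k) *\<^sub>R matpow (s *\<^sub>R E) k) ** E = E ** ((1 / fact k) *\<^sub>R matpow (s *\<^sub>R E) k)" for k
    by (simp add: matpow_scaleR bounded_bilinear.scaleR_left[OF bb] bounded_bilinear.scaleR_right[OF bb]
        matpow_commute)
  ultimately show ?thesis by (simp add: sums_iff)
qed

text \<open>For fixed r the product e^((r-u)E) e^(uE) has derivative 0 in u, because E commutes with
  its exponential; compare u = t with u = 0 for r = s + t.\<close>

lemma mexp_add:
  fixes E :: "real^'d::finite^'d"
  shows "mexp ((s + t) *\<^sub>R E) = mexp (s *\<^sub>R E) ** mexp (t *\<^sub>R E)"
proof -
  note bb = bounded_bilinear_matrix_matrix_mult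
  have const: "mexp ((r - u) *\<^sub>R E) ** mexp (u *\<^sub>R E) = mexp (r *\<^sub>R E)" for r u
  proof -
    let ?g = "\<lambda>u. mexp ((r - u) *\<^sub>R E) ** mexp (u *\<^sub>R E)"
    have "(?g has_vector_derivative 0) (at u)" for u
    proof -
      have "((\<lambda>u. mexp ((r - u) *\<^sub>R E)) has_vector_derivative (- 1) *\<^sub>R (mexp ((r - u) *\<^sub>R E) ** E)) (at u)"
      proof -
        have "((\<lambda>u. r - u) has_vector_derivative - 1) (at u)"
          by (auto intro!: derivative_eq_intros)
        from vector_diff_chain_at[OF this mexp_has_vector_derivative[of E "r - u"]]
        show ?thesis by (simp add: o_def)
      qed
      from bounded_bilinear.has_vector_derivative[OF bb this mexp_has_vector_derivative]
      have "(?g has_vector_derivative mexp ((r - u) *\<^sub>R E) ** (mexp (u *\<^sub>R E) ** E)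
         + ((- 1) *\<^sub>R (mexp ((r - u) *\<^sub>R E) ** E)) ** mexp (u *\<^sub>R E)) (at u)" .
      moreover have "mexp ((r - u) *\<^sub>R E) ** (mexp (u *\<^sub>R E) ** E)
         + ((- 1) *\<^sub>R (mexp ((r - u) *\<^sub>R E) ** E)) ** mexp (u *\<^sub>R E) = 0"
        by (simp add: mexp_commute bounded_bilinear.minus_left[OF bb] matrix_mul_assoc)
      ultimately show ?thesis by simp
    qed
    hence "?g u = ?g 0"
      by (intro has_derivative_zero_unique[of UNIV]) (auto simp: has_vector_derivative_def)
    thus ?thesis by simp
  qed
  show ?thesis using const[of "s + t" t] by simp
qed

section \<open>Determinant of the exponential\<close>

lemma det_has_derivative_mat_1:
  fixes f :: "real \<Rightarrow> real^'n::finite^'n"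
  assumes "(f has_vector_derivative f') (at x)" "f x = mat 1"
  shows "((\<lambda>s. det (f s)) has_real_derivative trace f') (at x)"
proof -
  have comp: "((\<lambda>s. f s $ i $ j) has_real_derivative f' $ i $ j) (at x)" for i j
  proof -
    have "bounded_linear (\<lambda>M::real^'n^'n. M $ i $ j)"
      by (rule bounded_linear_compose[OF bounded_linear_vec_nth bounded_linear_vec_nth])
    from bounded_linear.has_vector_derivative[OF this assms(1)]
    show ?thesis by (simp add: has_real_derivative_iff_has_vector_derivative)
  qed
  let ?D = "\<lambda>p. of_int (sign p) * (\<Sum>i\<in>UNIV. f' $ i $ p i * (\<Prod>j\<in>UNIV - {i}. f x $ j $ p j))"
  have "((\<lambda>s. det (f s)) has_real_derivative (\<Sum>p | p permutes (UNIV::'n set). ?D p)) (at x)"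
    unfolding det_def
    by (intro DERIV_sum DERIV_cmult has_field_derivative_prod comp)
  moreover have "?D p = (if p = id then trace f' else 0)" if p: "p permutes (UNIV::'n set)" for p
  proof (cases "p = id")
    case True
    thus ?thesis by (simp add: assms(2) mat_def trace_def)
  next
    case False
    then obtain a where a: "p a \<noteq> a" by (auto simp: fun_eq_iff)
    have "(\<Prod>j\<in>UNIV - {i}. f x $ j $ p j) = 0" for i
    proof -
      \<comment> \<open>A permutation other than the identity moves at least two points, so a moved
        point survives the removal of i and leaves an off-diagonal zero of the identity matrix in
        the product.\<close>
      have "\<exists>j. j \<noteq> i \<and> p j \<noteq> j"
        using a p by (metis permutes_def)
      then obtain j where "j \<noteq> i" "p j \<noteq> j" by blast
      thus ?thesis by (intro prod_zero bexI[of _ j]) (auto simp: assms(2) mat_def)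
    qed
    hence "?D p = 0" by (simp only: mult_zero_right sum.neutral_const)
    thus ?thesis using False by simp
  qed
  hence "(\<Sum>p | p permutes (UNIV::'n set). ?D p) = (\<Sum>p | p permutes (UNIV::'n set). if p = id then trace f' else 0)"
    by (intro sum.cong) auto
  moreover have "\<dots> = trace f'"
    by (subst sum.delta) (auto simp: finite_permutations permutes_id)
  ultimately show ?thesis by simp
qed

text \<open>Liouville's formula: the group law reduces the derivative at s to the one at 0, so det
  e^(sE) solves g' = (tr E) g and its product with e^(-s tr E) is constant.\<close>

lemma det_mexp:
  fixes E :: "real^'d::finite^'d"
  shows "det (mexp (s *\<^sub>R E)) = exp (s * trace E)"
proof -
  let ?g = "\<lambda>s. det (mexp (s *\<^sub>R E)) * exp (- s * trace E)"
  have "(?g has_real_derivative 0) (at s)" for s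
  proof -
    have "((\<lambda>u. mexp (u *\<^sub>R E)) has_vector_derivative E) (at 0)"
      using mexp_has_vector_derivative[of E 0] by simp
    hence d0: "((\<lambda>u. det (mexp (u *\<^sub>R E))) has_real_derivative trace E) (at 0)"
      by (rule det_has_derivative_mat_1) simp
    have "((\<lambda>u. det (mexp ((u - s) *\<^sub>R E))) has_real_derivative trace E) (at s)"
    proof -
      have "((\<lambda>u. u - s) has_real_derivative 1) (at s)"
        by (auto intro!: derivative_eq_intros)
      moreover have "((\<lambda>u. det (mexp (u *\<^sub>R E))) has_real_derivative trace E) (at (s - s))"
        using d0 by simp
      ultimately show ?thesis
        using DERIV_chain2[of "\<lambda>u. det (mexp (u *\<^sub>R E))" "trace E" "\<lambda>u. u - s" s 1 UNIV] by simp
    qed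
    hence "((\<lambda>u. det (mexp (s *\<^sub>R E)) * det (mexp ((u - s) *\<^sub>R E))) has_real_derivative
        det (mexp (s *\<^sub>R E)) * trace E) (at s)"
      by (rule DERIV_cmult)
    moreover have "det (mexp (s *\<^sub>R E)) * det (mexp ((u - s) *\<^sub>R E)) = det (mexp (u *\<^sub>R E))" for u
      using mexp_add[of s "u - s" E] by (simp add: det_mul)
    ultimately have "((\<lambda>u. det (mexp (u *\<^sub>R E))) has_real_derivative det (mexp (s *\<^sub>R E)) * trace E) (at s)"
      by simp
    thus ?thesis
      by (auto intro!: derivative_eq_intros)
  qed
  hence "?g s = ?g 0" by (intro DERIV_isconst_all) auto
  thus ?thesis by (simp add: exp_minus field_simps)
qed


section \<open>Lebesgue measure under linear maps\<close>

text \<open>The library version of this change of variables requires a well-ordered index type.\<close>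

lemma emeasure_lborel_shear:
  fixes m n :: "'n::finite"
  assumes mn: "m \<noteq> n" and S: "S \<in> sets borel"
  shows "emeasure lborel ((\<lambda>x::real^'n. \<chi> i. if i = m then x$m + x$n else x$i) -` S) = emeasure lborel S"
proof -
  define h where "h = (\<lambda>x::real^'n. \<chi> i. if i = m then x$m + x$n else x$i)"
  define g where "g = (\<lambda>x::real^'n. \<chi> i. if i = m then x$m - x$n else x$i)"
  have hg: "h (g x) = x" "g (h x) = x" for x
    using mn by (auto simp: h_def g_def vec_eq_iff)
  have lin: "linear h" "linear g"
    by (auto intro!: linearI simp: h_def g_def vec_eq_iff algebra_simps)
  have meas: "h \<in> borel_measurable borel" "g \<in> borel_measurable borel"
    using lin by (auto intro!: borel_measurable_continuous_onI linear_continuous_on simp: linear_conv_bounded_linear)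
  \<comment> \<open>The shear formula for boxes asks for a nonnegative lower bound in coordinate n;
    translating to lower corner 0 provides it.\<close>
  have hbox: "measure lebesgue (h ` cbox a b) = 1 * measure lebesgue (cbox a b)" for a b
  proof (cases "cbox a b = {}")
    case False
    hence ne: "cbox 0 (b - a) \<noteq> {}" by (simp add: interval_ne_empty_cart)
    have "cbox a b = (+) a ` cbox 0 (b - a)"
      by (simp flip: cbox_translation)
    hence "h ` cbox a b = (+) (h a) ` (h ` cbox 0 (b - a))"
      by (simp add: image_image linear_add[OF lin(1)])
    hence "measure lebesgue (h ` cbox a b) = measure lebesgue (h ` cbox 0 (b - a))"
      by (simp only: measure_translation)
    also have "\<dots> = measure lebesgue (cbox 0 (b - a))"
      unfolding h_def using measure_shear_interval[OF mn ne] by simp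
    also have "\<dots> = measure lebesgue (cbox a b)"
      using \<open>cbox a b = _\<close> measure_translation[of a "cbox 0 (b - a)"] by simp
    finally show ?thesis by simp
  qed simp
  have img: "g -` T = h ` T" for T
    using hg by (auto simp: image_iff) metis
  have lb: "lborel = distr lborel borel g"
  proof (rule lborel_eqI)
    fix l u :: "real^'n" assume le: "\<And>b. b \<in> Basis \<Longrightarrow> l \<bullet> b \<le> u \<bullet> b"
    have "h ` box l u \<in> lmeasurable \<and> 1 * measure lebesgue (box l u) = measure lebesgue (h ` box l u)"
      by (rule measure_linear_sufficient[OF lin(1) _ hbox]) simp
    moreover have b: "h ` box l u \<in> sets borel"
      using measurable_sets[OF meas(2), of "box l u"] by (simp add: img)
    ultimately have "emeasure lborel (h ` box l u) = emeasure lborel (box l u)"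
      using emeasure_lborel_box_finite[of l u]
      by (simp add: fmeasurable_def measure_def) (metis ennreal_enn2real)
    moreover have "emeasure (distr lborel borel g) (box l u) = emeasure lborel (h ` box l u)"
      using meas by (subst emeasure_distr) (auto simp: img)
    ultimately show "emeasure (distr lborel borel g) (box l u) = (\<Prod>b\<in>Basis. (u - l) \<bullet> b)"
      using le by simp
  qed simp
  have "h -` S \<in> sets borel"
    using measurable_sets[OF meas(1) S] by simp
  have "emeasure lborel (h -` S) = emeasure (distr lborel borel g) (h -` S)"
    using lb by simp
  also have "\<dots> = emeasure lborel S"
    using meas \<open>h -` S \<in> sets borel\<close> by (subst emeasure_distr) (auto simp: vimage_def hg)
  finally show ?thesis by (simp add: h_def)
qed

lemma det_matrix_shear:
  fixes m n :: "'n::finite"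
  assumes "m \<noteq> n"
  shows "det (matrix (\<lambda>x::real^'n. \<chi> i. if i = m then x$m + x$n else x$i)) = 1"
proof -
  have "matrix (\<lambda>x::real^'n. \<chi> i. if i = m then x$m + x$n else x$i) =
      (\<chi> k. if k = m then row m (mat 1) + 1 *s row n (mat 1) else row k (mat 1))"
    by (auto simp: matrix_def vec_eq_iff row_def axis_def mat_def)
  thus ?thesis by (simp only: det_row_operation[OF assms] det_I)
qed

lemma emeasure_lborel_swap:
  fixes m n :: "'n::finite"
  assumes S: "S \<in> sets borel"
  shows "emeasure lborel ((\<lambda>x::real^'n. \<chi> i. x $ Transposition.transpose m n i) -` S) = emeasure lborel S"
proof -
  define h where "h = (\<lambda>x::real^'n. \<chi> i. x $ Transposition.transpose m n i)"
  have meas: "h \<in> borel_measurable borel"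
    unfolding h_def by (intro borel_measurable_continuous_onI continuous_intros)
  have "lborel = distr lborel borel h"
  proof (rule lborel_eqI)
    fix l u :: "real^'n" assume le: "\<And>b. b \<in> Basis \<Longrightarrow> l \<bullet> b \<le> u \<bullet> b"
    hence le': "l $ i \<le> u $ i" for i
      using le[of "axis i 1"] by (auto simp: Basis_vec_def inner_axis)
    have "h -` box l u = box (h l) (h u)"
      by (auto simp: h_def mem_box_cart) (metis transpose_involutory)+
    hence "emeasure (distr lborel borel h) (box l u) = emeasure lborel (box (h l) (h u))"
      using meas by (subst emeasure_distr) auto
    also have "\<dots> = ennreal (\<Prod>i\<in>UNIV. (u - l) $ Transposition.transpose m n i)"
      using le' by (subst emeasure_lborel_box) (auto simp: Basis_vec_def inner_axis h_def
        prod.UNION_disjoint axis_eq_axis UNION_singleton_eq_range prod.reindex inj_on_def)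
    also have "(\<Prod>i\<in>UNIV. (u - l) $ Transposition.transpose m n i) = (\<Prod>i\<in>UNIV. (u - l) $ i)"
      using prod.permute[OF permutes_swap_id[of m UNIV n], of "\<lambda>i. (u - l) $ i"] by (simp add: o_def)
    also have "\<dots> = (\<Prod>b\<in>Basis. (u - l) \<bullet> b)"
      by (auto simp: Basis_vec_def inner_axis UNION_singleton_eq_range prod.reindex inj_on_def axis_eq_axis)
    finally show "emeasure (distr lborel borel h) (box l u) = (\<Prod>b\<in>Basis. (u - l) \<bullet> b)" .
  qed simp
  hence "emeasure lborel S = emeasure (distr lborel borel h) S" by simp
  also have "\<dots> = emeasure lborel (h -` S)"
    using meas S by (subst emeasure_distr) auto
  finally show ?thesis by (simp add: h_def)
qed

text \<open>Induction over compositions of elementary maps. Preimages keep measurability immediate,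
  and with det \<noteq> 0 inside the induction predicate the map with a zero row is vacuous, while a
  nonzero determinant of a composition passes to both factors.\<close>

lemma emeasure_lborel_vimage_linear:
  fixes f :: "real^'n::finite \<Rightarrow> real^'n"
  assumes "linear f" "det (matrix f) \<noteq> 0" "S \<in> sets borel"
  shows "emeasure lborel (f -` S) * ennreal \<bar>det (matrix f)\<bar> = emeasure lborel S"
proof -
  let ?P = "\<lambda>f::real^'n \<Rightarrow> real^'n. det (matrix f) \<noteq> 0 \<longrightarrow>
    (\<forall>S\<in>sets borel. emeasure lborel (f -` S) * ennreal \<bar>det (matrix f)\<bar> = emeasure lborel S)"
  have "?P f"
  proof (rule induct_linear_elementary[OF assms(1)])
    fix f g :: "real^'n \<Rightarrow> real^'n"
    assume lin: "linear f" "linear g" and P: "?P f" "?P g"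
    have det: "det (matrix (f \<circ> g)) = det (matrix f) * det (matrix g)"
      by (simp add: matrix_compose lin det_mul)
    have f: "f \<in> borel_measurable borel"
      using lin by (auto intro!: borel_measurable_continuous_onI linear_continuous_on simp: linear_conv_bounded_linear)
    show "?P (f \<circ> g)"
    proof (intro impI ballI)
      fix S :: "(real^'n) set"
      assume "det (matrix (f \<circ> g)) \<noteq> 0" and S: "S \<in> sets borel"
      moreover have "f -` S \<in> sets borel" using measurable_sets[OF f S] by simp
      ultimately have "emeasure lborel (g -` (f -` S)) * ennreal \<bar>det (matrix g)\<bar> * ennreal \<bar>det (matrix f)\<bar> = emeasure lborel S"
        using P det by auto
      thus "emeasure lborel ((f \<circ> g) -` S) * ennreal \<bar>det (matrix (f \<circ> g))\<bar> = emeasure lborel S"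
        by (simp add: det abs_mult ennreal_mult vimage_comp mult_ac)
    qed
  next
    fix f :: "real^'n \<Rightarrow> real^'n" and i
    assume "linear f" "\<And>x. f x $ i = 0"
    hence "row i (matrix f) = 0" by (simp add: row_def matrix_def vec_eq_iff)
    thus "?P f" by (simp add: det_zero_row)
  next
    fix c :: "'n \<Rightarrow> real"
    let ?f = "\<lambda>x::real^'n. \<chi> i. c i * x $ i"
    have det: "det (matrix ?f) = prod c UNIV"
      by (subst det_diagonal) (auto simp: matrix_def axis_def)
    show "?P ?f"
    proof (intro impI ballI)
      fix S :: "(real^'n) set"
      assume "det (matrix ?f) \<noteq> 0" and S: "S \<in> sets borel"
      hence c: "c i \<noteq> 0" for i using det by auto
      \<comment> \<open>\<open>c'\<close> moves the coefficients from the index type to the basis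
        vectors, over which the affine change of variables takes its product.\<close>
      define c' where "c' = (\<lambda>b::real^'n. c (THE i. b = axis i 1))"
      have c': "c' (axis i 1) = c i" for i by (simp add: c'_def axis_eq_axis)
      have meas: "?f \<in> borel_measurable borel"
        by (intro borel_measurable_continuous_onI continuous_intros)
      have "(\<lambda>x. 0 + (\<Sum>j\<in>Basis. (c' j * (x \<bullet> j)) *\<^sub>R j)) = ?f"
      proof
        fix x :: "real^'n"
        have "(\<Sum>j\<in>Basis. (c' j * (x \<bullet> j)) *\<^sub>R j) = (\<Sum>i\<in>UNIV. (c i * x $ i) *\<^sub>R axis i 1)"
          by (auto simp: Basis_vec_def UNION_singleton_eq_range sum.reindex inj_on_def axis_eq_axis c' inner_axis)
        thus "0 + (\<Sum>j\<in>Basis. (c' j * (x \<bullet> j)) *\<^sub>R j) = ?f x"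
          by (simp add: vec_eq_iff axis_def if_distrib cong: if_cong)
      qed
      moreover have "(\<Prod>j\<in>Basis. \<bar>c' j\<bar>) = \<bar>prod c UNIV\<bar>"
        by (auto simp: Basis_vec_def UNION_singleton_eq_range prod.reindex inj_on_def axis_eq_axis c' abs_prod)
      moreover have "c' j \<noteq> 0" if "j \<in> Basis" for j
        using that c by (auto simp: Basis_vec_def c')
      ultimately have "lborel = density (distr lborel borel ?f) (\<lambda>_. \<bar>prod c UNIV\<bar>)"
        using lborel_affine_euclidean[of c' 0] by simp
      hence "emeasure lborel S = emeasure (density (distr lborel borel ?f) (\<lambda>_. \<bar>prod c UNIV\<bar>)) S"
        by simp
      also have "\<dots> = \<bar>prod c UNIV\<bar> * emeasure (distr lborel borel ?f) S"
        using S by (subst emeasure_density) (auto simp: nn_integral_cmult_indicator)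
      also have "emeasure (distr lborel borel ?f) S = emeasure lborel (?f -` S)"
        using meas S by (subst emeasure_distr) auto
      finally show "emeasure lborel (?f -` S) * ennreal \<bar>det (matrix ?f)\<bar> = emeasure lborel S"
        by (simp add: det mult.commute)
    qed
  next
    fix m n :: 'n
    assume "m \<noteq> n"
    let ?h = "\<lambda>v::real^'n. \<chi> i. v $ Transposition.transpose m n i"
    have "matrix ?h = transpose (\<chi> i j. mat 1 $ i $ Transposition.transpose m n j)"
      by (auto simp: matrix_def transpose_def axis_def mat_def vec_eq_iff)
    hence "\<bar>det (matrix ?h)\<bar> = 1"
      by (simp add: det_permute_columns permutes_swap_id sign_swap_id abs_mult)
    thus "?P ?h" using emeasure_lborel_swap[of _ m n] by simp
  next
    fix m n :: 'n
    assume mn: "m \<noteq> n"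
    show "?P (\<lambda>x. \<chi> i. if i = m then x$m + x$n else x$i)"
      unfolding det_matrix_shear[OF mn] using emeasure_lborel_shear[OF mn] by auto
  qed
  thus ?thesis using assms by simp
qed

lemma lborel_distr_matrix:
  fixes A :: "real^'n::finite^'n"
  assumes "det A \<noteq> 0"
  shows "lborel = density (distr lborel borel ((*v) A)) (\<lambda>_. ennreal \<bar>det A\<bar>)"
proof (rule measure_eqI)
  fix S :: "(real^'n) set" assume "S \<in> sets lborel"
  hence S: "S \<in> sets borel" by simp
  have meas: "(*v) A \<in> borel_measurable borel"
    by (intro borel_measurable_continuous_onI matrix_vector_mult_linear_continuous_on)
  have "emeasure (density (distr lborel borel ((*v) A)) (\<lambda>_. ennreal \<bar>det A\<bar>)) S
      = \<bar>det A\<bar> * emeasure (distr lborel borel ((*v) A)) S"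
    using S by (subst emeasure_density) (auto simp: nn_integral_cmult_indicator)
  also have "emeasure (distr lborel borel ((*v) A)) S = emeasure lborel ((*v) A -` S)"
    using meas S by (subst emeasure_distr) auto
  finally show "emeasure lborel S = emeasure (density (distr lborel borel ((*v) A)) (\<lambda>_. ennreal \<bar>det A\<bar>)) S"
    using emeasure_lborel_vimage_linear[of "(*v) A" S] assms S by (simp add: mult.commute)
qed simp

lemma lborel_integral_matrix:
  fixes A :: "real^'n::finite^'n" and f :: "real^'n \<Rightarrow> 'b::{banach, second_countable_topology}"
  assumes "det A \<noteq> 0" and [measurable]: "f \<in> borel_measurable borel"
  shows "integral\<^sup>L lborel f = \<bar>det A\<bar> *\<^sub>R (\<integral>x. f (A *v x) \<partial>lborel)"
proof -
  have [measurable]: "(*v) A \<in> borel_measurable borel"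
    by (intro borel_measurable_continuous_onI matrix_vector_mult_linear_continuous_on)
  show ?thesis
    by (subst lborel_distr_matrix[OF assms(1)])
       (simp add: integral_density integral_distr)
qed

lemma measure_lborel_matrix_image:
  fixes A :: "real^'n::finite^'n"
  assumes "det A \<noteq> 0" and S: "S \<in> sets borel"
  shows "measure lborel ((*v) A ` S) = \<bar>det A\<bar> * measure lborel S" and "(*v) A ` S \<in> sets borel"
proof -
  obtain B where inv: "B ** A = mat 1" "A ** B = mat 1"
    using assms invertible_det_nz unfolding invertible_def by blast
  hence img: "(*v) A ` S = (*v) (B) -` S"
    by (auto simp: image_iff matrix_vector_mul_assoc intro!: bexI[of _ "B *v _"])
  have meas: "(*v) (B) \<in> borel_measurable borel"
    by (intro borel_measurable_continuous_onI matrix_vector_mult_linear_continuous_on)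
  show "(*v) A ` S \<in> sets borel"
    unfolding img using measurable_sets[OF meas S] by simp
  have d: "det (B) * det A = 1" using inv by (metis det_I det_mul)
  hence "det (B) \<noteq> 0" by auto
  from emeasure_lborel_vimage_linear[of "(*v) (B)" S] this S
  have e: "emeasure lborel ((*v) A ` S) * ennreal \<bar>det B\<bar> = emeasure lborel S"
    by (simp add: img)
  have "measure lborel S = measure lborel ((*v) A ` S) * \<bar>det B\<bar>"
    unfolding measure_def e[symmetric] by (simp add: enn2real_mult)
  hence "measure lborel ((*v) A ` S) * \<bar>det B * det A\<bar> = \<bar>det A\<bar> * measure lborel S"
    by (simp add: abs_mult)
  thus "measure lborel ((*v) A ` S) = \<bar>det A\<bar> * measure lborel S" using d by simp
qed


section \<open>Polar integration and oscillatory integrals\<close>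

text \<open>The norm on matrices is the Frobenius norm, so this is Cauchy-Schwarz row by
  row.\<close>

lemma norm_matrix_vector_mult_le:
  fixes A :: "real^'n::finite^'m::finite"
  shows "norm (A *v x) \<le> norm A * norm x"
proof -
  have "norm (A *v x) \<le> L2_set (\<lambda>i. norm (A $ i) * norm x) UNIV"
    unfolding norm_vec_def[of "A *v x"]
    by (intro L2_set_mono) (auto simp: matrix_vector_mul_component intro: Cauchy_Schwarz_ineq2)
  also have "\<dots> = norm A * norm x"
    by (simp add: norm_vec_def[of A] L2_set_left_distrib)
  finally show ?thesis .
qed

lemma mexp_add_mv: "mexp (s *\<^sub>R E) *v (mexp (t *\<^sub>R E) *v x) = mexp ((s + t) *\<^sub>R E) *v x"
  by (simp add: mexp_add matrix_vector_mul_assoc)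

lemma mexp_inverse_mv [simp]:
  "mexp (s *\<^sub>R E) *v (mexp ((- s) *\<^sub>R E) *v x) = x" "mexp ((- s) *\<^sub>R E) *v (mexp (s *\<^sub>R E) *v x) = x"
  "mexp (s *\<^sub>R E) *v (mexp (- (s *\<^sub>R E)) *v x) = x" "mexp (- (s *\<^sub>R E)) *v (mexp (s *\<^sub>R E) *v x) = x"
  using mexp_add_mv[of s E "- s" x] mexp_add_mv[of "- s" E s x] by auto

lemma continuous_on_mexp: "continuous_on S (\<lambda>s. mexp (s *\<^sub>R E))"
  by (intro continuous_at_imp_continuous_on ballI has_vector_derivative_continuous[OF mexp_has_vector_derivative])

lemma continuous_on_mexp_mv [continuous_intros]:
  assumes "continuous_on S f" "continuous_on S g"
  shows "continuous_on S (\<lambda>x. mexp (f x *\<^sub>R E) *v g x)"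
  using bounded_bilinear.continuous_on[OF bounded_bilinear_matrix_vector_mult
      continuous_on_compose2[OF continuous_on_mexp[of UNIV E] assms(1)] assms(2)] by simp

lemma mexp_mv_has_vector_derivative:
  "((\<lambda>s. mexp (s *\<^sub>R E) *v x) has_vector_derivative mexp (s *\<^sub>R E) *v (E *v x)) (at s)"
proof -
  have "bounded_linear (\<lambda>A. A *v x)"
    by (rule bounded_bilinear.bounded_linear_left[OF bounded_bilinear_matrix_vector_mult])
  from bounded_linear.has_vector_derivative[OF this mexp_has_vector_derivative]
  show ?thesis by (simp add: matrix_vector_mul_assoc)
qed

text \<open>At one time S < 0 the norm is at most 1/e. Iteration gives e^(-m) at time m S, and the
  remaining time lies in the compact interval [S, 0]. Hence a = -1/S, while the factor e M absorbs
  rounding and remainder.\<close>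

lemma contracting_decay:
  assumes "contracting E"
  obtains C a where "C > 0" "a > 0" "\<And>s x. s \<le> 0 \<Longrightarrow> norm (mexp (s *\<^sub>R E) *v x) \<le> C * exp (a * s) * norm x"
proof -
  have "eventually (\<lambda>t. norm (mexp (ln t *\<^sub>R E)) < exp (- 1)) (at_right 0)"
    using assms unfolding contracting_def by (rule order_tendstoD) simp
  then obtain b where b: "b > 0" "\<And>t. 0 < t \<Longrightarrow> t < b \<Longrightarrow> norm (mexp (ln t *\<^sub>R E)) < exp (- 1)"
    by (auto simp: eventually_at_right_field)
  \<comment> \<open>b / 2 lies in the range where the norm is below 1/e, and 1 / 2 makes the
    logarithm negative.\<close>
  define S where "S = ln (min (b / 2) (1 / 2))"
  have S: "S < 0" by (auto simp: S_def ln_less_zero_iff b)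
  have "norm (mexp (S *\<^sub>R E)) \<le> exp (- 1)"
    unfolding S_def using b by (intro less_imp_le b(2)) auto
  hence step: "norm (mexp (S *\<^sub>R E) *v x) \<le> exp (- 1) * norm x" for x
    using norm_matrix_vector_mult_le[of "mexp (S *\<^sub>R E)" x] 
    by (meson mult_right_mono norm_ge_zero order_trans)
  have iter: "norm (mexp ((real m * S) *\<^sub>R E) *v x) \<le> exp (- real m) * norm x" for m x
  proof (induction m)
    case (Suc m)
    have "norm (mexp ((real (Suc m) * S) *\<^sub>R E) *v x) = norm (mexp (S *\<^sub>R E) *v (mexp ((real m * S) *\<^sub>R E) *v x))"
      by (simp add: mexp_add_mv algebra_simps)
    also have "\<dots> \<le> exp (- 1) * (exp (- real m) * norm x)"
      using step[of "mexp ((real m * S) *\<^sub>R E) *v x"] mult_left_mono[OF Suc, of "exp (- 1)"] by (meson exp_ge_zero order_trans)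
    finally show ?case by (simp add: exp_add[symmetric] mult.assoc[symmetric])
  qed simp
  have "bounded ((\<lambda>s. mexp (s *\<^sub>R E)) ` {S..0})"
    by (intro compact_imp_bounded compact_continuous_image continuous_on_mexp compact_Icc)
  then obtain M where M: "M > 0" "\<And>s. s \<in> {S..0} \<Longrightarrow> norm (mexp (s *\<^sub>R E)) \<le> M"
    unfolding bounded_pos by auto
  show ?thesis
  proof (rule that[of "exp 1 * M" "- 1 / S"])
    show "exp 1 * M > 0" "- 1 / S > 0" using M S by (auto simp: divide_neg_neg)
    fix s :: real and x assume s: "s \<le> 0"
    define m where "m = nat \<lfloor>s / S\<rfloor>"
    have sS: "s / S \<ge> 0" using s S by (simp add: divide_nonpos_neg)
    have m: "real m \<le> s / S" "s / S < real m + 1"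
      using sS unfolding m_def by (auto simp: of_nat_nat)
    have r: "s - real m * S \<in> {S..0}"
      using m S by (auto simp: field_simps)
    have "norm (mexp (s *\<^sub>R E) *v x) = norm (mexp ((s - real m * S) *\<^sub>R E) *v (mexp ((real m * S) *\<^sub>R E) *v x))"
      by (simp add: mexp_add_mv)
    also have "\<dots> \<le> norm (mexp ((s - real m * S) *\<^sub>R E)) * norm (mexp ((real m * S) *\<^sub>R E) *v x)"
      by (rule norm_matrix_vector_mult_le)
    also have "\<dots> \<le> M * (exp (- real m) * norm x)"
      using M r iter by (intro mult_mono) auto
    also have "\<dots> \<le> M * (exp (1 - s / S) * norm x)"
      using m M by (intro mult_left_mono mult_right_mono) auto
    also have "exp (1 - s / S) = exp 1 * exp (- 1 / S * s)"
      by (simp add: exp_add[symmetric])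
    finally show "norm (mexp (s *\<^sub>R E) *v x) \<le> exp 1 * M * exp (- 1 / S * s) * norm x"
      by (simp add: mult_ac)
  qed
qed

text \<open>Integration in generalized polar coordinates, with the surface measure on \<open>{P = 1}\<close> replaced by
  Lebesgue measure on the shell \<open>{1 \<le> P \<le> e}\<close>: for \<open>\<xi> \<noteq> 0\<close> the set of times \<open>s\<close> at which
  \<open>e\<^bsup>-sE\<^esup> \<xi>\<close> lies in the shell has length 1, so Fubini and a linear substitution suffice.\<close>

lemma polar_integral_bound:
  fixes P :: "real^'d::finite \<Rightarrow> real" and f :: "real^'d \<Rightarrow> complex"
  defines "A \<equiv> {\<eta>. 1 \<le> P \<eta> \<and> P \<eta> \<le> exp 1}"
  assumes P: "continuous_on UNIV P" "\<And>\<xi>. 0 \<le> P \<xi>" "\<And>\<xi>. P \<xi> = 0 \<longleftrightarrow> \<xi> = 0"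
    and hom: "\<And>s \<xi>. P (mexp (s *\<^sub>R E) *v \<xi>) = exp s * P \<xi>"
    and f: "integrable lborel f" and bnd: "bounded A" 
    and B: "\<And>\<eta>. \<eta> \<in> A \<Longrightarrow> norm (\<integral>s. exp (s * trace E) *\<^sub>R f (mexp (s *\<^sub>R E) *v \<eta>) \<partial>lborel) \<le> B"
  shows "norm (integral\<^sup>L lborel f) \<le> B * measure lborel A"
proof -
  have fm [measurable]: "f \<in> borel_measurable borel" using f by auto
  have Am [measurable]: "A \<in> sets borel"
    unfolding A_def using P by (intro borel_closed closed_Collect_conj closed_Collect_le continuous_intros) auto
  have A_fin: "emeasure lborel A < \<infinity>"
    using bnd by (rule emeasure_bounded_finite)
  have flow [measurable]: "(\<lambda>p. mexp (fst p *\<^sub>R E) *v snd p) \<in> borel_measurable (borel \<Otimes>\<^sub>M borel)"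
    unfolding borel_prod by (intro borel_measurable_continuous_onI continuous_intros)
  have flow1 [measurable]: "(\<lambda>x. mexp (s *\<^sub>R E) *v x) \<in> borel_measurable borel" for s
    by (intro borel_measurable_continuous_onI continuous_intros)
  have sets_eq: "sets (lborel \<Otimes>\<^sub>M lborel) = sets (borel \<Otimes>\<^sub>M borel :: (real \<times> (real^'d)) measure)"
     "sets (lborel \<Otimes>\<^sub>M lborel) = sets (borel \<Otimes>\<^sub>M borel :: ((real^'d) \<times> real) measure)"
    by (simp_all cong: sets_pair_measure_cong)
  \<comment> \<open>\<open>G\<close> lives on pairs (\<xi>, s) and integrates to f(\<xi>) in s.
    Substituting \<xi> = e^(sE) \<eta> at fixed s turns it into \<open>H\<close>, whose indicator
    depends on \<eta> alone and whose Jacobian is e^(s tr E). The origin, fixed by the flow, is a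
    null set.\<close>
  define G where "G = (\<lambda>\<xi> s. indicator A (mexp ((- s) *\<^sub>R E) *v \<xi>) *\<^sub>R f \<xi>)"
  define H where "H = (\<lambda>s \<eta>. exp (s * trace E) *\<^sub>R indicator A \<eta> *\<^sub>R f (mexp (s *\<^sub>R E) *v \<eta>))"
  have Gm: "case_prod G \<in> borel_measurable (lborel \<Otimes>\<^sub>M lborel)"
  proof -
    have [measurable]: "(\<lambda>p. mexp ((- snd p) *\<^sub>R E) *v fst p) \<in> borel_measurable (borel \<Otimes>\<^sub>M borel)"
      unfolding borel_prod by (intro borel_measurable_continuous_onI continuous_intros)
    show ?thesis
      unfolding measurable_cong_sets[OF sets_eq(2) refl] G_def case_prod_beta by measurable
  qed
  have Hm: "case_prod H \<in> borel_measurable (lborel \<Otimes>\<^sub>M lborel)"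
    unfolding measurable_cong_sets[OF sets_eq(1) refl] H_def case_prod_beta by measurable
  have ind: "indicator A (mexp ((- s) *\<^sub>R E) *v \<xi>) = (indicator {ln (P \<xi>) - 1..ln (P \<xi>)} s :: real)"
    if "\<xi> \<noteq> 0" for s \<xi>
  proof -
    have p: "P \<xi> > 0" using P that by (metis order_le_less)
    have "P (mexp ((- s) *\<^sub>R E) *v \<xi>) = exp (ln (P \<xi>) - s)"
      unfolding hom using p by (simp add: exp_diff exp_minus field_simps)
    moreover have "1 \<le> exp (ln (P \<xi>) - s) \<longleftrightarrow> s \<le> ln (P \<xi>)" by simp
    moreover have "exp (ln (P \<xi>) - s) \<le> exp 1 \<longleftrightarrow> ln (P \<xi>) - 1 \<le> s"
      unfolding exp_le_cancel_iff by auto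
    ultimately show ?thesis by (auto simp: A_def indicator_def)
  qed
  have AE0: "AE \<xi> in lborel. (\<xi>::real^'d) \<noteq> 0" by (rule AE_lborel_singleton)
  have G_int: "integrable (lborel \<Otimes>\<^sub>M lborel) (case_prod G)"
  proof (rule lborel_pair.Fubini_integrable[OF Gm])
    have "integrable lborel (\<lambda>\<xi>. norm (f \<xi>))" using f by simp
    moreover have "AE \<xi> in lborel. norm (f \<xi>) = (\<integral>s. norm (case_prod G (\<xi>, s)) \<partial>lborel)"
      using AE0 by eventually_elim (auto simp: G_def ind[unfolded scaleR_minus_left] measure_def)
    ultimately show "integrable lborel (\<lambda>\<xi>. \<integral>s. norm (case_prod G (\<xi>, s)) \<partial>lborel)"
      using Gm by (subst (asm) integrable_cong_AE) (auto intro!: lborel.borel_measurable_lebesgue_integral)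
    show "AE \<xi> in lborel. integrable lborel (\<lambda>s. case_prod G (\<xi>, s))"
      using AE0 by eventually_elim (auto simp: G_def ind[unfolded scaleR_minus_left] intro!: integrable_scaleR_left)
  qed
  have G_fst: "(\<integral>\<xi>. \<integral>s. G \<xi> s \<partial>lborel \<partial>lborel) = integral\<^sup>L lborel f"
  proof (rule integral_cong_AE)
    show "(\<lambda>\<xi>. \<integral>s. G \<xi> s \<partial>lborel) \<in> borel_measurable lborel"
      using Gm by (rule lborel.borel_measurable_lebesgue_integral)
    show "AE \<xi> in lborel. (\<integral>s. G \<xi> s \<partial>lborel) = f \<xi>"
      using AE0 by eventually_elim (auto simp: G_def ind[unfolded scaleR_minus_left] measure_def)
  qed auto
  have det: "\<bar>det (mexp (s *\<^sub>R E))\<bar> = exp (s * trace E)" "det (mexp (s *\<^sub>R E)) \<noteq> 0" for s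
    by (auto simp: det_mexp)
  have Gm1 [measurable]: "(\<lambda>\<xi>. G \<xi> s) \<in> borel_measurable borel" for s
    unfolding G_def by measurable
  have G_flow: "G (mexp (s *\<^sub>R E) *v \<eta>) s = indicator A \<eta> *\<^sub>R f (mexp (s *\<^sub>R E) *v \<eta>)" for s \<eta>
    by (simp add: G_def)
  have G_snd: "(\<integral>\<xi>. G \<xi> s \<partial>lborel) = (\<integral>\<eta>. H s \<eta> \<partial>lborel)" for s
    unfolding H_def integral_scaleR_right
    by (subst lborel_integral_matrix[OF det(2)[of s] Gm1]) (simp only: det G_flow)
  have G_snd_norm: "(\<integral>\<xi>. norm (G \<xi> s) \<partial>lborel) = (\<integral>\<eta>. norm (H s \<eta>) \<partial>lborel)" for s
    by (subst lborel_integral_matrix[OF det(2)[of s] measurable_compose[OF Gm1 borel_measurable_norm]])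
       (simp only: det G_flow H_def norm_scaleR abs_exp_cancel real_scaleR_def integral_mult_right_zero)
  \<comment> \<open>For each s the substitution equates the integrals of the norms of
    \<open>G\<close> and \<open>H\<close>, so integrability passes to \<open>H\<close> and its two
    integrations may be exchanged as well.\<close>
  have H_int: "integrable (lborel \<Otimes>\<^sub>M lborel) (case_prod H)"
  proof (rule lborel_pair.Fubini_integrable[OF Hm])
    have "integrable (lborel \<Otimes>\<^sub>M lborel) (\<lambda>x. norm (case_prod G x))" using G_int by simp
    hence "integrable (lborel \<Otimes>\<^sub>M lborel) (\<lambda>(\<xi>, s). norm (G \<xi> s))"
      by (simp only: case_prod_unfold)
    from lborel_pair.integrable_snd[OF this]
    show "integrable lborel (\<lambda>s. \<integral>\<eta>. norm (case_prod H (s, \<eta>)) \<partial>lborel)" by (simp add: G_snd_norm)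
    show "AE s in lborel. integrable lborel (\<lambda>\<eta>. case_prod H (s, \<eta>))"
    proof (rule AE_I2)
      fix s :: real
      have "integrable lborel (\<lambda>\<eta>. f (mexp (s *\<^sub>R E) *v \<eta>))"
      proof -
        have "integrable (density (distr lborel borel ((*v) (mexp (s *\<^sub>R E)))) (\<lambda>_. ennreal \<bar>det (mexp (s *\<^sub>R E))\<bar>)) f"
          using f lborel_distr_matrix[OF det(2)[of s]] by simp
        hence "integrable lborel (\<lambda>\<eta>. exp (s * trace E) *\<^sub>R f (mexp (s *\<^sub>R E) *v \<eta>))"
          by (subst (asm) integrable_density) (auto simp: integrable_distr_eq det)
        from integrable_scaleR_right[OF this, of "exp (- (s * trace E))"] show ?thesis
          by (simp add: exp_minus)
      qed
      thus "integrable lborel (\<lambda>\<eta>. case_prod H (s, \<eta>))"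
        unfolding H_def prod.case by (intro integrable_scaleR_right integrable_mult_indicator) auto
    qed
  qed
  have "integral\<^sup>L lborel f = (\<integral>s. \<integral>\<eta>. H s \<eta> \<partial>lborel \<partial>lborel)"
    using lborel_pair.Fubini_integral[OF G_int] G_fst by (simp add: G_snd)
  also have "\<dots> = (\<integral>\<eta>. \<integral>s. H s \<eta> \<partial>lborel \<partial>lborel)"
    by (rule lborel_pair.Fubini_integral[OF H_int, symmetric])
  finally have eq: "integral\<^sup>L lborel f = (\<integral>\<eta>. \<integral>s. H s \<eta> \<partial>lborel \<partial>lborel)" .
  have "norm (\<integral>\<eta>. \<integral>s. H s \<eta> \<partial>lborel \<partial>lborel) \<le> (\<integral>\<eta>. indicator A \<eta> * B \<partial>lborel)"
  proof (rule Bochner_Integration.integral_norm_bound_integral)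
    show "integrable lborel (\<lambda>\<eta>. \<integral>s. H s \<eta> \<partial>lborel)"
      using lborel_pair.integrable_snd[OF H_int] .
    show "integrable lborel (\<lambda>\<eta>. indicator A \<eta> * B)" using A_fin by simp
    fix \<eta> :: "real^'d"
    show "norm (\<integral>s. H s \<eta> \<partial>lborel) \<le> indicator A \<eta> * B"
      using B[of \<eta>] by (cases "\<eta> \<in> A") (auto simp: H_def)
  qed
  also have "\<dots> = B * measure lborel A" by simp
  finally show ?thesis by (simp add: eq)
qed

text \<open>One integration by parts with H = -i (a / p') e^(ip). Since 1/|p'| \<le> 2 e^(-s) / N,
  the two boundary terms account for the 4, and the two terms of (a / p')' for 2 C1 and 4 C2. The
  remainder decays like e^((\<mu>-1)s) because \<mu> < 1, so s0 dominates. A bound on p'' stands in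
  for the monotonicity of p' in van der Corput's lemma.\<close>

lemma oscillatory_integral_bound:
  fixes p p' p'' a a' :: "real \<Rightarrow> real"
  assumes s: "s0 \<le> s1" and mu: "\<mu> < 1" and N: "N > 0" and C: "C1 \<ge> 0" "C2 \<ge> 0"
    and p: "\<And>s. s \<in> {s0..s1} \<Longrightarrow> (p has_real_derivative p' s) (at s within {s0..s1})"
    and p': "\<And>s. s \<in> {s0..s1} \<Longrightarrow> (p' has_real_derivative p'' s) (at s within {s0..s1})"
    and a: "\<And>s. s \<in> {s0..s1} \<Longrightarrow> (a has_real_derivative a' s) (at s within {s0..s1})"
    and a_le: "\<And>s. s \<in> {s0..s1} \<Longrightarrow> \<bar>a s\<bar> \<le> exp (\<mu> * s)"
    and a'_le: "\<And>s. s \<in> {s0..s1} \<Longrightarrow> \<bar>a' s\<bar> \<le> C1 * exp (\<mu> * s)"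
    and p'_ge: "\<And>s. s \<in> {s0..s1} \<Longrightarrow> N * exp s / 2 \<le> \<bar>p' s\<bar>"
    and p''_le: "\<And>s. s \<in> {s0..s1} \<Longrightarrow> \<bar>p'' s\<bar> \<le> C2 * N * exp s"
  shows "norm (integral {s0..s1} (\<lambda>s. a s *\<^sub>R cis (p s))) \<le> (4 + (2 * C1 + 4 * C2) / (1 - \<mu>)) * exp ((\<mu> - 1) * s0) / N"
proof -
  define H where "H = (\<lambda>s. (a s / p' s) *\<^sub>R (- \<i> * cis (p s)))"
  define q where "q = (\<lambda>s. (a' s * p' s - a s * p'' s) / (p' s)\<^sup>2)"
  have p'_nz: "p' s \<noteq> 0" if "s \<in> {s0..s1}" for s
    using p'_ge[OF that] mult_pos_pos[OF N exp_gt_zero[of s]] by auto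
  have dH: "(H has_vector_derivative (a s *\<^sub>R cis (p s) + q s *\<^sub>R (- \<i> * cis (p s)))) (at s within {s0..s1})"
    if s: "s \<in> {s0..s1}" for s
  proof -
    have 1: "((\<lambda>s. a s / p' s) has_real_derivative q s) (at s within {s0..s1})"
      unfolding q_def power2_eq_square using DERIV_divide[OF a[OF s] p'[OF s] p'_nz[OF s]] .
    have 2: "((\<lambda>s. - \<i> * cis (p s)) has_vector_derivative (p' s *\<^sub>R cis (p s))) (at s within {s0..s1})"
      using p[OF s] unfolding has_field_derivative_def has_vector_derivative_def
      by (auto intro!: derivative_eq_intros simp: fun_eq_iff scaleR_conv_of_real mult_ac)
    from has_vector_derivative_scaleR[OF 1 2] show ?thesis
      unfolding H_def using p'_nz[OF s] by (simp add: add.commute)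
  qed
  have int: "((\<lambda>s. a s *\<^sub>R cis (p s) + q s *\<^sub>R (- \<i> * cis (p s))) has_integral (H s1 - H s0)) {s0..s1}"
    by (rule fundamental_theorem_of_calculus[OF s dH])
  have "continuous_on {s0..s1} a" "continuous_on {s0..s1} p"
    by (rule DERIV_continuous_on[OF a], assumption, rule DERIV_continuous_on[OF p], assumption)
  hence int1: "(\<lambda>s. a s *\<^sub>R cis (p s)) integrable_on {s0..s1}"
    by (intro integrable_continuous_real continuous_intros) auto
  have int2: "(\<lambda>s. q s *\<^sub>R (- \<i> * cis (p s))) integrable_on {s0..s1}"
    using integrable_diff[OF has_integral_integrable[OF int] int1] by simp
  have eq: "integral {s0..s1} (\<lambda>s. a s *\<^sub>R cis (p s)) = H s1 - H s0 - integral {s0..s1} (\<lambda>s. q s *\<^sub>R (- \<i> * cis (p s)))"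
    using integral_unique[OF int] Henstock_Kurzweil_Integration.integral_add[OF int1 int2]
    by (simp only: eq_diff_eq)
  have inv_le: "1 / \<bar>p' s\<bar> \<le> 2 / N * exp (- s)" if "s \<in> {s0..s1}" for s
    using p'_ge[OF that] p'_nz[OF that] N by (simp add: exp_minus field_simps)
  have H_le: "norm (H s) \<le> 2 * exp ((\<mu> - 1) * s0) / N" if s: "s \<in> {s0..s1}" for s
  proof -
    have "norm (H s) = \<bar>a s\<bar> * (1 / \<bar>p' s\<bar>)" by (simp add: H_def norm_mult)
    also have "\<dots> \<le> exp (\<mu> * s) * (2 / N * exp (- s))"
      using a_le[OF s] inv_le[OF s] by (intro mult_mono) auto
    also have "\<dots> = 2 * exp ((\<mu> - 1) * s) / N" by (simp add: exp_add[symmetric] algebra_simps)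
    also have "exp ((\<mu> - 1) * s) \<le> exp ((\<mu> - 1) * s0)"
      using s mu by (simp add: mult_left_mono_neg)
    finally show ?thesis using N by (simp add: divide_right_mono)
  qed
  let ?K = "(2 * C1 + 4 * C2) / N"
  have q_le: "norm (q s *\<^sub>R (- \<i> * cis (p s))) \<le> ?K * exp ((\<mu> - 1) * s)" if s: "s \<in> {s0..s1}" for s
  proof -
    have "q s = a' s * (1 / p' s) - a s * p'' s * (1 / p' s) * (1 / p' s)"
      using p'_nz[OF s] by (simp add: q_def field_simps power2_eq_square)
    hence "\<bar>q s\<bar> \<le> \<bar>a' s\<bar> * (1 / \<bar>p' s\<bar>) + \<bar>a s\<bar> * \<bar>p'' s\<bar> * (1 / \<bar>p' s\<bar>) * (1 / \<bar>p' s\<bar>)"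
      by (simp add: abs_mult abs_triangle_ineq4 [THEN order_trans])
    also have "\<dots> \<le> (C1 * exp (\<mu> * s)) * (2 / N * exp (- s)) +
        exp (\<mu> * s) * (C2 * N * exp s) * (2 / N * exp (- s)) * (2 / N * exp (- s))"
      using a_le[OF s] a'_le[OF s] inv_le[OF s] p''_le[OF s] C N
      by (intro add_mono mult_mono mult_nonneg_nonneg) auto
    also have "\<dots> = ?K * exp ((\<mu> - 1) * s)"
      using N by (simp add: field_simps exp_diff exp_minus)
    finally show ?thesis by (simp add: norm_mult)
  qed
  define F where "F = (\<lambda>s. ?K * exp ((\<mu> - 1) * s) / (\<mu> - 1))"
  have F: "((\<lambda>s. ?K * exp ((\<mu> - 1) * s)) has_integral (F s1 - F s0)) {s0..s1}"
    by (rule fundamental_theorem_of_calculus[OF s])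
       (use mu N in \<open>auto intro!: derivative_eq_intros simp: F_def has_real_derivative_iff_has_vector_derivative[symmetric]\<close>)
  have "norm (integral {s0..s1} (\<lambda>s. q s *\<^sub>R (- \<i> * cis (p s)))) \<le> F s1 - F s0"
    using Henstock_Kurzweil_Integration.integral_norm_bound_integral[OF int2 has_integral_integrable[OF F] q_le] integral_unique[OF F] by simp
  \<comment> \<open>\<open>F\<close> is nonpositive since \<mu> < 1, so s1 drops out and the bound
    is uniform in the length of the interval.\<close>
  also have "\<dots> \<le> - F s0"
    using mu C N by (simp add: F_def) (intro divide_nonneg_neg mult_nonneg_nonneg mult_pos_neg, auto)
  also have "- F s0 = ((2 * C1 + 4 * C2) / (1 - \<mu>)) * exp ((\<mu> - 1) * s0) / N"
    using mu N by (simp add: F_def field_simps)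
  finally have Q: "norm (integral {s0..s1} (\<lambda>s. q s *\<^sub>R (- \<i> * cis (p s)))) \<le>
    ((2 * C1 + 4 * C2) / (1 - \<mu>)) * exp ((\<mu> - 1) * s0) / N" .
  have "norm (integral {s0..s1} (\<lambda>s. a s *\<^sub>R cis (p s))) \<le> norm (H s1) + norm (H s0) +
      norm (integral {s0..s1} (\<lambda>s. q s *\<^sub>R (- \<i> * cis (p s))))"
    unfolding eq by (meson add_mono norm_triangle_ineq4 order_refl order_trans)
  also have "\<dots> \<le> 2 * exp ((\<mu> - 1) * s0) / N + 2 * exp ((\<mu> - 1) * s0) / N + 
      ((2 * C1 + 4 * C2) / (1 - \<mu>)) * exp ((\<mu> - 1) * s0) / N"
    using s by (intro add_mono H_le Q) auto
  also have "\<dots> = (4 + (2 * C1 + 4 * C2) / (1 - \<mu>)) * exp ((\<mu> - 1) * s0) / N"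
    by (simp add: algebra_simps add_divide_distrib)
  finally show ?thesis .
qed


section \<open>Fourier analysis on the integer lattice\<close>

lemma zvec_diff: "zvec (x - y) = zvec x - zvec y"
  by (simp add: zvec_def vec_eq_iff)

lemma convolution_summable:
  fixes f g :: "'a::ab_group_add \<Rightarrow> complex"
  assumes f: "(\<lambda>x. norm (f x)) summable_on UNIV" and g: "(\<lambda>x. norm (g x)) summable_on UNIV"
  shows "(\<lambda>(y, x). norm (f (x - y) * g y)) summable_on UNIV \<times> UNIV"
proof -
  have bij: "bij_betw (\<lambda>x. x - y) UNIV UNIV" for y :: 'a
    by (rule bij_betwI[where g="\<lambda>x. x + y"]) auto
  have fy: "(\<lambda>x. norm (f (x - y))) summable_on UNIV" for y
    using summable_on_reindex_bij_betw[OF bij, of "\<lambda>x. norm (f x)"] f by simp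
  have inner: "(\<Sum>\<^sub>\<infinity>x. norm (f (x - y) * g y)) = (\<Sum>\<^sub>\<infinity>x. norm (f x)) * norm (g y)" for y
    using infsum_reindex_bij_betw[OF bij, of "\<lambda>x. norm (f x)" y]
    by (simp add: norm_mult infsum_cmult_left fy)
  have "(\<lambda>p. norm (case_prod (\<lambda>y x. f (x - y) * g y) p)) summable_on (SIGMA y:UNIV. UNIV)"
    unfolding Infinite_Sum.abs_summable_on_Sigma_iff prod.case inner
    by (auto simp: norm_mult abs_mult intro!: summable_on_cmult_left fy summable_on_cmult_right g)
  thus ?thesis by (simp add: case_prod_unfold)
qed

lemma convolution_infsum:
  fixes f g :: "'a::ab_group_add \<Rightarrow> complex"
  assumes f: "(\<lambda>x. norm (f x)) summable_on UNIV" and g: "(\<lambda>x. norm (g x)) summable_on UNIV"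
  shows "(\<lambda>x. norm (\<Sum>\<^sub>\<infinity>y. f (x - y) * g y)) summable_on UNIV"
    and "(\<Sum>\<^sub>\<infinity>x. \<Sum>\<^sub>\<infinity>y. f (x - y) * g y) = (\<Sum>\<^sub>\<infinity>x. f x) * (\<Sum>\<^sub>\<infinity>y. g y)"
proof -
  have bij: "bij_betw (\<lambda>x. x - y) UNIV UNIV" for y :: 'a
    by (rule bij_betwI[where g="\<lambda>x. x + y"]) auto
  note S = convolution_summable[OF f g]
  have S': "(\<lambda>(x, y). norm (f (x - y) * g y)) summable_on UNIV \<times> UNIV"
    using summable_on_reindex_bij_betw[of prod.swap "UNIV \<times> UNIV" "UNIV \<times> UNIV" "\<lambda>(y, x). norm (f (x - y) * g y)"] S
    by (simp add: bij_betw_def product_swap case_prod_unfold)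
  hence S'': "(\<lambda>p. norm (case_prod (\<lambda>x y. f (x - y) * g y) p)) summable_on (SIGMA x:UNIV. UNIV)"
    by (simp add: case_prod_unfold)
  have row: "(\<lambda>y. norm (f (x - y) * g y)) summable_on UNIV" for x
    using S''[unfolded Infinite_Sum.abs_summable_on_Sigma_iff] by simp
  have "(\<lambda>x. \<Sum>\<^sub>\<infinity>y. norm (f (x - y) * g y)) summable_on UNIV"
    using S''[unfolded Infinite_Sum.abs_summable_on_Sigma_iff] by (simp add: infsum_nonneg)
  thus "(\<lambda>x. norm (\<Sum>\<^sub>\<infinity>y. f (x - y) * g y)) summable_on UNIV"
    by (rule summable_on_comparison_test) (auto intro!: norm_infsum_bound row)
  have "(\<lambda>(x, y). f (x - y) * g y) summable_on UNIV \<times> UNIV"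
    using abs_summable_summable[OF S''] by simp
  from infsum_swap_banach[OF this]
  have "(\<Sum>\<^sub>\<infinity>x. \<Sum>\<^sub>\<infinity>y. f (x - y) * g y) = (\<Sum>\<^sub>\<infinity>y. \<Sum>\<^sub>\<infinity>x. f (x - y) * g y)" .
  moreover have "(\<Sum>\<^sub>\<infinity>x. f (x - y) * g y) = (\<Sum>\<^sub>\<infinity>x. f x) * g y" for y
  proof -
    have "f summable_on UNIV" using f by (rule abs_summable_summable)
    hence "(\<lambda>x. f (x - y)) summable_on UNIV"
      using summable_on_reindex_bij_betw[OF bij, of f] by simp
    thus ?thesis
      using infsum_reindex_bij_betw[OF bij, of f y] by (simp add: infsum_cmult_left)
  qed
  moreover have "(\<Sum>\<^sub>\<infinity>y. (\<Sum>\<^sub>\<infinity>x. f x) * g y) = (\<Sum>\<^sub>\<infinity>x. f x) * (\<Sum>\<^sub>\<infinity>y. g y)"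
    by (rule infsum_cmult_right) (use abs_summable_summable[OF g] in auto)
  ultimately show "(\<Sum>\<^sub>\<infinity>x. \<Sum>\<^sub>\<infinity>y. f (x - y) * g y) = (\<Sum>\<^sub>\<infinity>x. f x) * (\<Sum>\<^sub>\<infinity>y. g y)" by simp
qed

text \<open>Multiplying a convolution by a character gives the convolution of the two twisted
  sequences; summing over x turns it into the product of their sums.\<close>

lemma conv_pow_summable_fhat:
  fixes \<phi> :: "int^'d::finite \<Rightarrow> complex"
  assumes "(\<lambda>x. norm (\<phi> x)) summable_on UNIV"
  shows "(\<lambda>x. norm (conv_pow \<phi> n x)) summable_on UNIV" and "fhat (conv_pow \<phi> n) \<xi> = fhat \<phi> \<xi> ^ n"
proof -
  have "(\<lambda>x. norm (conv_pow \<phi> n x)) summable_on UNIV \<and> fhat (conv_pow \<phi> n) \<xi> = fhat \<phi> \<xi> ^ n"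
  proof (induction n)
    case 0
    have "(\<lambda>x. norm (conv_pow \<phi> 0 x)) summable_on UNIV \<longleftrightarrow> (\<lambda>x. norm (conv_pow \<phi> 0 x)) summable_on {0}"
      by (rule summable_on_cong_neutral) auto
    moreover have "fhat (conv_pow \<phi> 0) \<xi> = (\<Sum>\<^sub>\<infinity>x\<in>{0}. conv_pow \<phi> 0 x * cis (zvec x \<bullet> \<xi>))"
      unfolding fhat_def by (rule infsum_cong_neutral) auto
    moreover have "zvec 0 = (0::real^'d)" by (simp add: zvec_def vec_eq_iff)
    ultimately show ?case by simp
  next
    case (Suc n)
    let ?e = "\<lambda>c x. c x * cis (zvec x \<bullet> \<xi>)"
    have e: "(\<lambda>x. norm (?e (conv_pow \<phi> n) x)) summable_on UNIV" "(\<lambda>x. norm (?e \<phi> x)) summable_on UNIV"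
      using Suc assms by (simp_all add: norm_mult)
    have "?e (conv_pow \<phi> (Suc n)) x = (\<Sum>\<^sub>\<infinity>y. ?e (conv_pow \<phi> n) (x - y) * ?e \<phi> y)" for x
    proof -
      have "(\<Sum>\<^sub>\<infinity>y. ?e (conv_pow \<phi> n) (x - y) * ?e \<phi> y) = (\<Sum>\<^sub>\<infinity>y. (conv_pow \<phi> n (x - y) * \<phi> y) * cis (zvec x \<bullet> \<xi>))"
        by (intro infsum_cong) (simp add: zvec_diff inner_diff_left cis_mult[symmetric] cis_divide[symmetric])
      also have "\<dots> = (\<Sum>\<^sub>\<infinity>y. conv_pow \<phi> n (x - y) * \<phi> y) * cis (zvec x \<bullet> \<xi>)"
        by (rule infsum_cmult_left') 
      finally show ?thesis by simp
    qed
    hence "fhat (conv_pow \<phi> (Suc n)) \<xi> = fhat (conv_pow \<phi> n) \<xi> * fhat \<phi> \<xi>"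
      unfolding fhat_def by (simp only: convolution_infsum(2)[OF e])
    thus ?case
      using convolution_infsum(1)[of "conv_pow \<phi> n" \<phi>] Suc assms by simp
  qed
  thus "(\<lambda>x. norm (conv_pow \<phi> n x)) summable_on UNIV" "fhat (conv_pow \<phi> n) \<xi> = fhat \<phi> \<xi> ^ n" by auto
qed

lemma in_Sd_summable:
  assumes "in_Sd \<phi>" shows "(\<lambda>x. norm (\<phi> x)) summable_on UNIV"
  using assms[unfolded in_Sd_def, rule_format, of "\<lambda>_. 0"] by (simp add: zmono_def)

lemma fhat_uniform_limit:
  assumes "(\<lambda>x. norm (c x)) summable_on UNIV"
  shows "uniform_limit UNIV (\<lambda>F \<xi>. \<Sum>x\<in>F. c x * cis (zvec x \<bullet> \<xi>)) (fhat c) (finite_subsets_at_top UNIV)"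
  unfolding fhat_def[abs_def] using assms by (intro Weierstrass_m_test_general[where M="\<lambda>x. norm (c x)"]) (auto simp: norm_mult)

text \<open>A prescribed x is adjoined to the finite set because the inversion formula reads off the
  coefficient at x from the partial sum.\<close>

lemma fhat_finite_approx:
  assumes "(\<lambda>x. norm (c x)) summable_on UNIV" "e > 0"
  obtains F where "finite F" "x \<in> F" "\<And>\<xi>. norm (fhat c \<xi> - (\<Sum>x\<in>F. c x * cis (zvec x \<bullet> \<xi>))) < e"
proof -
  have "eventually (\<lambda>F. \<forall>\<xi>\<in>UNIV. dist (\<Sum>x\<in>F. c x * cis (zvec x \<bullet> \<xi>)) (fhat c \<xi>) < e) (finite_subsets_at_top UNIV)"
    using fhat_uniform_limit[OF assms(1)] assms(2) by (rule uniform_limitD)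
  then obtain X where X: "finite X" "\<And>Y \<xi>. finite Y \<Longrightarrow> X \<subseteq> Y \<Longrightarrow> dist (\<Sum>x\<in>Y. c x * cis (zvec x \<bullet> \<xi>)) (fhat c \<xi>) < e"
    unfolding eventually_finite_subsets_at_top by auto
  show ?thesis
    by (rule that[of "insert x X"]) (use X in \<open>auto simp: dist_norm norm_minus_commute subset_insertI\<close>)
qed

lemma continuous_on_fhat:
  assumes "(\<lambda>x. norm (c x)) summable_on UNIV"
  shows "continuous_on UNIV (fhat c)"
  by (rule uniform_limit_theorem[OF _ fhat_uniform_limit[OF assms]])
     (auto intro!: always_eventually continuous_intros)

lemma norm_fhat_le:
  assumes "(\<lambda>x. norm (c x)) summable_on UNIV"
  shows "norm (fhat c \<xi>) \<le> (\<Sum>\<^sub>\<infinity>x. norm (c x))"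
  unfolding fhat_def using norm_infsum_bound[of "\<lambda>x. c x * cis (zvec x \<bullet> \<xi>)" UNIV] assms by (simp add: norm_mult)

lemma fhat_periodic: "fhat c (\<xi> + (2 * pi) *\<^sub>R zvec m) = fhat c \<xi>"
proof -
  have "cis (zvec x \<bullet> ((2 * pi) *\<^sub>R zvec m)) = 1" for x
  proof -
    have "zvec x \<bullet> zvec m = of_int (\<Sum>i\<in>UNIV. x $ i * m $ i)"
      by (simp add: inner_vec_def zvec_def)
    hence "zvec x \<bullet> ((2 * pi) *\<^sub>R zvec m) = 2 * pi * of_int (\<Sum>i\<in>UNIV. x $ i * m $ i)" by simp
    thus ?thesis by (metis Ints_of_int cis_multiple_2pi)
  qed
  thus ?thesis
    unfolding fhat_def by (simp add: inner_add_right cis_mult[symmetric])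
qed

section \<open>Orthogonality of characters on a period box\<close>

lemma lborel_integral_prod:
  fixes f :: "'a::euclidean_space \<Rightarrow> real \<Rightarrow> complex"
  assumes int: "\<And>b. b \<in> Basis \<Longrightarrow> integrable lborel (f b)"
  shows "(\<integral>x. (\<Prod>b\<in>Basis. f b (x \<bullet> b)) \<partial>lborel) = (\<Prod>b\<in>Basis. integral\<^sup>L lborel (f b))"
proof -
  interpret product_sigma_finite "\<lambda>_::'a. lborel :: real measure" ..
  have [measurable]: "f b \<in> borel_measurable borel" if "b \<in> Basis" for b
    using int[OF that] by auto
  have "(\<integral>x. (\<Prod>b\<in>Basis. f b (x \<bullet> b)) \<partial>lborel) =
      (\<integral>x. (\<Prod>b\<in>Basis. f b ((\<Sum>c\<in>Basis. x c *\<^sub>R c) \<bullet> b)) \<partial>(\<Pi>\<^sub>M b\<in>Basis. lborel))"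
    by (subst lborel_eq) (rule integral_distr; measurable)
  also have "\<dots> = (\<integral>x. (\<Prod>b\<in>Basis. f b (x b)) \<partial>(\<Pi>\<^sub>M b\<in>Basis. lborel))"
    by (intro Bochner_Integration.integral_cong refl prod.cong) (auto simp: inner_sum_left inner_Basis if_distrib cong: if_cong)
  also have "\<dots> = (\<Prod>b\<in>Basis. integral\<^sup>L lborel (f b))"
    by (rule product_integral_prod) (use int in auto)
  finally show ?thesis .
qed

lemma integral_cis_period:
  fixes m :: int
  shows "integrable lborel (\<lambda>t. indicator {c..c + 2 * pi} t *\<^sub>R cis (of_int m * t))"
    and "(\<integral>t. indicator {c..c + 2 * pi} t *\<^sub>R cis (of_int m * t) \<partial>lborel) = (if m = 0 then 2 * pi else 0)"
proof -
  show "integrable lborel (\<lambda>t. indicator {c..c + 2 * pi} t *\<^sub>R cis (of_int m * t))"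
    by (intro borel_integrable_compact continuous_intros) auto
  show "(\<integral>t. indicator {c..c + 2 * pi} t *\<^sub>R cis (of_int m * t) \<partial>lborel) = (if m = 0 then 2 * pi else 0)"
  proof (cases "m = 0")
    case True
    thus ?thesis by (simp add: measure_def scaleR_conv_of_real)
  next
    case False
    let ?F = "\<lambda>t. (- \<i> / of_int m) * cis (of_int m * t)"
    have "(\<integral>t. indicator {c..c + 2 * pi} t *\<^sub>R cis (of_int m * t) \<partial>lborel) = ?F (c + 2 * pi) - ?F c"
    proof (rule integral_FTC_Icc)
      fix t
      show "(?F has_vector_derivative cis (of_int m * t)) (at t within {c..c + 2 * pi})"
        unfolding has_vector_derivative_def using False
        by (auto intro!: derivative_eq_intros simp: fun_eq_iff scaleR_conv_of_real field_simps)
    qed (auto intro!: continuous_intros)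
    also have "cis (of_int m * (c + 2 * pi)) = cis (of_int m * c)"
    proof -
      have "cis (of_int m * (c + 2 * pi)) = cis (of_int m * c) * cis (2 * pi * of_int m)"
        by (simp add: cis_mult distrib_left mult_ac)
      thus ?thesis by (simp add: cis_multiple_2pi)
    qed
    finally show ?thesis using False by simp
  qed
qed

text \<open>The corner is free because estimates near a point need a full neighbourhood inside the
  box: the upper bound moves the faces away from all points of modulus one, the lower bound takes
  the corner - pi.\<close>

definition period_box :: "real \<Rightarrow> (real^'d::finite) set" where
  "period_box c = {\<xi>. \<forall>j. c \<le> \<xi> $ j \<and> \<xi> $ j \<le> c + 2 * pi}"

lemma period_box_cbox: "period_box c = cbox (\<chi> _. c) (\<chi> _. c + 2 * pi)"
  by (auto simp: period_box_def mem_box_cart)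

lemma period_box_props [simp]:
  "compact (period_box c)" "period_box c \<in> sets borel" "emeasure lborel (period_box c) < \<infinity>"
  "emeasure lborel (period_box c) < top"
  unfolding period_box_cbox using emeasure_lborel_cbox_finite by auto

lemma integral_cis_period_box:
  fixes m :: "int^'d::finite"
  shows "(\<integral>\<xi>. indicator (period_box c) \<xi> *\<^sub>R cis (zvec m \<bullet> \<xi>) \<partial>lborel) = (if m = 0 then (2 * pi) ^ CARD('d) else 0)"
proof -
  define k where "k = (\<lambda>b::real^'d. m $ (THE i. b = axis i 1))"
  have k: "k (axis i 1) = m $ i" for i by (simp add: k_def axis_eq_axis)
  define f where "f = (\<lambda>b t. indicator {c..c + 2 * pi} t *\<^sub>R cis (of_int (k b) * t))"
  have Basis: "(\<Prod>b\<in>Basis. h b) = (\<Prod>i\<in>UNIV. h (axis i 1))" for h :: "real^'d \<Rightarrow> complex"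
    by (auto simp: Basis_vec_def UNION_singleton_eq_range prod.reindex inj_on_def axis_eq_axis)
  have "indicator (period_box c) \<xi> *\<^sub>R cis (zvec m \<bullet> \<xi>) = (\<Prod>b\<in>Basis. f b (\<xi> \<bullet> b))" for \<xi> :: "real^'d"
  proof -
    have "(\<Prod>b\<in>Basis. f b (\<xi> \<bullet> b)) = (\<Prod>i\<in>UNIV. of_real (indicator {c..c + 2 * pi} (\<xi> $ i))) * (\<Prod>i\<in>UNIV. cis (of_int (m $ i) * \<xi> $ i))"
      unfolding Basis f_def by (simp add: k inner_axis scaleR_conv_of_real prod.distrib)
    also have "(\<Prod>i\<in>UNIV. of_real (indicator {c..c + 2 * pi} (\<xi> $ i))) = complex_of_real (indicator (period_box c) \<xi>)"
      by (auto simp: period_box_def indicator_def simp flip: of_real_prod)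
    also have "(\<Prod>i\<in>UNIV. cis (of_int (m $ i) * \<xi> $ i)) = cis (zvec m \<bullet> \<xi>)"
      by (simp add: cis_conv_exp exp_sum[symmetric] inner_vec_def zvec_def sum_distrib_left)
    finally show ?thesis by (simp add: scaleR_conv_of_real)
  qed
  hence "(\<integral>\<xi>. indicator (period_box c) \<xi> *\<^sub>R cis (zvec m \<bullet> \<xi>) \<partial>lborel) = (\<Prod>b\<in>Basis. integral\<^sup>L lborel (f b))"
    by (simp only: lborel_integral_prod[of f, unfolded f_def, OF integral_cis_period(1)] f_def)
  also have "\<dots> = (\<Prod>i\<in>UNIV. if m $ i = 0 then 2 * pi else 0)"
    unfolding Basis f_def integral_cis_period(2) by (simp add: k)
  also have "\<dots> = (if m = 0 then (2 * pi) ^ CARD('d) else 0)"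
    by (auto simp: vec_eq_iff)
  finally show ?thesis .
qed

section \<open>Fourier inversion and Bessel's inequality\<close>

lemma integrable_indicator_bounded:
  fixes g :: "real^'d::finite \<Rightarrow> complex"
  assumes "A \<in> sets borel" "emeasure lborel A < \<infinity>" "g \<in> borel_measurable borel" "\<And>x. x \<in> A \<Longrightarrow> norm (g x) \<le> B"
  shows "integrable lborel (\<lambda>x. indicator A x *\<^sub>R g x)"
  using assms by (intro integrableI_bounded_set_indicator[where B=B]) auto

lemma norm_integral_indicator_le:
  fixes g :: "real^'d::finite \<Rightarrow> complex"
  assumes "A \<in> sets borel" "emeasure lborel A < \<infinity>" "g \<in> borel_measurable borel" "\<And>x. x \<in> A \<Longrightarrow> norm (g x) \<le> B"
  shows "norm (\<integral>x. indicator A x *\<^sub>R g x \<partial>lborel) \<le> B * measure lborel A"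
proof -
  have "norm (\<integral>x. indicator A x *\<^sub>R g x \<partial>lborel) \<le> (\<integral>x. indicator A x * B \<partial>lborel)"
    using assms by (intro Bochner_Integration.integral_norm_bound_integral integrable_indicator_bounded[where B=B])
       (auto split: split_indicator)
  thus ?thesis using assms by (simp add: mult.commute)
qed

lemma integral_indicator_lincomb:
  fixes e :: "'i \<Rightarrow> real^'d::finite \<Rightarrow> complex"
  assumes "A \<in> sets borel" "emeasure lborel A < \<infinity>"
    and "\<And>y. y \<in> F \<Longrightarrow> e y \<in> borel_measurable borel" "\<And>y x. y \<in> F \<Longrightarrow> norm (e y x) \<le> 1"
  shows "integrable lborel (\<lambda>x. indicator A x *\<^sub>R (\<Sum>y\<in>F. c y * e y x))"
    and "(\<integral>x. indicator A x *\<^sub>R (\<Sum>y\<in>F. c y * e y x) \<partial>lborel) = (\<Sum>y\<in>F. c y * (\<integral>x. indicator A x *\<^sub>R e y x \<partial>lborel))"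
proof -
  have int: "integrable lborel (\<lambda>x. c y * (indicator A x *\<^sub>R e y x))" if "y \<in> F" for y
    using assms that by (intro integrable_mult_right integrable_indicator_bounded[where B=1]) auto
  have eq: "(\<lambda>x. indicator A x *\<^sub>R (\<Sum>y\<in>F. c y * e y x)) = (\<lambda>x. \<Sum>y\<in>F. c y * (indicator A x *\<^sub>R e y x))"
    by (simp add: scaleR_sum_right)
  show "integrable lborel (\<lambda>x. indicator A x *\<^sub>R (\<Sum>y\<in>F. c y * e y x))"
    unfolding eq by (intro Bochner_Integration.integrable_sum int)
  show "(\<integral>x. indicator A x *\<^sub>R (\<Sum>y\<in>F. c y * e y x) \<partial>lborel) = (\<Sum>y\<in>F. c y * (\<integral>x. indicator A x *\<^sub>R e y x \<partial>lborel))"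
    unfolding eq by (subst Bochner_Integration.integral_sum[OF int]) (simp_all only: integral_mult_right_zero)
qed

text \<open>A finite partial sum approximates \<open>fhat c\<close> uniformly, orthogonality
  evaluates the integral of the partial sum exactly, and the error is at most e times the volume of
  the box, for every e > 0.\<close>

lemma fourier_inversion:
  fixes c :: "int^'d::finite \<Rightarrow> complex"
  assumes c: "(\<lambda>x. norm (c x)) summable_on UNIV"
  shows "(\<integral>\<xi>. indicator (period_box a) \<xi> *\<^sub>R (fhat c \<xi> * cis (- (zvec x \<bullet> \<xi>))) \<partial>lborel) = (2 * pi) ^ CARD('d) * c x"
proof -
  let ?D = "period_box a :: (real^'d) set"
  let ?I = "\<integral>\<xi>. indicator ?D \<xi> *\<^sub>R (fhat c \<xi> * cis (- (zvec x \<bullet> \<xi>))) \<partial>lborel"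
  have [measurable]: "fhat c \<in> borel_measurable borel"
    by (intro borel_measurable_continuous_onI continuous_on_fhat c)
  have [measurable]: "(\<lambda>\<xi>::real^'d. cis (v \<bullet> \<xi>)) \<in> borel_measurable borel" "(\<lambda>\<xi>::real^'d. cis (- (v \<bullet> \<xi>))) \<in> borel_measurable borel" for v
    by (intro borel_measurable_continuous_onI continuous_intros)+
  have "norm (?I - (2 * pi) ^ CARD('d) * c x) \<le> e * measure lborel ?D" if e: "e > 0" for e
  proof -
    obtain F where F: "finite F" "x \<in> F" "\<And>\<xi>. norm (fhat c \<xi> - (\<Sum>x\<in>F. c x * cis (zvec x \<bullet> \<xi>))) < e"
      using fhat_finite_approx[OF c e] by blast
    let ?S = "\<lambda>\<xi>. \<Sum>y\<in>F. c y * cis (zvec y \<bullet> \<xi>)"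
    have Sx: "?S \<xi> * cis (- (zvec x \<bullet> \<xi>)) = (\<Sum>y\<in>F. c y * cis (zvec (y - x) \<bullet> \<xi>))" for \<xi>
      by (simp add: sum_distrib_right zvec_diff inner_diff_left cis_mult mult.assoc)
    have "(\<integral>\<xi>. indicator ?D \<xi> *\<^sub>R (?S \<xi> * cis (- (zvec x \<bullet> \<xi>))) \<partial>lborel)
        = (\<Sum>y\<in>F. c y * (\<integral>\<xi>. indicator ?D \<xi> *\<^sub>R cis (zvec (y - x) \<bullet> \<xi>) \<partial>lborel))"
      unfolding Sx by (rule integral_indicator_lincomb) auto
    also have "\<dots> = (2 * pi) ^ CARD('d) * c x"
      unfolding integral_cis_period_box using F by (simp add: if_distrib cong: if_cong)
    finally have eq: "(\<integral>\<xi>. indicator ?D \<xi> *\<^sub>R (?S \<xi> * cis (- (zvec x \<bullet> \<xi>))) \<partial>lborel) = (2 * pi) ^ CARD('d) * c x" .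
    have "?I - (2 * pi) ^ CARD('d) * c x = (\<integral>\<xi>. indicator ?D \<xi> *\<^sub>R ((fhat c \<xi> - ?S \<xi>) * cis (- (zvec x \<bullet> \<xi>))) \<partial>lborel)"
      unfolding eq[symmetric]
    proof (subst Bochner_Integration.integral_diff[symmetric])
      show "integrable lborel (\<lambda>\<xi>. indicator ?D \<xi> *\<^sub>R (fhat c \<xi> * cis (- (zvec x \<bullet> \<xi>))))"
        using norm_fhat_le[OF c] by (intro integrable_indicator_bounded[where B="\<Sum>\<^sub>\<infinity>x. norm (c x)"]) (auto simp: norm_mult)
      show "integrable lborel (\<lambda>\<xi>. indicator ?D \<xi> *\<^sub>R (?S \<xi> * cis (- (zvec x \<bullet> \<xi>))))"
        unfolding Sx by (rule integral_indicator_lincomb) auto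
    qed (simp add: algebra_simps)
    also have "norm \<dots> \<le> e * measure lborel ?D"
      using F(3) by (intro norm_integral_indicator_le) (auto simp: norm_mult intro: less_imp_le)
    finally show ?thesis .
  qed
  note * = this
  have "norm (?I - (2 * pi) ^ CARD('d) * c x) \<le> 0"
  proof (rule field_le_epsilon)
    fix e :: real assume "e > 0"
    hence "e / (measure lborel ?D + 1) > 0" by (simp add: add_nonneg_pos)
    from *[OF this] have "norm (?I - (2 * pi) ^ CARD('d) * c x) \<le> e * (measure lborel ?D / (measure lborel ?D + 1))"
      by simp
    also have "\<dots> \<le> e * 1" using \<open>e > 0\<close> by (intro mult_left_mono) (auto simp: divide_le_eq add_nonneg_pos)
    finally show "norm (?I - (2 * pi) ^ CARD('d) * c x) \<le> 0 + e" by simp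
  qed
  thus ?thesis by simp
qed

text \<open>The shift v is real because n \<alpha> need not be a lattice point; products of one
  exponential with the conjugate of another still have integer frequency, so orthogonality persists.
  Let G be the sum of the exponentials weighted by the conjugate coefficients, S the sum of squares
  and L = (2 pi)^d. Then G integrates to S over A, and |G|^2 to L S over the box. The weights in |G|
  \<le> L/2 + |G|^2/(2L) make the last term return S/2, which is absorbed.\<close>

lemma bessel_inequality:
  fixes A :: "(real^'d::finite) set" and v :: "real^'d"
  assumes F: "finite (F :: (int^'d) set)" and A: "A \<in> sets borel" "A \<subseteq> period_box a"
  shows "(\<Sum>x\<in>F. (norm (\<integral>\<eta>. indicator A \<eta> *\<^sub>R cis ((zvec x - v) \<bullet> \<eta>) \<partial>lborel))\<^sup>2) \<le> (2 * pi) ^ CARD('d) * measure lborel A"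
proof -
  let ?D = "period_box a :: (real^'d) set"
  have Afin: "emeasure lborel A < \<infinity>"
    by (rule emeasure_bounded_finite[OF bounded_subset[OF compact_imp_bounded A(2)]]) simp
  have [measurable]: "(\<lambda>\<xi>::real^'d. cis (w \<bullet> \<xi>)) \<in> borel_measurable borel" for w
    by (intro borel_measurable_continuous_onI continuous_intros)
  note [measurable] = A(1)
  define \<alpha> where "\<alpha> = (\<lambda>x. \<integral>\<eta>. indicator A \<eta> *\<^sub>R cis ((zvec x - v) \<bullet> \<eta>) \<partial>lborel)"
  define G where "G = (\<lambda>\<eta>. \<Sum>x\<in>F. cnj (\<alpha> x) * cis ((zvec x - v) \<bullet> \<eta>))"
  define S where "S = (\<Sum>x\<in>F. (norm (\<alpha> x))\<^sup>2)"
  define L :: real where "L = (2 * pi) ^ CARD('d)"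
  have L: "L > 0" by (simp add: L_def)
  have Gm [measurable]: "G \<in> borel_measurable borel" unfolding G_def by measurable
  have [measurable]: "(\<lambda>\<eta>. cnj (G \<eta>)) \<in> borel_measurable borel"
    by (rule measurable_compose[OF Gm]) (intro borel_measurable_continuous_onI continuous_intros)
  have G_le: "norm (G \<eta>) \<le> (\<Sum>x\<in>F. norm (\<alpha> x))" for \<eta>
    unfolding G_def by (intro sum_norm_le) (simp add: norm_mult)
  have norm_eq: "(complex_of_real (norm (\<alpha> x)))\<^sup>2 = cnj (\<alpha> x) * \<alpha> x" for x
    by (metis complex_norm_square mult.commute of_real_power)
  have S_eq: "of_real S = (\<integral>\<eta>. indicator A \<eta> *\<^sub>R G \<eta> \<partial>lborel)"
  proof -
    have "(\<integral>\<eta>. indicator A \<eta> *\<^sub>R G \<eta> \<partial>lborel) =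
       (\<Sum>x\<in>F. cnj (\<alpha> x) * (\<integral>\<eta>. indicator A \<eta> *\<^sub>R cis ((zvec x - v) \<bullet> \<eta>) \<partial>lborel))"
      unfolding G_def by (rule integral_indicator_lincomb) (use Afin A in auto)
    hence "(\<integral>\<eta>. indicator A \<eta> *\<^sub>R G \<eta> \<partial>lborel) = (\<Sum>x\<in>F. cnj (\<alpha> x) * \<alpha> x)"
      by (simp only: \<alpha>_def)
    thus ?thesis by (simp add: S_def norm_eq)
  qed
  have G2_int: "integrable lborel (\<lambda>\<eta>. indicator ?D \<eta> *\<^sub>R (G \<eta> * cnj (G \<eta>)))"
    by (rule integrable_indicator_bounded[where B="(\<Sum>x\<in>F. norm (\<alpha> x)) * (\<Sum>x\<in>F. norm (\<alpha> x))"])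
       (auto simp: norm_mult intro!: mult_mono G_le sum_nonneg)
  have G2: "(\<integral>\<eta>. indicator ?D \<eta> * (norm (G \<eta>))\<^sup>2 \<partial>lborel) = L * S"
  proof -
    have cc: "cis ((zvec x - v) \<bullet> \<eta>) * cnj (cis ((zvec y - v) \<bullet> \<eta>)) = cis (zvec (x - y) \<bullet> \<eta>)" for x y \<eta>
      by (simp add: cis_cnj cis_mult zvec_diff inner_diff_left)
    have GG: "G \<eta> * cnj (G \<eta>) = (\<Sum>p\<in>F \<times> F. (cnj (\<alpha> (fst p)) * \<alpha> (snd p)) * cis (zvec (fst p - snd p) \<bullet> \<eta>))" for \<eta>
      unfolding G_def cnj_sum sum_product sum.cartesian_product
      by (intro sum.cong refl) (auto simp: cc[symmetric])
    have "(\<integral>\<eta>. indicator ?D \<eta> *\<^sub>R (G \<eta> * cnj (G \<eta>)) \<partial>lborel) =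
       (\<Sum>p\<in>F \<times> F. (cnj (\<alpha> (fst p)) * \<alpha> (snd p)) * (\<integral>\<eta>. indicator ?D \<eta> *\<^sub>R cis (zvec (fst p - snd p) \<bullet> \<eta>) \<partial>lborel))"
      unfolding GG by (rule integral_indicator_lincomb) auto
    also have "\<dots> = (\<Sum>x\<in>F. \<Sum>y\<in>F. cnj (\<alpha> x) * \<alpha> y * (if x = y then of_real L else 0))"
      unfolding integral_cis_period_box sum.cartesian_product L_def by (intro sum.cong) auto
    also have "\<dots> = of_real (L * S)"
      using F by (simp add: S_def if_distrib norm_eq sum_distrib_left mult_ac cong: if_cong)
    finally have "(\<integral>\<eta>. indicator ?D \<eta> *\<^sub>R (G \<eta> * cnj (G \<eta>)) \<partial>lborel) = of_real (L * S)" .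
    moreover have "indicator ?D \<eta> *\<^sub>R (G \<eta> * cnj (G \<eta>)) = of_real (indicator ?D \<eta> * (norm (G \<eta>))\<^sup>2)" for \<eta>
      by (simp only: complex_norm_square[symmetric] scaleR_conv_of_real of_real_mult)
    ultimately show ?thesis by (simp only: integral_complex_of_real of_real_eq_iff) 
  qed
  have int2: "integrable lborel (\<lambda>\<eta>. indicator ?D \<eta> * (norm (G \<eta>))\<^sup>2)"
  proof -
    have "indicator ?D \<eta> * (norm (G \<eta>))\<^sup>2 = Re (indicator ?D \<eta> *\<^sub>R (G \<eta> * cnj (G \<eta>)))" for \<eta>
      by (simp only: complex_norm_square[symmetric] scaleR_conv_of_real flip: of_real_mult) simp
    thus ?thesis using G2_int by (simp only: integrable_Re)
  qed
  have "S \<le> norm (\<integral>\<eta>. indicator A \<eta> *\<^sub>R G \<eta> \<partial>lborel)"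
    unfolding S_eq[symmetric] by simp
  also have "\<dots> \<le> (\<integral>\<eta>. indicator A \<eta> * (L / 2) + (indicator ?D \<eta> * (norm (G \<eta>))\<^sup>2) / (2 * L) \<partial>lborel)"
  proof (rule Bochner_Integration.integral_norm_bound_integral)
    show "integrable lborel (\<lambda>\<eta>. indicator A \<eta> *\<^sub>R G \<eta>)"
      by (rule integrable_indicator_bounded[OF A(1) Afin Gm G_le])
    show "integrable lborel (\<lambda>\<eta>. indicator A \<eta> * (L / 2) + (indicator ?D \<eta> * (norm (G \<eta>))\<^sup>2) / (2 * L))"
      using int2 Afin by simp
    fix \<eta> :: "real^'d"
    have "norm (G \<eta>) \<le> L / 2 + (norm (G \<eta>))\<^sup>2 / (2 * L)"
      using L sum_squares_bound[of "norm (G \<eta>)" L] by (simp add: field_simps power2_eq_square)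
    thus "norm (indicator A \<eta> *\<^sub>R G \<eta>) \<le> indicator A \<eta> * (L / 2) + (indicator ?D \<eta> * (norm (G \<eta>))\<^sup>2) / (2 * L)"
      using A(2) L by (auto simp: indicator_def)
  qed
  also have "\<dots> = measure lborel A * (L / 2) + (L * S) / (2 * L)"
    using int2 Afin G2 by simp
  finally have "S \<le> L * measure lborel A" using L by (simp add: field_simps)
  thus ?thesis by (simp add: S_def \<alpha>_def L_def)
qed


section \<open>Bounding the largest coefficient from below\<close>

lemma Re_integral_indicator_ge:
  fixes g :: "real^'d::finite \<Rightarrow> complex"
  assumes "A \<in> sets borel" "emeasure lborel A < \<infinity>" "integrable lborel (\<lambda>x. indicator A x *\<^sub>R g x)"
    and "\<And>x. x \<in> A \<Longrightarrow> b \<le> Re (g x)"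
  shows "b * measure lborel A \<le> Re (\<integral>x. indicator A x *\<^sub>R g x \<partial>lborel)"
proof -
  have "(\<integral>x. indicator A x * b \<partial>lborel) \<le> (\<integral>x. Re (indicator A x *\<^sub>R g x) \<partial>lborel)"
    using assms by (intro integral_mono integrable_Re) (auto split: split_indicator)
  also have "\<dots> = Re (\<integral>x. indicator A x *\<^sub>R g x \<partial>lborel)"
    by (rule integral_Re[OF assms(3)])
  finally show ?thesis using assms by (simp add: mult.commute)
qed

text \<open>The pairing of \<open>c\<close> with the positive weights \<open>|\<integral>\<^sub>A e\<^bsup>i(x-v)\<eta>\<^esup> d\<eta>|\<^sup>2\<close>, whose total mass Bessel's inequality
  controls, equals a double integral of \<open>fhat c\<close> over \<open>A \<times> A\<close>.\<close>

lemma measure_le_sup_coefficients: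
  fixes c :: "int^'d::finite \<Rightarrow> complex"
  assumes c: "(\<lambda>x. norm (c x)) summable_on UNIV" and A: "A \<in> sets borel" "A \<subseteq> period_box a"
    and M: "\<And>x. norm (c x) \<le> M" and u: "norm u = 1"
    and Re_ge: "\<And>\<eta> \<zeta>. \<eta> \<in> A \<Longrightarrow> \<zeta> \<in> A \<Longrightarrow> 1 / 2 \<le> Re (u * fhat c (\<xi>0 + (\<eta> - \<zeta>)) * cis (- (v \<bullet> (\<eta> - \<zeta>))))"
  shows "measure lborel A \<le> 4 * (2 * pi) ^ CARD('d) * M"
proof -
  let ?m = "measure lborel A"
  have M0: "M \<ge> 0" using M[of 0] norm_ge_zero order_trans by blast
  have Afin: "emeasure lborel A < \<infinity>"
    by (rule emeasure_bounded_finite[OF bounded_subset[OF compact_imp_bounded A(2)]]) simp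
  have [measurable]: "(\<lambda>\<xi>::real^'d. cis (w \<bullet> \<xi>)) \<in> borel_measurable borel" "(\<lambda>\<xi>::real^'d. cis (- (w \<bullet> \<xi>))) \<in> borel_measurable borel" for w
    by (intro borel_measurable_continuous_onI continuous_intros)+
  \<comment> \<open>An error of 1/4 leaves half of the assumed 1/2 for the real part, and with a
    finite sum the double integral can be taken term by term.\<close>
  obtain F where F: "finite F" "\<And>\<xi>. norm (fhat c \<xi> - (\<Sum>x\<in>F. c x * cis (zvec x \<bullet> \<xi>))) < 1 / 4"
    by (rule fhat_finite_approx[OF c, of "1/4"]) auto
  define w where "w = (\<lambda>x. zvec x - v)"
  define \<alpha> where "\<alpha> = (\<lambda>x. \<integral>\<eta>. indicator A \<eta> *\<^sub>R cis (w x \<bullet> \<eta>) \<partial>lborel)"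
  define b where "b = (\<lambda>x. u * c x * cis (zvec x \<bullet> \<xi>0))"
  have g_eq: "u * (\<Sum>x\<in>F. c x * cis (zvec x \<bullet> (\<xi>0 + (\<eta> - \<zeta>)))) * cis (- (v \<bullet> (\<eta> - \<zeta>)))
     = (\<Sum>x\<in>F. (b x * cis (w x \<bullet> \<eta>)) * cis ((- w x) \<bullet> \<zeta>))" for \<eta> \<zeta>
  proof -
    have "cis (zvec x \<bullet> (\<xi>0 + (\<eta> - \<zeta>))) * cis (- (v \<bullet> (\<eta> - \<zeta>))) = cis (zvec x \<bullet> \<xi>0) * cis (w x \<bullet> \<eta>) * cis ((- w x) \<bullet> \<zeta>)" for x
      unfolding cis_mult by (rule arg_cong[of _ _ cis]) (simp add: w_def inner_add_right inner_diff_right inner_diff_left)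
    hence "u * (c x * cis (zvec x \<bullet> (\<xi>0 + (\<eta> - \<zeta>)))) * cis (- (v \<bullet> (\<eta> - \<zeta>))) = (b x * cis (w x \<bullet> \<eta>)) * cis ((- w x) \<bullet> \<zeta>)" for x
      by (simp only: b_def mult.assoc)
    thus ?thesis unfolding sum_distrib_left sum_distrib_right by (intro sum.cong refl)
  qed
  have Re_g: "1 / 4 \<le> Re (\<Sum>x\<in>F. (b x * cis (w x \<bullet> \<eta>)) * cis ((- w x) \<bullet> \<zeta>))" if "\<eta> \<in> A" "\<zeta> \<in> A" for \<eta> \<zeta>
  proof -
    let ?\<xi> = "\<xi>0 + (\<eta> - \<zeta>)"
    have "\<bar>Re (u * (fhat c ?\<xi> - (\<Sum>x\<in>F. c x * cis (zvec x \<bullet> ?\<xi>))) * cis (- (v \<bullet> (\<eta> - \<zeta>))))\<bar> \<le> 1 / 4"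
      by (rule order_trans[OF abs_Re_le_cmod]) (use F(2)[of ?\<xi>] u in \<open>simp add: norm_mult\<close>)
    thus ?thesis
      unfolding g_eq[symmetric] using Re_ge[OF that]
      by (simp only: right_diff_distrib left_diff_distrib minus_complex.sel abs_le_iff) linarith
  qed
  have cnj_\<alpha>: "(\<integral>\<zeta>. indicator A \<zeta> *\<^sub>R cis ((- w x) \<bullet> \<zeta>) \<partial>lborel) = cnj (\<alpha> x)" for x
  proof -
    have "(\<integral>\<zeta>. indicator A \<zeta> *\<^sub>R cis ((- w x) \<bullet> \<zeta>) \<partial>lborel) = (\<integral>\<zeta>. cnj (indicator A \<zeta> *\<^sub>R cis (w x \<bullet> \<zeta>)) \<partial>lborel)"
      by (intro Bochner_Integration.integral_cong) (auto simp: cis_cnj)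
    thus ?thesis by (simp only: \<alpha>_def Bochner_Integration.integral_cnj)
  qed
  define T where "T = (\<lambda>\<eta>. \<Sum>x\<in>F. (b x * cnj (\<alpha> x)) * cis (w x \<bullet> \<eta>))"
  have T_eq: "(\<integral>\<zeta>. indicator A \<zeta> *\<^sub>R (\<Sum>x\<in>F. (b x * cis (w x \<bullet> \<eta>)) * cis ((- w x) \<bullet> \<zeta>)) \<partial>lborel) = T \<eta>" for \<eta>
  proof -
    have "(\<integral>\<zeta>. indicator A \<zeta> *\<^sub>R (\<Sum>x\<in>F. (b x * cis (w x \<bullet> \<eta>)) * cis ((- w x) \<bullet> \<zeta>)) \<partial>lborel)
      = (\<Sum>x\<in>F. (b x * cis (w x \<bullet> \<eta>)) * (\<integral>\<zeta>. indicator A \<zeta> *\<^sub>R cis ((- w x) \<bullet> \<zeta>) \<partial>lborel))"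
      by (rule integral_indicator_lincomb[OF A(1) Afin]) auto
    thus ?thesis unfolding cnj_\<alpha> T_def by (simp add: mult_ac)
  qed
  have T_ge: "1 / 4 * ?m \<le> Re (T \<eta>)" if "\<eta> \<in> A" for \<eta>
    unfolding T_eq[symmetric]
    by (rule Re_integral_indicator_ge[OF A(1) Afin])
       (use Re_g[OF that] in \<open>auto intro!: integral_indicator_lincomb[OF A(1) Afin]\<close>)
  have "1 / 4 * ?m * ?m \<le> Re (\<integral>\<eta>. indicator A \<eta> *\<^sub>R T \<eta> \<partial>lborel)"
    by (rule Re_integral_indicator_ge[OF A(1) Afin])
       (use T_ge in \<open>auto simp: T_def intro!: integral_indicator_lincomb[OF A(1) Afin]\<close>)
  also have "\<dots> \<le> norm (\<integral>\<eta>. indicator A \<eta> *\<^sub>R T \<eta> \<partial>lborel)" by (rule complex_Re_le_cmod)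
  also have "(\<integral>\<eta>. indicator A \<eta> *\<^sub>R T \<eta> \<partial>lborel) = (\<Sum>x\<in>F. (b x * cnj (\<alpha> x)) * \<alpha> x)"
    unfolding T_def \<alpha>_def by (rule integral_indicator_lincomb[OF A(1) Afin]) auto
  also have "norm \<dots> \<le> (\<Sum>x\<in>F. M * (norm (\<alpha> x))\<^sup>2)"
  proof (intro sum_norm_le)
    fix x
    show "norm (b x * cnj (\<alpha> x) * \<alpha> x) \<le> M * (norm (\<alpha> x))\<^sup>2"
      using mult_right_mono[OF M[of x], of "(norm (\<alpha> x))\<^sup>2"] u by (simp add: norm_mult b_def power2_eq_square mult.assoc)
  qed
  also have "\<dots> = M * (\<Sum>x\<in>F. (norm (\<alpha> x))\<^sup>2)" by (simp add: sum_distrib_left)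
  also have "\<dots> \<le> M * ((2 * pi) ^ CARD('d) * ?m)"
    unfolding \<alpha>_def w_def by (intro mult_left_mono bessel_inequality[OF F(1) A] M0)
  \<comment> \<open>The double integral contributes |A| twice and Bessel's inequality once, so one
    factor remains after division.\<close>
  finally have "?m * ?m \<le> (4 * (2 * pi) ^ CARD('d) * M) * ?m" by (simp add: mult_ac)
  thus ?thesis
  proof (cases "?m = 0")
    case False
    hence "?m > 0" using measure_nonneg[of lborel A] by linarith
    thus ?thesis using \<open>?m * ?m \<le> _\<close> by simp
  qed (use M0 in auto)
qed

section \<open>Integrals over half-lines with exponential amplitude\<close>

lemma exp_half_line:
  fixes \<mu> :: real
  assumes "\<mu> > 0"
  shows "integrable lborel (\<lambda>s. indicator {b..} s * exp (- \<mu> * s))" "(\<integral>s. indicator {b..} s * exp (- \<mu> * s) \<partial>lborel) = exp (- \<mu> * b) / \<mu>"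
    and "integrable lborel (\<lambda>s. indicator {..b} s * exp (\<mu> * s))" "(\<integral>s. indicator {..b} s * exp (\<mu> * s) \<partial>lborel) = exp (\<mu> * b) / \<mu>"
proof -
  have "has_bochner_integral lborel (\<lambda>s. indicator {b..} s * exp (- \<mu> * s)) (exp (- \<mu> * b) / \<mu>)" for b
  proof (rule has_bochner_integral_nn_integral)
    let ?F = "\<lambda>s. - exp (- \<mu> * s) / \<mu>"
    have "(\<integral>\<^sup>+x. ennreal (exp (- \<mu> * x)) * indicator {b..} x \<partial>lborel) = ennreal (0 - ?F b)"
    proof (rule nn_integral_FTC_atLeast)
      show "(?F has_real_derivative exp (- \<mu> * x)) (at x)" for x
        using assms by (auto intro!: derivative_eq_intros)
      have "filterlim (\<lambda>x. - \<mu> * x) at_bot at_top"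
        using assms by (intro filterlim_tendsto_neg_mult_at_bot[OF tendsto_const] filterlim_ident) auto
      hence "((\<lambda>x. exp (- \<mu> * x)) \<longlongrightarrow> 0) at_top"
        by (rule filterlim_compose[OF exp_at_bot])
      from tendsto_minus[OF tendsto_divide[OF this tendsto_const[of \<mu>]]] assms
      show "(?F \<longlongrightarrow> 0) at_top" by simp
    qed auto
    moreover have "ennreal (indicator {b..} x * exp (- \<mu> * x)) = ennreal (exp (- \<mu> * x)) * indicator {b..} x" for x
      by (auto split: split_indicator)
    ultimately show "(\<integral>\<^sup>+x. ennreal (indicator {b..} x * exp (- \<mu> * x)) \<partial>lborel) = ennreal (exp (- \<mu> * b) / \<mu>)"
      by simp
  qed (use assms in auto)
  note H = this
  show "integrable lborel (\<lambda>s. indicator {b..} s * exp (- \<mu> * s))" "(\<integral>s. indicator {b..} s * exp (- \<mu> * s) \<partial>lborel) = exp (- \<mu> * b) / \<mu>"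
    using H[of b] by (auto simp: has_bochner_integral_iff)
  have ind: "indicator {- b..} (- s) = (indicator {..b} s :: real)" for s by (auto split: split_indicator)
  show "integrable lborel (\<lambda>s. indicator {..b} s * exp (\<mu> * s))"
    using lborel_integrable_real_affine[of "\<lambda>s. indicator {-b..} s * exp (- \<mu> * s)" "-1" 0] H[of "-b"]
    by (auto simp: has_bochner_integral_iff ind)
  show "(\<integral>s. indicator {..b} s * exp (\<mu> * s) \<partial>lborel) = exp (\<mu> * b) / \<mu>"
    using lborel_integral_real_affine[of "-1" "\<lambda>s. indicator {-b..} s * exp (- \<mu> * s)" 0] H[of "-b"]
    by (auto simp: has_bochner_integral_iff ind)
qed

text \<open>A non-integrable f has Bochner integral 0 by convention, and 0 is below the integral of
  the nonnegative g; a caller therefore supplies only the majorant.\<close>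

lemma norm_integral_le_majorant:
  fixes f :: "'a \<Rightarrow> complex"
  assumes "integrable M g" "\<And>x. norm (f x) \<le> g x"
  shows "norm (integral\<^sup>L M f) \<le> integral\<^sup>L M g"
proof (cases "integrable M f")
  case True
  have "norm (integral\<^sup>L M f) \<le> (\<integral>x. norm (f x) \<partial>M)" by simp
  also have "\<dots> \<le> integral\<^sup>L M g" using True assms by (intro integral_mono) auto
  finally show ?thesis .
next
  case False
  have "0 \<le> g x" for x using assms(2)[of x] norm_ge_zero[of "f x"] by linarith
  thus ?thesis using False by (simp add: not_integrable_integral_eq)
qed

text \<open>Below s0 the amplitude is integrable by itself since \<mu> > 0, and oscillation is used
  on [s0, s1] only. The case s0 > s1, with nothing left to oscillate, occurs when N is
  small.\<close>

lemma half_line_integral_bound: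
  fixes F :: "real \<Rightarrow> complex"
  assumes mu: "\<mu> > 0" and F: "\<And>s. s \<le> s1 \<Longrightarrow> norm (F s) \<le> exp (\<mu> * s)" and cont: "continuous_on {..s1} F"
    and B: "s0 \<le> s1 \<Longrightarrow> norm (integral {s0..s1} F) \<le> B" "0 \<le> B"
  shows "norm (\<integral>s. indicator {..<s1} s *\<^sub>R F s \<partial>lborel) \<le> exp (\<mu> * s0) / \<mu> + B"
proof (cases "s0 \<le> s1")
  case False
  have "norm (\<integral>s. indicator {..<s1} s *\<^sub>R F s \<partial>lborel) \<le> (\<integral>s. indicator {..s0} s * exp (\<mu> * s) \<partial>lborel)"
    using F False by (intro norm_integral_le_majorant exp_half_line mu) (auto split: split_indicator)
  thus ?thesis using B(2) by (simp add: exp_half_line mu)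
next
  case True
  have AE1: "AE s in lborel. s \<noteq> s1" "AE s in lborel. s \<noteq> s0" by (rule AE_lborel_singleton)+
  have c2: "set_integrable lborel {s0..s1} F"
    unfolding set_integrable_def by (intro borel_integrable_compact continuous_on_subset[OF cont]) auto
  have c1: "integrable lborel (\<lambda>s. indicator {..s0} s *\<^sub>R F s)"
  proof (rule Bochner_Integration.integrable_bound[OF exp_half_line(3)[OF mu, of s0]])
    have "continuous_on {..s0} F" by (rule continuous_on_subset[OF cont]) (use True in auto)
    thus "(\<lambda>s. indicator {..s0} s *\<^sub>R F s) \<in> borel_measurable lborel"
      using borel_measurable_continuous_on_indicator[of "{..s0}" F] by simp
    show "AE x in lborel. norm (indicator {..s0} x *\<^sub>R F x) \<le> norm (indicator {..s0} x * exp (\<mu> * x))"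
      using F True by (intro AE_I2) (auto split: split_indicator)
  qed
  have "(\<integral>s. indicator {..<s1} s *\<^sub>R F s \<partial>lborel) = (\<integral>s. indicator {..s0} s *\<^sub>R F s + indicator {s0..s1} s *\<^sub>R F s \<partial>lborel)"
  proof (rule integral_cong_AE)
    have "continuous_on {..<s1} F" by (rule continuous_on_subset[OF cont]) auto
    thus "(\<lambda>s. indicator {..<s1} s *\<^sub>R F s) \<in> borel_measurable lborel"
      using borel_measurable_continuous_on_indicator[of "{..<s1}" F] by simp
    show "(\<lambda>s. indicator {..s0} s *\<^sub>R F s + indicator {s0..s1} s *\<^sub>R F s) \<in> borel_measurable lborel"
      using c1 c2 by (auto simp: set_integrable_def)
    show "AE s in lborel. indicator {..<s1} s *\<^sub>R F s = indicator {..s0} s *\<^sub>R F s + indicator {s0..s1} s *\<^sub>R F s"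
      using AE1 by eventually_elim (use True in \<open>auto split: split_indicator\<close>)
  qed
  also have "\<dots> = (\<integral>s. indicator {..s0} s *\<^sub>R F s \<partial>lborel) + integral {s0..s1} F"
    using c1 c2 set_borel_integral_eq_integral(2)[OF c2]
    by (simp add: set_integrable_def set_lebesgue_integral_def)
  also have "norm \<dots> \<le> norm (\<integral>s. indicator {..s0} s *\<^sub>R F s \<partial>lborel) + norm (integral {s0..s1} F)"
    by (rule norm_triangle_ineq)
  also have "norm (\<integral>s. indicator {..s0} s *\<^sub>R F s \<partial>lborel) \<le> (\<integral>s. indicator {..s0} s * exp (\<mu> * s) \<partial>lborel)"
    using F True by (intro norm_integral_le_majorant exp_half_line mu) (auto split: split_indicator)
  also have "\<dots> = exp (\<mu> * s0) / \<mu>" by (simp add: exp_half_line mu)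
  finally show ?thesis using B(1)[OF True] by linarith
qed


section \<open>Homogeneous gauges\<close>

lemma mpow_exp: "mpow (exp s) E \<xi> = mexp (s *\<^sub>R E) *v \<xi>"
  by (simp add: mpow_def)

lemma homogeneous_wrt_flow:
  assumes "homogeneous_wrt P E" shows "P (mexp (s *\<^sub>R E) *v \<xi>) = exp s * P \<xi>"
  using assms[unfolded homogeneous_wrt_def, rule_format, of "exp s" \<xi>] by (simp add: mpow_exp)

lemma strongly_subhomogeneous_imp_subhomogeneous:
  assumes "strongly_subhomogeneous P E l" shows "subhomogeneous P E"
  unfolding subhomogeneous_def
proof (intro conjI allI impI)
  show "contracting E" using assms by (simp add: strongly_subhomogeneous_def)
  fix e :: real and K :: "(real^'a) set" assume "0 < e" "compact K"
  then obtain \<tau> where \<tau>: "\<tau> > 0" "\<And>t \<xi> k. 0 < t \<Longrightarrow> t < \<tau> \<Longrightarrow> \<xi> \<in> K \<Longrightarrow> k \<le> l \<Longrightarrow>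
      \<bar>t ^ k * (deriv ^^ k) (\<lambda>s. P (mpow s E \<xi>)) t\<bar> \<le> e * t"
    using assms[unfolded strongly_subhomogeneous_def, THEN conjunct2, THEN conjunct2, rule_format, OF \<open>0 < e\<close> \<open>compact K\<close>]
    by auto
  show "\<exists>\<tau>>0. \<forall>t. 0 < t \<and> t < \<tau> \<longrightarrow> (\<forall>\<xi>\<in>K. \<bar>P (mpow t E \<xi>)\<bar> \<le> e * t)"
    using \<tau>(1) \<tau>(2)[of _ _ 0] by (intro exI[of _ \<tau>]) auto
qed

text \<open>Raise y \<le> e^y with y = x / (2 c) to the power c. This extracts any desired power of
  1/x from an exponential.\<close>

lemma exp_neg_half_le_powr:
  fixes c x :: real
  assumes c: "c > 0" and x: "x > 0"
  shows "exp (- x / 2) \<le> (2 * c) powr c * x powr (- c)"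
proof -
  have "x / (2 * c) \<le> exp (x / (2 * c))" using exp_ge_add_one_self[of "x / (2 * c)"] by linarith
  hence "(x / (2 * c)) powr c \<le> exp (x / (2 * c)) powr c" using x c by (intro powr_mono2) auto
  also have "\<dots> = exp (x / 2)" using c by (simp add: powr_def)
  finally show ?thesis using x c by (simp add: powr_divide powr_minus exp_minus field_simps)
qed

text \<open>The common frame for R at positive type and |Q| at imaginary type. Unlike in
  \<open>positive_homogeneous\<close>, one exponent is fixed, and its contraction, which the notions
  of subhomogeneity carry along, is part of the data.\<close>

locale homogeneous_gauge =
  fixes P :: "real^'d::finite \<Rightarrow> real" and E :: "real^'d^'d"
  assumes cont: "continuous_on UNIV P" and nonneg: "0 \<le> P \<xi>" and zero_iff: "P \<xi> = 0 \<longleftrightarrow> \<xi> = 0"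
    and compact_unit: "compact {\<xi>. P \<xi> = 1}" and hom: "homogeneous_wrt P E" and contr: "contracting E"
begin

lemma flow: "P (mexp (s *\<^sub>R E) *v \<xi>) = exp s * P \<xi>"
  by (rule homogeneous_wrt_flow[OF hom])

lemma pos: "\<xi> \<noteq> 0 \<Longrightarrow> 0 < P \<xi>"
  using nonneg[of \<xi>] zero_iff[of \<xi>] by linarith

lemma unit_representative:
  assumes "\<xi> \<noteq> 0"
  obtains \<eta> where "P \<eta> = 1" "\<xi> = mexp (ln (P \<xi>) *\<^sub>R E) *v \<eta>"
proof (rule that[of "mexp ((- ln (P \<xi>)) *\<^sub>R E) *v \<xi>"])
  show "P (mexp ((- ln (P \<xi>)) *\<^sub>R E) *v \<xi>) = 1"
    unfolding flow using pos[OF assms] by (simp add: exp_minus)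
qed simp

lemma small_sublevel:
  assumes r: "r > 0"
  obtains \<delta> where "\<delta> > 0" "\<And>\<xi>. P \<xi> \<le> \<delta> \<Longrightarrow> norm \<xi> < r"
proof -
  obtain C a where C: "C > 0" "a > 0" "\<And>s x. s \<le> 0 \<Longrightarrow> norm (mexp (s *\<^sub>R E) *v x) \<le> C * exp (a * s) * norm x"
    using contracting_decay[OF contr] by metis
  obtain B where B: "B > 0" "\<And>\<xi>. P \<xi> = 1 \<Longrightarrow> norm \<xi> \<le> B"
    using compact_imp_bounded[OF compact_unit] unfolding bounded_pos by auto
  \<comment> \<open>The logarithm makes C e^(aS) B at most r / 2; the cap at 0 keeps to times at
    which the decay estimate applies.\<close>
  define S where "S = min 0 (ln (r / (2 * C * B)) / a)"
  show ?thesis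
  proof (rule that[of "exp S"])
    fix \<xi> assume P: "P \<xi> \<le> exp S"
    show "norm \<xi> < r"
    proof (cases "\<xi> = 0")
      case False
      obtain \<eta> where \<eta>: "P \<eta> = 1" "\<xi> = mexp (ln (P \<xi>) *\<^sub>R E) *v \<eta>"
        using unit_representative[OF False] .
      have le: "ln (P \<xi>) \<le> S" using P pos[OF False] by (metis ln_exp ln_le_cancel_iff exp_gt_zero)
      hence "norm \<xi> \<le> C * exp (a * ln (P \<xi>)) * norm \<eta>"
        by (subst \<eta>(2)) (rule C(3), simp add: S_def)
      also have "\<dots> \<le> C * exp (a * S) * B"
        using le C B(1) B(2)[OF \<eta>(1)] by (intro mult_mono) auto
      also have "\<dots> \<le> C * exp (ln (r / (2 * C * B))) * B"
        using C B by (intro mult_right_mono mult_left_mono) (auto simp: S_def min_def field_simps)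
      also have "\<dots> = r / 2" using r C B by simp
      finally show ?thesis using r by simp
    qed (use r in simp)
  qed simp
qed

lemma bounded_sublevel: "bounded {\<xi>. P \<xi> \<le> c}"
proof (cases "c > 0")
  case True
  obtain \<delta> where \<delta>: "\<delta> > 0" "\<And>\<xi>. P \<xi> \<le> \<delta> \<Longrightarrow> norm \<xi> < 1" by (rule small_sublevel[of 1]) auto
  define s where "s = ln (c / \<delta>)"
  have s: "exp (- s) = \<delta> / c" using True \<delta>(1) by (simp add: s_def exp_minus)
  have "norm \<xi> \<le> norm (mexp (s *\<^sub>R E))" if "P \<xi> \<le> c" for \<xi>
  proof -
    let ?\<zeta> = "mexp ((- s) *\<^sub>R E) *v \<xi>"
    have "P ?\<zeta> = \<delta> / c * P \<xi>" unfolding flow s ..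
    also have "\<dots> \<le> \<delta> / c * c" using that True \<delta>(1) by (intro mult_left_mono) auto
    finally have "norm ?\<zeta> < 1" using True by (intro \<delta>(2)) simp
    have "norm \<xi> = norm (mexp (s *\<^sub>R E) *v ?\<zeta>)" by (simp only: mexp_inverse_mv)
    also have "\<dots> \<le> norm (mexp (s *\<^sub>R E)) * norm ?\<zeta>" by (rule norm_matrix_vector_mult_le)
    also have "\<dots> \<le> norm (mexp (s *\<^sub>R E)) * 1"
      by (rule mult_left_mono[OF less_imp_le[OF \<open>norm ?\<zeta> < 1\<close>] norm_ge_zero])
    finally show ?thesis by simp
  qed
  thus ?thesis by (intro boundedI[of _ "norm (mexp (s *\<^sub>R E))"]) simp
next
  case False
  hence "{\<xi>. P \<xi> \<le> c} \<subseteq> {0}"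
  proof (intro subsetI)
    fix \<xi> assume "\<xi> \<in> {\<xi>. P \<xi> \<le> c}"
    hence "P \<xi> = 0" using nonneg[of \<xi>] False by simp
    thus "\<xi> \<in> {0}" using zero_iff by simp
  qed
  thus ?thesis by (rule bounded_subset[rotated]) simp
qed

text \<open>Take the unit level set as the compact set and t = P(\<xi>). The origin lies on no orbit
  of the unit level set, hence the separate assumption on its value.\<close>

lemma subhomogeneous_le:
  assumes sub: "subhomogeneous Pt E" and "Pt 0 = 0" and e: "e > 0"
  obtains \<delta> where "\<delta> > 0" "\<And>\<xi>. P \<xi> < \<delta> \<Longrightarrow> \<bar>Pt \<xi>\<bar> \<le> e * P \<xi>"
proof -
  obtain \<tau> where \<tau>: "\<tau> > 0" "\<And>t \<xi>. 0 < t \<Longrightarrow> t < \<tau> \<Longrightarrow> P \<xi> = 1 \<Longrightarrow> \<bar>Pt (mpow t E \<xi>)\<bar> \<le> e * t"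
    using sub[unfolded subhomogeneous_def, THEN conjunct2, rule_format, OF e compact_unit] by auto
  show ?thesis
  proof (rule that[OF \<tau>(1)])
    fix \<xi> assume *: "P \<xi> < \<tau>"
    show "\<bar>Pt \<xi>\<bar> \<le> e * P \<xi>"
    proof (cases "\<xi> = 0")
      case False
      obtain \<eta> where \<eta>: "P \<eta> = 1" "\<xi> = mexp (ln (P \<xi>) *\<^sub>R E) *v \<eta>"
        using unit_representative[OF False] .
      thus ?thesis using \<tau>(2)[of "P \<xi>" \<eta>] pos[OF False] * by (simp add: mpow_def)
    qed (use assms nonneg[of 0] in simp)
  qed
qed

text \<open>The determinant of the contracting dilation is t^(tr E), and it tends to det 0 = 0 as t
  tends to 0.\<close>

lemma trace_pos: "trace E > 0"
proof (rule ccontr)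
  assume "\<not> trace E > 0"
  have "((\<lambda>t. mexp (ln t *\<^sub>R E)) \<longlongrightarrow> 0) (at_right 0)"
    using contr unfolding contracting_def by (simp add: tendsto_norm_zero_iff)
  hence "((\<lambda>t. det (mexp (ln t *\<^sub>R E))) \<longlongrightarrow> det (0 :: real^'d^'d)) (at_right 0)"
    unfolding det_def by (intro tendsto_intros)
  moreover have "det (0 :: real^'d^'d) = 0"
    by (rule det_zero_row(1)[of undefined]) (simp add: row_def vec_eq_iff)
  ultimately have "((\<lambda>t. exp (ln t * trace E)) \<longlongrightarrow> 0) (at_right 0)"
    by (simp add: det_mexp)
  hence "eventually (\<lambda>t. exp (ln t * trace E) < 1) (at_right 0)"
    by (rule order_tendstoD) simp
  moreover have "eventually (\<lambda>t::real. t < 1) (at_right 0)" "eventually (\<lambda>t::real. t > 0) (at_right 0)"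
    by (auto simp: eventually_at_right_field intro: exI[of _ 1])
  ultimately have "eventually (\<lambda>t::real. False) (at_right 0)"
  proof eventually_elim
    case (elim t)
    hence "ln t * trace E \<ge> 0"
      using \<open>\<not> trace E > 0\<close> by (intro mult_nonpos_nonpos) auto
    with elim(1) show False by simp
  qed
  thus False by simp
qed

lemma sublevel_measure_pos: "measure lborel {\<xi>. P \<xi> \<le> 1} > 0"
proof -
  have "open {\<xi>. P \<xi> < 1}"
    using cont by (intro open_Collect_less continuous_intros) auto
  moreover have "0 \<in> {\<xi>. P \<xi> < 1}" using zero_iff[of 0] by simp
  ultimately obtain r where r: "r > 0" "ball 0 r \<subseteq> {\<xi>. P \<xi> < 1}" by (meson openE)
  have "{\<xi>. P \<xi> \<le> 1} \<in> sets borel"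
    using cont by (intro borel_closed closed_Collect_le continuous_intros) auto
  hence "measure lborel (ball (0::real^'d) r) \<le> measure lborel {\<xi>. P \<xi> \<le> 1}"
    using r(2) emeasure_bounded_finite[OF bounded_sublevel[of 1]]
    by (intro measure_mono_fmeasurable) (auto simp: fmeasurable_def)
  moreover have "measure lborel (ball (0::real^'d) r) > 0" using r(1) by (simp add: content_ball_pos)
  ultimately show ?thesis by linarith
qed

text \<open>If \<open>P\<close> is homogeneous with respect to \<open>E\<close> and \<open>E'\<close>, then \<open>e\<^bsup>E\<^esup> e\<^bsup>-E'\<^esup>\<close> preserves the
  set \<open>{P \<le> 1}\<close> of finite positive measure, so its determinant is 1.\<close>

lemma trace_unique:
  assumes "homogeneous_wrt P E'" shows "trace E' = trace E"
proof -
  let ?V = "{\<xi>. P \<xi> \<le> 1}"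
  define g where "g = mexp (1 *\<^sub>R E) ** mexp ((- 1) *\<^sub>R E')"
  have det: "det g = exp (trace E - trace E')"
    unfolding g_def det_mul det_mexp by (simp add: exp_diff exp_minus field_simps)
  have Pg: "P (g *v \<xi>) = P \<xi>" for \<xi>
    unfolding g_def matrix_vector_mul_assoc[symmetric] flow homogeneous_wrt_flow[OF assms] by (simp add: exp_minus)
  have img: "(*v) g ` ?V = ?V"
  proof (intro equalityI subsetI)
    fix \<xi> assume \<xi>: "\<xi> \<in> ?V"
    let ?\<zeta> = "mexp (1 *\<^sub>R E') *v (mexp ((- 1) *\<^sub>R E) *v \<xi>)"
    have "g *v ?\<zeta> = \<xi>"
      unfolding g_def matrix_vector_mul_assoc[symmetric] using mexp_inverse_mv[of 1 E] mexp_inverse_mv[of 1 E'] by simp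
    moreover from this have "?\<zeta> \<in> ?V" using Pg[of ?\<zeta>] \<xi> by simp
    ultimately show "\<xi> \<in> (*v) g ` ?V" by (metis imageI)
  qed (auto simp: Pg)
  have "?V \<in> sets borel"
    using cont by (intro borel_closed closed_Collect_le continuous_intros) auto
  from measure_lborel_matrix_image(1)[OF _ this, of g] have "measure lborel ?V = exp (trace E - trace E') * measure lborel ?V"
    by (simp add: img det)
  thus ?thesis using sublevel_measure_pos by simp
qed

text \<open>\<open>hom_order\<close> is the trace of an arbitrarily picked exponent; by
  \<open>trace_unique\<close> the pick does not matter.\<close>

lemma hom_order_eq: "hom_order P = trace E"
  unfolding hom_order_def
  by (rule trace_unique) (metis (mono_tags) ExpSet_def hom mem_Collect_eq someI)

text \<open>Let w = e^(sE) x, pull the unit vector w/|w| back to x/|w|, and let m be the minimum of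
  P on the unit sphere. Then e^(-s) m \<le> P(x/|w|) \<le> C |x|^2/|w|^2, which is growth of order
  e^(s/2). The quadratic bound needs |x| \<le> |w|; otherwise w is shorter than x, which is why K is
  at least 1.\<close>

lemma flow_growth:
  assumes quad: "\<And>\<xi>. norm \<xi> \<le> 1 \<Longrightarrow> P \<xi> \<le> C * (norm \<xi>)\<^sup>2"
  obtains K where "K > 0" "\<And>s x. s \<ge> 0 \<Longrightarrow> norm (mexp (s *\<^sub>R E) *v x) \<le> K * exp (s / 2) * norm x"
proof -
  have "sphere 0 1 \<noteq> ({} :: (real^'d) set)" by simp
  then obtain v0 where v0: "v0 \<in> sphere 0 1" "\<And>v. v \<in> sphere 0 1 \<Longrightarrow> P v0 \<le> P v"
    using continuous_attains_inf[of "sphere 0 1" P] continuous_on_subset[OF cont] by auto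
  define m where "m = P v0"
  have m: "m > 0" unfolding m_def using v0 by (intro pos) auto
  have "P v0 \<le> C" using quad[of v0] v0(1) by simp
  hence Cpos: "C > 0" using m by (simp add: m_def)
  define K where "K = max 1 (sqrt (C / m))"
  show ?thesis
  proof (rule that[of K])
    show "K > 0" by (simp add: K_def)
    fix s :: real and x assume s: "s \<ge> 0"
    define w where "w = mexp (s *\<^sub>R E) *v x"
    show "norm w \<le> K * exp (s / 2) * norm x"
    proof (cases "w = 0")
      case False
      define v where "v = (1 / norm w) *\<^sub>R w"
      have v: "norm v = 1" using False by (simp add: v_def)
      have Xv: "mexp ((- s) *\<^sub>R E) *v v = (1 / norm w) *\<^sub>R x"
        unfolding v_def w_def matrix_vector_mult_scaleR by simp
      show ?thesis
      proof (cases "norm x / norm w \<le> 1")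
        case True
        have "exp (- s) * m \<le> exp (- s) * P v"
          using v0(2)[of v] v by (simp add: m_def)
        also have "\<dots> = P ((1 / norm w) *\<^sub>R x)" unfolding Xv[symmetric] flow ..
        also have "\<dots> \<le> C * (norm ((1 / norm w) *\<^sub>R x))\<^sup>2" using True by (intro quad) simp
        also have "\<dots> = C * (norm x)\<^sup>2 / (norm w)\<^sup>2" by (simp add: power_divide)
        finally have "(norm w)\<^sup>2 * (exp (- s) * m) \<le> C * (norm x)\<^sup>2"
          using False by (simp add: field_simps)
        hence "(norm w)\<^sup>2 \<le> (C / m) * exp s * (norm x)\<^sup>2"
          using m by (simp add: exp_minus field_simps)
        also have "\<dots> = (sqrt (C / m) * exp (s / 2) * norm x)\<^sup>2"
          using m Cpos by (simp add: power_mult_distrib exp_double[symmetric])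
        finally have "norm w \<le> sqrt (C / m) * exp (s / 2) * norm x"
          by (rule power2_le_imp_le) (use m Cpos in auto)
        also have "\<dots> \<le> K * exp (s / 2) * norm x"
          by (intro mult_right_mono) (auto simp: K_def)
        finally show ?thesis .
      next
        case F2: False
        hence "norm w \<le> 1 * 1 * norm x" using False by (simp add: field_simps)
        also have "\<dots> \<le> K * exp (s / 2) * norm x"
          using s by (intro mult_right_mono mult_mono) (auto simp: K_def)
        finally show ?thesis .
      qed
    qed (use \<open>K > 0\<close> in simp)
  qed
qed

lemma gaussian_bound:
  obtains C where "C > 0" "\<And>N f. N \<ge> 1 \<Longrightarrow> integrable lborel f \<Longrightarrow> (\<And>\<xi>. norm (f \<xi> :: complex) \<le> exp (- N * P \<xi> / 2))
    \<Longrightarrow> norm (integral\<^sup>L lborel f) \<le> C * N powr (- trace E)"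
proof -
  define \<mu> where "\<mu> = trace E"
  have mu: "\<mu> > 0" using trace_pos by (simp add: \<mu>_def)
  \<comment> \<open>With this exponent e^(\<mu>s) (N e^s)^(-c) equals N^(-c) e^(-s). Integrated from
    s = - ln N, where N e^s = 1, it gives N^(1-c) = N^(-\<mu>), the same order as the part
    below.\<close>
  define c where "c = \<mu> + 1"
  have c: "c > 0" using mu by (simp add: c_def)
  define A where "A = {\<eta>. 1 \<le> P \<eta> \<and> P \<eta> \<le> exp 1}"
  have A: "bounded A" by (rule bounded_subset[OF bounded_sublevel[of "exp 1"]]) (auto simp: A_def)
  define C where "C = (1 / \<mu> + (2 * c) powr c) * measure lborel A + 1"
  show ?thesis
  proof (rule that[of C])
    show "C > 0" using mu by (auto simp: C_def intro!: add_nonneg_pos mult_nonneg_nonneg add_nonneg_nonneg)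
    fix N and f :: "real^'d \<Rightarrow> complex"
    assume N: "N \<ge> 1" and f: "integrable lborel f" and le: "\<And>\<xi>. norm (f \<xi>) \<le> exp (- N * P \<xi> / 2)"
    let ?s0 = "- ln N"
    let ?g = "\<lambda>s. indicator {..?s0} s * exp (\<mu> * s) + ((2 * c) powr c * N powr (- c)) * (indicator {?s0..} s * exp (- 1 * s))"
    have "norm (\<integral>s. exp (s * trace E) *\<^sub>R f (mexp (s *\<^sub>R E) *v \<eta>) \<partial>lborel) \<le> (1 / \<mu> + (2 * c) powr c) * N powr (- \<mu>)"
      if \<eta>: "\<eta> \<in> A" for \<eta>
    proof -
      have "norm (exp (s * trace E) *\<^sub>R f (mexp (s *\<^sub>R E) *v \<eta>)) \<le> ?g s" for s
      proof -
        have "N * exp s * 1 \<le> N * exp s * P \<eta>"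
          using \<eta> N by (intro mult_left_mono) (auto simp: A_def)
        hence "exp (- N * (exp s * P \<eta>) / 2) \<le> exp (- (N * exp s) / 2)" by simp
        with le[of "mexp (s *\<^sub>R E) *v \<eta>"] have f1: "norm (f (mexp (s *\<^sub>R E) *v \<eta>)) \<le> exp (- (N * exp s) / 2)"
          unfolding flow by linarith
        show ?thesis
        proof (cases "s \<le> ?s0")
          case True
          have "exp (\<mu> * s) * norm (f (mexp (s *\<^sub>R E) *v \<eta>)) \<le> exp (\<mu> * s) * 1"
            using f1 N by (intro mult_left_mono) (auto intro: order_trans)
          moreover have "0 \<le> ((2 * c) powr c * N powr (- c)) * (indicator {?s0..} s * exp (- 1 * s))"
            by (intro mult_nonneg_nonneg) auto
          ultimately have "exp (\<mu> * s) * norm (f (mexp (s *\<^sub>R E) *v \<eta>)) \<le> exp (\<mu> * s) * 1 +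
              ((2 * c) powr c * N powr (- c)) * (indicator {?s0..} s * exp (- 1 * s))" by linarith
          thus ?thesis using True by (simp add: \<mu>_def mult.commute)
        next
          case False
          have "exp (- (N * exp s) / 2) \<le> (2 * c) powr c * (N * exp s) powr (- c)"
            by (rule exp_neg_half_le_powr[OF c]) (use N in auto)
          hence "exp (\<mu> * s) * norm (f (mexp (s *\<^sub>R E) *v \<eta>)) \<le> exp (\<mu> * s) * ((2 * c) powr c * (N * exp s) powr (- c))"
            using f1 by (intro mult_left_mono) auto
          also have "(N * exp s) powr (- c) = N powr (- c) * exp (- c * s)"
            using N by (simp add: powr_mult exp_powr_real mult.commute)
          also have "exp (\<mu> * s) * ((2 * c) powr c * (N powr (- c) * exp (- c * s))) = ((2 * c) powr c * N powr (- c)) * exp (- 1 * s)"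
          proof -
            have "exp (\<mu> * s) * exp (- c * s) = exp (- 1 * s)"
              unfolding exp_add[symmetric] by (simp add: c_def algebra_simps)
            thus ?thesis by (metis mult.left_commute mult.assoc)
          qed
          finally show ?thesis using False by (simp add: \<mu>_def mult.commute)
        qed
      qed
      moreover have "integrable lborel ?g"
        using exp_half_line(1)[of 1 ?s0] exp_half_line(3)[OF mu, of ?s0] by simp
      ultimately have "norm (\<integral>s. exp (s * trace E) *\<^sub>R f (mexp (s *\<^sub>R E) *v \<eta>) \<partial>lborel) \<le> integral\<^sup>L lborel ?g"
        by (intro norm_integral_le_majorant)
      also have "\<dots> = exp (\<mu> * ?s0) / \<mu> + ((2 * c) powr c * N powr (- c)) * (exp (- 1 * ?s0) / 1)"
        using exp_half_line(1,2)[of 1 ?s0] exp_half_line(3,4)[OF mu, of ?s0] by simp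
      also have "exp (\<mu> * ?s0) = N powr (- \<mu>)" using N by (simp add: powr_def)
      also have "N powr (- c) = N powr (- \<mu>) / N" using N by (simp add: c_def powr_diff)
      also have "exp (- 1 * ?s0) / 1 = N" using N by simp
      finally show ?thesis using N by (simp add: algebra_simps)
    qed
    from polar_integral_bound[OF cont nonneg zero_iff flow f A[unfolded A_def] this[unfolded A_def]]
    have "norm (integral\<^sup>L lborel f) \<le> (1 / \<mu> + (2 * c) powr c) * N powr (- \<mu>) * measure lborel A"
      by (simp add: A_def)
    also have "\<dots> \<le> C * N powr (- \<mu>)" using N by (simp add: C_def algebra_simps)
    finally show "norm (integral\<^sup>L lborel f) \<le> C * N powr (- trace E)" by (simp add: \<mu>_def)
  qed
qed

end

section \<open>Polynomials without terms of degree below two\<close>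

lemma poly_nolin_quadratic:
  assumes "poly_nolin P"
  obtains C where "C > 0" "\<And>\<xi>. norm \<xi> \<le> 1 \<Longrightarrow> \<bar>P \<xi>\<bar> \<le> C * (norm \<xi>)\<^sup>2"
proof -
  obtain B c where B: "finite B" "\<And>\<beta>. \<beta> \<in> B \<Longrightarrow> 2 \<le> sum \<beta> UNIV" "\<And>\<xi>. P \<xi> = (\<Sum>\<beta>\<in>B. c \<beta> * rmono \<xi> \<beta>)"
    using assms unfolding poly_nolin_def by blast
  show ?thesis
  proof (rule that[of "(\<Sum>\<beta>\<in>B. \<bar>c \<beta>\<bar>) + 1"])
    show "(\<Sum>\<beta>\<in>B. \<bar>c \<beta>\<bar>) + 1 > 0" by (simp add: add_nonneg_pos sum_nonneg)
    fix \<xi> :: "real^'a" assume \<xi>: "norm \<xi> \<le> 1"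
    have mono: "\<bar>rmono \<xi> \<beta>\<bar> \<le> (norm \<xi>)\<^sup>2" if "\<beta> \<in> B" for \<beta>
    proof -
      have "\<bar>rmono \<xi> \<beta>\<bar> = (\<Prod>j\<in>UNIV. \<bar>\<xi> $ j\<bar> ^ \<beta> j)" by (simp add: rmono_def abs_prod power_abs)
      also have "\<dots> \<le> (\<Prod>j\<in>UNIV. norm \<xi> ^ \<beta> j)"
        by (intro prod_mono) (auto intro!: power_mono component_le_norm_cart)
      also have "\<dots> = norm \<xi> ^ sum \<beta> UNIV" by (simp add: power_sum)
      also have "\<dots> \<le> norm \<xi> ^ 2" using B(2)[OF that] \<xi> by (intro power_decreasing) auto
      finally show ?thesis .
    qed
    have "\<bar>P \<xi>\<bar> \<le> (\<Sum>\<beta>\<in>B. \<bar>c \<beta>\<bar> * (norm \<xi>)\<^sup>2)"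
      unfolding B(3) by (rule order_trans[OF sum_abs]) (auto simp: abs_mult intro!: sum_mono mult_left_mono mono)
    thus "\<bar>P \<xi>\<bar> \<le> ((\<Sum>\<beta>\<in>B. \<bar>c \<beta>\<bar>) + 1) * (norm \<xi>)\<^sup>2"
      by (simp add: sum_distrib_right algebra_simps) (smt (verit) zero_le_power2)
  qed
qed

lemma poly_nolin_continuous:
  assumes "poly_nolin P" shows "continuous_on S P"
proof -
  obtain B c where "P = (\<lambda>\<xi>. \<Sum>\<beta>\<in>B. c \<beta> * rmono \<xi> \<beta>)"
    using assms unfolding poly_nolin_def by (metis ext)
  thus ?thesis unfolding rmono_def by (auto intro!: continuous_intros)
qed


section \<open>Points of imaginary type\<close>

text \<open>The derivative is expressed through partial derivatives because these are what
  \<open>Ck_on\<close> controls; a second application then differentiates each coefficient.\<close>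

lemma flow_compose_has_derivative:
  fixes f :: "real^'d::finite \<Rightarrow> real"
  assumes "f differentiable (at (mexp (s *\<^sub>R E) *v \<eta>))"
  shows "((\<lambda>s. f (mexp (s *\<^sub>R E) *v \<eta>)) has_real_derivative
    (\<Sum>j\<in>UNIV. frechet_derivative f (at (mexp (s *\<^sub>R E) *v \<eta>)) (axis j 1) * (mexp (s *\<^sub>R E) *v (E *v \<eta>)) $ j)) (at s)"
proof -
  let ?x = "mexp (s *\<^sub>R E) *v \<eta>" and ?v = "mexp (s *\<^sub>R E) *v (E *v \<eta>)"
  let ?D = "frechet_derivative f (at ?x)"
  have D: "(f has_derivative ?D) (at ?x)" using assms by (simp add: frechet_derivative_works)
  have lin: "linear ?D" using D has_derivative_linear by blast
  have "((\<lambda>s. mexp (s *\<^sub>R E) *v \<eta>) has_derivative (\<lambda>h. h *\<^sub>R ?v)) (at s)"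
    using mexp_mv_has_vector_derivative[of E \<eta> s] by (simp add: has_vector_derivative_def)
  from diff_chain_at[OF this D] have "((\<lambda>s. f (mexp (s *\<^sub>R E) *v \<eta>)) has_derivative (\<lambda>h. ?D (h *\<^sub>R ?v))) (at s)"
    by (simp add: o_def)
  moreover have "?D ?v = (\<Sum>j\<in>UNIV. ?D (axis j 1) * ?v $ j)"
  proof -
    have "(\<Sum>j\<in>UNIV. ?v $ j *\<^sub>R axis j 1) = ?v"
      by (simp add: vec_eq_iff axis_def if_distrib cong: if_cong)
    hence "?D ?v = ?D (\<Sum>j\<in>UNIV. ?v $ j *\<^sub>R axis j 1)" by simp
    also have "\<dots> = (\<Sum>j\<in>UNIV. ?D (axis j 1) * ?v $ j)"
      by (simp add: linear_sum[OF lin] linear_cmul[OF lin] mult.commute)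
    finally show ?thesis .
  qed
  ultimately show ?thesis
    by (simp add: has_field_derivative_def linear_cmul[OF lin] mult.commute[of _ "sum _ _"])
qed

lemma Ck_on_1_flow:
  fixes f :: "real^'d::finite \<Rightarrow> real"
  assumes "Ck_on 1 U f"
  obtains h1 where "\<And>s. mexp (s *\<^sub>R E) *v \<eta> \<in> U \<Longrightarrow> ((\<lambda>s. f (mexp (s *\<^sub>R E) *v \<eta>)) has_real_derivative h1 s) (at s)"
proof -
  have "f differentiable (at x)" if "x \<in> U" for x using assms that by simp
  from that[OF flow_compose_has_derivative[OF this]] show ?thesis .
qed

lemma Ck_on_2_flow:
  fixes f :: "real^'d::finite \<Rightarrow> real"
  assumes "Ck_on 2 U f"
  obtains h1 h2 where "\<And>s. mexp (s *\<^sub>R E) *v \<eta> \<in> U \<Longrightarrow> ((\<lambda>s. f (mexp (s *\<^sub>R E) *v \<eta>)) has_real_derivative h1 s) (at s)"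
    "\<And>s. mexp (s *\<^sub>R E) *v \<eta> \<in> U \<Longrightarrow> (h1 has_real_derivative h2 s) (at s)"
proof -
  let ?X = "\<lambda>s. mexp (s *\<^sub>R E) *v \<eta>" and ?v = "\<lambda>s. mexp (s *\<^sub>R E) *v (E *v \<eta>)"
  define D where "D = (\<lambda>j x. frechet_derivative f (at x) (axis j 1))"
  have f: "f differentiable (at x)" "\<And>j. D j differentiable (at x)" if "x \<in> U" for x
    using assms that by (auto simp: numeral_2_eq_2 D_def)
  have v: "((\<lambda>s. ?v s $ j) has_real_derivative (mexp (s *\<^sub>R E) *v (E *v (E *v \<eta>))) $ j) (at s)" for j s
    using bounded_linear.has_vector_derivative[OF bounded_linear_vec_nth mexp_mv_has_vector_derivative]
    by (simp add: has_real_derivative_iff_has_vector_derivative)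
  define h1 where "h1 = (\<lambda>s. \<Sum>j\<in>UNIV. D j (?X s) * ?v s $ j)"
  \<comment> \<open>Only the existence of the second derivative is wanted: its size will come from
    strong subhomogeneity, not from a formula.\<close>
  have "\<exists>d. (h1 has_real_derivative d) (at s)" if "?X s \<in> U" for s
    unfolding h1_def
    by (rule exI) (rule DERIV_sum DERIV_mult flow_compose_has_derivative f(2)[OF that] v)+
  then obtain h2 where "\<And>s. ?X s \<in> U \<Longrightarrow> (h1 has_real_derivative h2 s) (at s)" by metis
  moreover have "((\<lambda>s. f (?X s)) has_real_derivative h1 s) (at s)" if "?X s \<in> U" for s
    unfolding h1_def D_def by (rule flow_compose_has_derivative[OF f(1)[OF that]])
  ultimately show ?thesis by (rule that[rotated])
qed

text \<open>Along the flow the Euler operator \<open>t \<partial>\<^sub>t\<close> becomes \<open>d/ds\<close> with \<open>t = e\<^sup>s\<close>, and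
  \<open>t\<^sup>2 \<partial>\<^sub>t\<^sup>2 = (d/ds)\<^sup>2 - d/ds\<close>.\<close>

lemma deriv_mpow:
  fixes f :: "real^'d::finite \<Rightarrow> real"
  assumes h1: "((\<lambda>s. f (mexp (s *\<^sub>R E) *v \<eta>)) has_real_derivative h1) (at (ln t))" and t: "t > 0"
  shows "deriv (\<lambda>t. f (mpow t E \<eta>)) t = h1 / t"
proof -
  have "((\<lambda>t. f (mexp (ln t *\<^sub>R E) *v \<eta>)) has_real_derivative h1 * (1 / t)) (at t)"
    using DERIV_chain2[OF h1 DERIV_ln_divide[OF t]] .
  thus ?thesis by (simp add: mpow_def DERIV_imp_deriv)
qed

text \<open>\<tau> and U serve all \<eta> in K at once. The orbit has to be in U because
  \<open>deriv\<close> is meaningful only where the function is differentiable; there its value can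
  be identified with \<open>h1\<close>.\<close>

lemma strongly_subhomogeneous_1_flow:
  fixes f :: "real^'d::finite \<Rightarrow> real"
  assumes ss: "strongly_subhomogeneous f E 1" and K: "compact K" and e: "e > 0"
  obtains \<tau> U where "\<tau> > 0" "open U" "0 \<in> U"
    "\<And>\<eta>. \<eta> \<in> K \<Longrightarrow> \<exists>h1. \<forall>s. exp s < \<tau> \<and> mexp (s *\<^sub>R E) *v \<eta> \<in> U \<longrightarrow>
        ((\<lambda>s. f (mexp (s *\<^sub>R E) *v \<eta>)) has_real_derivative h1 s) (at s) \<and> \<bar>h1 s\<bar> \<le> e * exp s \<and>
        \<bar>f (mexp (s *\<^sub>R E) *v \<eta>)\<bar> \<le> e * exp s"
proof -
  obtain U where U: "open U" "0 \<in> U" "Ck_on 1 U f"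
    using ss unfolding strongly_subhomogeneous_def by blast
  obtain \<tau> where \<tau>: "\<tau> > 0" "\<And>t \<xi> k. 0 < t \<Longrightarrow> t < \<tau> \<Longrightarrow> \<xi> \<in> K \<Longrightarrow> k \<le> 1 \<Longrightarrow>
      \<bar>t ^ k * (deriv ^^ k) (\<lambda>s. f (mpow s E \<xi>)) t\<bar> \<le> e * t"
    using ss[unfolded strongly_subhomogeneous_def, THEN conjunct2, THEN conjunct2, rule_format, OF e K] by auto
  show ?thesis
  proof (rule that[OF \<tau>(1) U(1,2)])
    fix \<eta> assume \<eta>: "\<eta> \<in> K"
    obtain h1 where h1: "\<And>s. mexp (s *\<^sub>R E) *v \<eta> \<in> U \<Longrightarrow> ((\<lambda>s. f (mexp (s *\<^sub>R E) *v \<eta>)) has_real_derivative h1 s) (at s)"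
      by (rule Ck_on_1_flow[OF U(3)]) blast
    have "\<bar>h1 s\<bar> \<le> e * exp s \<and> \<bar>f (mexp (s *\<^sub>R E) *v \<eta>)\<bar> \<le> e * exp s"
      if "exp s < \<tau>" "mexp (s *\<^sub>R E) *v \<eta> \<in> U" for s
    proof
      have "deriv (\<lambda>t. f (mpow t E \<eta>)) (exp s) = h1 s / exp s"
        by (rule deriv_mpow) (use h1[OF that(2)] in auto)
      thus "\<bar>h1 s\<bar> \<le> e * exp s" using \<tau>(2)[of "exp s" \<eta> 1] that(1) \<eta> by simp
      show "\<bar>f (mexp (s *\<^sub>R E) *v \<eta>)\<bar> \<le> e * exp s"
        using \<tau>(2)[of "exp s" \<eta> 0] that(1) \<eta> by (simp add: mpow_exp)
    qed
    thus "\<exists>h1. \<forall>s. exp s < \<tau> \<and> mexp (s *\<^sub>R E) *v \<eta> \<in> U \<longrightarrow>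
        ((\<lambda>s. f (mexp (s *\<^sub>R E) *v \<eta>)) has_real_derivative h1 s) (at s) \<and> \<bar>h1 s\<bar> \<le> e * exp s \<and>
        \<bar>f (mexp (s *\<^sub>R E) *v \<eta>)\<bar> \<le> e * exp s"
      using h1 by (intro exI[of _ h1]) simp
  qed
qed

text \<open>The hypothesis for k = 2 bounds h2 - h1 rather than h2; adding the bound on h1 from k =
  1 gives the factor 2.\<close>

lemma strongly_subhomogeneous_2_flow:
  fixes f :: "real^'d::finite \<Rightarrow> real"
  assumes ss: "strongly_subhomogeneous f E 2" and K: "compact K" and e: "e > 0"
  obtains \<tau> U where "\<tau> > 0" "open U" "0 \<in> U"
    "\<And>\<eta>. \<eta> \<in> K \<Longrightarrow> \<exists>h1 h2. \<forall>s. exp s < \<tau> \<and> mexp (s *\<^sub>R E) *v \<eta> \<in> U \<longrightarrow>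
        ((\<lambda>s. f (mexp (s *\<^sub>R E) *v \<eta>)) has_real_derivative h1 s) (at s) \<and>
        (h1 has_real_derivative h2 s) (at s) \<and> \<bar>h1 s\<bar> \<le> e * exp s \<and> \<bar>h2 s\<bar> \<le> 2 * e * exp s"
proof -
  obtain U where U: "open U" "0 \<in> U" "Ck_on 2 U f"
    using ss unfolding strongly_subhomogeneous_def by blast
  obtain \<tau> where \<tau>: "\<tau> > 0" "\<And>t \<xi> k. 0 < t \<Longrightarrow> t < \<tau> \<Longrightarrow> \<xi> \<in> K \<Longrightarrow> k \<le> 2 \<Longrightarrow>
      \<bar>t ^ k * (deriv ^^ k) (\<lambda>s. f (mpow s E \<xi>)) t\<bar> \<le> e * t"
    using ss[unfolded strongly_subhomogeneous_def, THEN conjunct2, THEN conjunct2, rule_format, OF e K] by auto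
  show ?thesis
  proof (rule that[OF \<tau>(1) U(1,2)])
    fix \<eta> assume \<eta>: "\<eta> \<in> K"
    obtain h1 h2 where h: "\<And>s. mexp (s *\<^sub>R E) *v \<eta> \<in> U \<Longrightarrow> ((\<lambda>s. f (mexp (s *\<^sub>R E) *v \<eta>)) has_real_derivative h1 s) (at s)"
      "\<And>s. mexp (s *\<^sub>R E) *v \<eta> \<in> U \<Longrightarrow> (h1 has_real_derivative h2 s) (at s)"
      by (rule Ck_on_2_flow[OF U(3)]) blast
    let ?g = "\<lambda>t. f (mpow t E \<eta>)"
    have d1: "deriv ?g t = h1 (ln t) / t" if "t > 0" "mexp (ln t *\<^sub>R E) *v \<eta> \<in> U" for t
      by (rule deriv_mpow[OF h(1)[OF that(2)] that(1)])
    have "\<bar>h1 s\<bar> \<le> e * exp s \<and> \<bar>h2 s\<bar> \<le> 2 * e * exp s"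
      if s: "exp s < \<tau>" "mexp (s *\<^sub>R E) *v \<eta> \<in> U" for s
    proof
      have "deriv ?g (exp s) = h1 s / exp s" using d1[of "exp s"] s by simp
      thus b1: "\<bar>h1 s\<bar> \<le> e * exp s" using \<tau>(2)[of "exp s" \<eta> 1] s(1) \<eta> by simp
      \<comment> \<open>Differentiating \<open>deriv\<close> again requires its formula on a whole
        neighbourhood of e^s, not only at that point.\<close>
      define V where "V = {t \<in> {0<..}. mexp (ln t *\<^sub>R E) *v \<eta> \<in> U}"
      have "open V" 
      proof -
        have "continuous_on {0<..} (\<lambda>t::real. mexp (ln t *\<^sub>R E) *v \<eta>)" by (intro continuous_intros) auto
        from continuous_open_preimage[OF this open_greaterThan U(1)] show ?thesis
          by (simp add: V_def vimage_def Int_def)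
      qed
      moreover have "exp s \<in> V" using s by (simp add: V_def)
      moreover have "((\<lambda>t. h1 (ln t) / t) has_real_derivative (h2 s - h1 s) / (exp s)\<^sup>2) (at (exp s))"
      proof -
        have "(h1 has_real_derivative h2 s) (at (ln (exp s)))" using h(2)[OF s(2)] by simp
        from DERIV_chain2[OF this DERIV_ln_divide[of "exp s"]]
        have "((\<lambda>t. h1 (ln t)) has_real_derivative h2 s / exp s) (at (exp s))" by simp
        from DERIV_divide[OF this DERIV_ident] show ?thesis
          by (simp add: power2_eq_square)
      qed
      ultimately have "(deriv ?g has_real_derivative (h2 s - h1 s) / (exp s)\<^sup>2) (at (exp s))"
        using has_field_derivative_transform_within_open[of "\<lambda>t. h1 (ln t) / t" _ "exp s" V "deriv ?g"]
        by (auto simp: V_def d1)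
      hence "deriv (deriv ?g) (exp s) = (h2 s - h1 s) / (exp s)\<^sup>2" by (rule DERIV_imp_deriv)
      hence "\<bar>h2 s - h1 s\<bar> \<le> e * exp s"
        using \<tau>(2)[of "exp s" \<eta> 2] s(1) \<eta> by (simp add: numeral_2_eq_2)
      thus "\<bar>h2 s\<bar> \<le> 2 * e * exp s" using b1 by linarith
    qed
    thus "\<exists>h1 h2. \<forall>s. exp s < \<tau> \<and> mexp (s *\<^sub>R E) *v \<eta> \<in> U \<longrightarrow>
        ((\<lambda>s. f (mexp (s *\<^sub>R E) *v \<eta>)) has_real_derivative h1 s) (at s) \<and>
        (h1 has_real_derivative h2 s) (at s) \<and> \<bar>h1 s\<bar> \<le> e * exp s \<and> \<bar>h2 s\<bar> \<le> 2 * e * exp s"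
      using h by (intro exI[of _ h1] exI[of _ h2]) simp
  qed
qed

text \<open>The type only makes |Q| homogeneous. Along an orbit e^(-s) Q takes at most the two
  values Q(\<eta>) and - Q(\<eta>), and by continuity it cannot switch between them.\<close>

lemma abs_homogeneous_imp_homogeneous:
  assumes hom: "homogeneous_wrt (\<lambda>\<xi>. \<bar>Q \<xi>\<bar>) E" and cont: "continuous_on UNIV Q"
  shows "Q (mexp (s *\<^sub>R E) *v \<eta>) = exp s * Q \<eta>"
proof -
  let ?g = "\<lambda>s. exp (- s) * Q (mexp (s *\<^sub>R E) *v \<eta>)"
  have "\<bar>?g s\<bar> = \<bar>Q \<eta>\<bar>" for s
    using homogeneous_wrt_flow[OF hom, of s \<eta>] by (simp add: abs_mult exp_minus)
  hence "range ?g \<subseteq> {Q \<eta>, - Q \<eta>}" by (auto simp: abs_eq_iff)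
  hence "finite (range ?g)" by (rule finite_subset) simp
  moreover have "continuous_on UNIV ?g"
    by (intro continuous_intros continuous_on_compose2[OF cont]) auto
  ultimately have "?g constant_on UNIV"
    by (intro continuous_finite_range_constant) auto
  then obtain c where "\<And>s. ?g s = c" by (auto simp: constant_on_def)
  hence "?g s = ?g 0" by metis
  thus ?thesis by (simp add: exp_minus field_simps)
qed

section \<open>Oscillation along dilation orbits\<close>

lemma mult_exp_neg_le: "c > 0 \<Longrightarrow> x * exp (- (c * x)) \<le> 1 / (c::real)"
proof -
  assume c: "c > 0"
  have "c * x \<le> exp (c * x)" using exp_ge_add_one_self[of "c * x"] by linarith
  thus ?thesis using c by (simp add: exp_minus field_simps)
qed

text \<open>Write e^(sE) = e^(-(ln N)E) e^((s + ln N)E). The first factor contracts by N^(-a) and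
  cancels |y| \<le> \<rho> + N^a. The second grows like (N e^s)^(1/2), which is at most N e^s / T
  because N e^s \<ge> T^2. A large T therefore makes the linear phase a small multiple of the main
  phase.\<close>

lemma flow_pairing_bound:
  assumes decay: "\<And>s x. s \<le> 0 \<Longrightarrow> norm (mexp (s *\<^sub>R E) *v x) \<le> C * exp (a * s) * norm x"
    and growth: "\<And>s x. s \<ge> 0 \<Longrightarrow> norm (mexp (s *\<^sub>R E) *v x) \<le> K * exp (s / 2) * norm x"
    and pos: "C > 0" "K > 0" "a > 0" "\<rho> \<ge> 0" "N \<ge> 1" "T \<ge> 1"
    and y: "norm y \<le> \<rho> + N powr a" and s: "2 * ln T - ln N \<le> s"
  shows "\<bar>y \<bullet> (mexp (s *\<^sub>R E) *v x)\<bar> \<le> (\<rho> + 1) * C * K * norm x / T * (N * exp s)"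
proof -
  let ?u = "s + ln N"
  have u: "2 * ln T \<le> ?u" "0 \<le> ?u" using s pos ln_ge_zero[of T] by linarith+
  have X: "mexp (s *\<^sub>R E) *v x = mexp ((- ln N) *\<^sub>R E) *v (mexp (?u *\<^sub>R E) *v x)"
    by (simp only: mexp_add_mv) simp
  have "norm (mexp (s *\<^sub>R E) *v x) \<le> C * exp (a * (- ln N)) * norm (mexp (?u *\<^sub>R E) *v x)"
    unfolding X by (rule decay) (use pos in simp)
  also have "\<dots> \<le> C * exp (a * (- ln N)) * (K * exp (?u / 2) * norm x)"
    using pos u by (intro mult_left_mono growth) auto
  also have "exp (a * (- ln N)) = N powr (- a)" using pos by (simp add: powr_def)
  finally have n: "norm (mexp (s *\<^sub>R E) *v x) \<le> C * N powr (- a) * (K * exp (?u / 2) * norm x)" .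
  have eu: "exp (?u / 2) \<le> N * exp s / T"
  proof -
    have "T = exp (2 * ln T / 2)" using pos by simp
    also have "\<dots> \<le> exp (?u / 2)" unfolding exp_le_cancel_iff using u by simp
    finally have "T * exp (?u / 2) \<le> exp (?u / 2) * exp (?u / 2)" by simp
    also have "\<dots> = N * exp s" using pos by (simp add: exp_add[symmetric]) (simp add: exp_add)
    finally show ?thesis using pos by (simp add: field_simps)
  qed
  have yN: "norm y * N powr (- a) \<le> \<rho> + 1"
  proof -
    have "norm y * N powr (- a) \<le> (\<rho> + N powr a) * N powr (- a)" using y by (intro mult_right_mono) auto
    also have "\<dots> = \<rho> * N powr (- a) + 1" using pos by (simp add: distrib_right flip: powr_add)
    also have "\<rho> * N powr (- a) \<le> \<rho> * 1"
      using pos powr_mono[of "- a" 0 N] by (intro mult_left_mono) auto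
    finally show ?thesis by simp
  qed
  have "\<bar>y \<bullet> (mexp (s *\<^sub>R E) *v x)\<bar> \<le> norm y * (C * N powr (- a) * (K * exp (?u / 2) * norm x))"
    by (rule order_trans[OF Cauchy_Schwarz_ineq2]) (intro mult_left_mono n norm_ge_zero)
  also have "\<dots> = (norm y * N powr (- a)) * (C * K * norm x * exp (?u / 2))" by (simp add: mult_ac)
  also have "\<dots> \<le> (\<rho> + 1) * (C * K * norm x * (N * exp s / T))"
    using pos yN eu by (intro mult_mono mult_left_mono) auto
  finally show ?thesis by (simp add: mult_ac)
qed

text \<open>The rate a is produced before r and \<rho>, so the same growth N^a serves every
  neighbourhood and every compact set.\<close>

lemma imaginary_type_integral_bound:
  fixes Q R Qt Rt :: "real^'d::finite \<Rightarrow> real"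
  assumes gauge: "homogeneous_gauge (\<lambda>\<xi>. \<bar>Q \<xi>\<bar>) E" and polyQ: "poly_nolin Q" and polyR: "poly_nolin R"
    and Rpos: "\<And>\<xi>. \<xi> \<noteq> 0 \<Longrightarrow> 0 < R \<xi>" and k: "k > 0" and Rhom: "homogeneous_wrt R ((1 / k) *\<^sub>R E)"
    and Qt: "strongly_subhomogeneous Qt E 2" and Rt: "strongly_subhomogeneous Rt ((1 / k) *\<^sub>R E) 1"
    and mu1: "trace E < 1"
    and smooth: "open W" "0 \<in> W" "continuous_on W Qt" "continuous_on W Rt"
  obtains a where "a > 0" "\<And>r \<rho>. r > 0 \<Longrightarrow> \<rho> \<ge> 0 \<Longrightarrow> \<exists>\<delta>>0. \<exists>C>0. {\<xi>. \<bar>Q \<xi>\<bar> < \<delta>} \<subseteq> ball 0 r \<and>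
     (\<forall>N\<ge>1. \<forall>y. norm y \<le> \<rho> + N powr a \<longrightarrow>
       norm (\<integral>\<xi>. indicator {\<xi>. \<bar>Q \<xi>\<bar> < \<delta>} \<xi> *\<^sub>R (exp (- N * (R \<xi> + Rt \<xi>)) *\<^sub>R cis (y \<bullet> \<xi> - N * (Q \<xi> + Qt \<xi>))) \<partial>lborel)
         \<le> C * N powr (- trace E))"
proof -
  interpret G: homogeneous_gauge "\<lambda>\<xi>. \<bar>Q \<xi>\<bar>" E by (rule gauge)
  define \<mu> where "\<mu> = trace E"
  have mu: "\<mu> > 0" "\<mu> < 1" using G.trace_pos mu1 by (auto simp: \<mu>_def)
  have contQ: "continuous_on UNIV Q" and contR: "continuous_on UNIV R"
    by (rule poly_nolin_continuous polyQ polyR)+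
  have Qflow: "Q (mexp (s *\<^sub>R E) *v \<eta>) = exp s * Q \<eta>" for s \<eta>
    by (rule abs_homogeneous_imp_homogeneous[OF G.hom contQ])
  have Rflow: "R (mexp (s *\<^sub>R E) *v \<eta>) = exp (k * s) * R \<eta>" for s \<eta>
    using homogeneous_wrt_flow[OF Rhom, of "k * s" \<eta>] k by simp
  obtain C0 a where C0: "C0 > 0" "a > 0" "\<And>s x. s \<le> 0 \<Longrightarrow> norm (mexp (s *\<^sub>R E) *v x) \<le> C0 * exp (a * s) * norm x"
    by (rule contracting_decay[OF G.contr]) blast
  obtain Cq where Cq: "\<And>\<xi>. norm \<xi> \<le> 1 \<Longrightarrow> \<bar>Q \<xi>\<bar> \<le> Cq * (norm \<xi>)\<^sup>2"
    by (rule poly_nolin_quadratic[OF polyQ]) blast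
  obtain K where K: "K > 0" "\<And>s x. s \<ge> 0 \<Longrightarrow> norm (mexp (s *\<^sub>R E) *v x) \<le> K * exp (s / 2) * norm x"
    by (rule G.flow_growth[OF Cq]) auto
  define A where "A = {\<eta>. 1 \<le> \<bar>Q \<eta>\<bar> \<and> \<bar>Q \<eta>\<bar> \<le> exp 1}"
  have Abnd: "bounded A" by (rule bounded_subset[OF G.bounded_sublevel[of "exp 1"]]) (auto simp: A_def)
  have "closed A" unfolding A_def
    by (intro closed_Collect_conj closed_Collect_le continuous_intros contQ)
  hence Acpt: "compact A" using Abnd by (simp add: compact_eq_bounded_closed)
  have A0: "\<eta> \<noteq> 0" if "\<eta> \<in> A" for \<eta> using that G.zero_iff[of \<eta>] by (auto simp: A_def)
  have cb: "\<exists>B>0. \<forall>\<eta>\<in>A. norm (f \<eta>) \<le> B" if "continuous_on A f" for f :: "real^'d \<Rightarrow> 'b::real_normed_vector"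
    using compact_imp_bounded[OF compact_continuous_image[OF that Acpt]] unfolding bounded_pos by auto
  obtain V1 where V1: "V1 > 0" "\<forall>\<eta>\<in>A. norm (E *v \<eta>) \<le> V1"
    using cb[OF matrix_vector_mult_linear_continuous_on] by blast
  obtain V2 where V2: "V2 > 0" "\<forall>\<eta>\<in>A. norm ((E ** E) *v \<eta>) \<le> V2"
    using cb[OF matrix_vector_mult_linear_continuous_on] by blast
  obtain Rm where Rm: "Rm > 0" "\<forall>\<eta>\<in>A. norm (R \<eta>) \<le> Rm"
    using cb[OF continuous_on_subset[OF contR subset_UNIV]] by blast
  have "continuous_on A (\<lambda>\<eta>. inverse (R \<eta>))"
    using Rpos A0 by (intro continuous_intros continuous_on_subset[OF contR]) (auto simp: less_imp_neq[symmetric])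
  from cb[OF this] obtain Ri where Ri: "Ri > 0" "\<forall>\<eta>\<in>A. norm (inverse (R \<eta>)) \<le> Ri" by blast
  \<comment> \<open>Half of the minimum guaranteed for R on the shell: R \<ge> 2 c there, and the
    remainder \<open>Rt\<close> will use up at most one c.\<close>
  define c where "c = 1 / (2 * Ri)"
  have c: "c > 0" using Ri by (simp add: c_def)
  have Rge: "2 * c \<le> R \<eta>" if "\<eta> \<in> A" for \<eta>
    using Ri(2)[rule_format, OF that] Ri(1) Rpos[OF A0[OF that]] by (simp add: c_def field_simps)
  \<comment> \<open>The main phase has derivative at least N e^s in modulus. The remainder
    \<open>Qt\<close> may take a quarter of it and the linear phase another, which leaves the half
    that the oscillation lemma asks for.\<close>
  obtain \<tau>q Uq where q: "\<tau>q > 0" "open Uq" "0 \<in> Uq"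
    "\<And>\<eta>. \<eta> \<in> A \<Longrightarrow> \<exists>h1 h2. \<forall>s. exp s < \<tau>q \<and> mexp (s *\<^sub>R E) *v \<eta> \<in> Uq \<longrightarrow>
        ((\<lambda>s. Qt (mexp (s *\<^sub>R E) *v \<eta>)) has_real_derivative h1 s) (at s) \<and>
        (h1 has_real_derivative h2 s) (at s) \<and> \<bar>h1 s\<bar> \<le> 1/4 * exp s \<and> \<bar>h2 s\<bar> \<le> 2 * (1/4) * exp s"
    by (rule strongly_subhomogeneous_2_flow[OF Qt Acpt, of "1/4"]) (simp, blast)
  obtain \<tau>r Ur where rr: "\<tau>r > 0" "open Ur" "0 \<in> Ur"
    "\<And>\<eta>. \<eta> \<in> A \<Longrightarrow> \<exists>h1. \<forall>s. exp s < \<tau>r \<and> mexp (s *\<^sub>R ((1 / k) *\<^sub>R E)) *v \<eta> \<in> Ur \<longrightarrow>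
        ((\<lambda>s. Rt (mexp (s *\<^sub>R ((1 / k) *\<^sub>R E)) *v \<eta>)) has_real_derivative h1 s) (at s) \<and> \<bar>h1 s\<bar> \<le> c * exp s \<and>
        \<bar>Rt (mexp (s *\<^sub>R ((1 / k) *\<^sub>R E)) *v \<eta>)\<bar> \<le> c * exp s"
    by (rule strongly_subhomogeneous_1_flow[OF Rt Acpt c]) blast
  show ?thesis
  proof (rule that[OF C0(2)])
    fix r \<rho> :: real assume r: "r > 0" and \<rho>: "\<rho> \<ge> 0"
    have "open (ball 0 r \<inter> Uq \<inter> Ur \<inter> W)" "0 \<in> ball 0 r \<inter> Uq \<inter> Ur \<inter> W"
      using q rr smooth r by auto
    then obtain r' where r': "r' > 0" "ball 0 r' \<subseteq> ball 0 r \<inter> Uq \<inter> Ur \<inter> W" by (meson openE)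
    obtain \<delta>0 where \<delta>0: "\<delta>0 > 0" "\<And>\<xi>. \<bar>Q \<xi>\<bar> \<le> \<delta>0 \<Longrightarrow> norm \<xi> < r'"
      by (rule G.small_sublevel[OF r'(1)]) blast
    \<comment> \<open>The bounds on \<open>Rt\<close> refer to the flow of E / k, whose time is k s,
      so e^(ks) rather than e^s has to stay below \<tau>r; hence the power 1 / k.\<close>
    define \<delta> where "\<delta> = min \<delta>0 (min (\<tau>q / 2) ((\<tau>r / 2) powr (1 / k)))"
    have \<delta>: "\<delta> > 0" "\<delta> \<le> \<delta>0" "\<delta> < \<tau>q" "\<delta> \<le> (\<tau>r / 2) powr (1 / k)" using \<delta>0 q rr by (auto simp: \<delta>_def)
    let ?O = "{\<xi>. \<bar>Q \<xi>\<bar> < \<delta>}"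
    have sub: "\<xi> \<in> ball 0 r \<and> \<xi> \<in> Uq \<and> \<xi> \<in> Ur \<and> \<xi> \<in> W" if "\<bar>Q \<xi>\<bar> \<le> \<delta>" for \<xi>
    proof -
      have "\<xi> \<in> ball 0 r'" using \<delta>0(2)[of \<xi>] that \<delta>(2) by simp
      thus ?thesis using r'(2) by blast
    qed
    define M where "M = (\<rho> + 1) * C0 * K"
    have M: "M > 0" using C0 K \<rho> by (simp add: M_def)
    \<comment> \<open>4 M V1 brings the derivative of the linear phase down to a quarter of N e^s,
      and T \<ge> 1 is a condition of the pairing bound.\<close>
    define T where "T = max 1 (4 * M * V1)"
    have T: "T \<ge> 1" "4 * M * V1 \<le> T" by (auto simp: T_def)
    \<comment> \<open>In \<open>C1\<close> the summand \<mu> comes from the Jacobian, the other from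
      the damping. The summands of \<open>C2\<close> bound the second derivatives of the linear
      phase, of N Q, where |Q| \<le> e on the shell, and of N Qt.\<close>
    define C1 where "C1 = \<mu> + k * (Rm + c) / c"
    define C2 where "C2 = M * V2 + exp 1 + 1"
    have C12: "C1 \<ge> 0" "C2 \<ge> 0" using mu k Rm c M V2 by (auto simp: C1_def C2_def)
    define L where "L = 4 + (2 * C1 + 4 * C2) / (1 - \<mu>)"
    have L: "L > 0" using mu C12 by (auto simp: L_def intro!: add_pos_nonneg)
    define B where "B = exp (2 * \<mu> * ln T) / \<mu> + L * exp (2 * (\<mu> - 1) * ln T)"
    have Bpos: "B > 0" using mu L by (auto simp: B_def intro!: add_pos_pos)
    have Oopen: "open ?O" by (intro open_Collect_less continuous_intros contQ)
    have Ofin: "emeasure lborel ?O < \<infinity>"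
      by (rule emeasure_bounded_finite[OF bounded_subset[OF G.bounded_sublevel[of \<delta>]]]) auto
    have main: "norm (\<integral>\<xi>. indicator ?O \<xi> *\<^sub>R (exp (- N * (R \<xi> + Rt \<xi>)) *\<^sub>R cis (y \<bullet> \<xi> - N * (Q \<xi> + Qt \<xi>))) \<partial>lborel)
         \<le> (B * N powr (- \<mu>)) * measure lborel A" if N: "N \<ge> 1" and y: "norm y \<le> \<rho> + N powr a" for N y
    proof -
      define f where "f = (\<lambda>\<xi>. indicator ?O \<xi> *\<^sub>R (exp (- N * (R \<xi> + Rt \<xi>)) *\<^sub>R cis (y \<bullet> \<xi> - N * (Q \<xi> + Qt \<xi>))))"
      have Wsub: "?O \<subseteq> W" using sub by (auto dest: less_imp_le)
      have f_cont: "continuous_on ?O (\<lambda>\<xi>. exp (- N * (R \<xi> + Rt \<xi>)) *\<^sub>R cis (y \<bullet> \<xi> - N * (Q \<xi> + Qt \<xi>)))"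
        by (intro continuous_intros continuous_on_subset[OF contQ] continuous_on_subset[OF contR]
            continuous_on_subset[OF smooth(3) Wsub] continuous_on_subset[OF smooth(4) Wsub]) auto
      have f_meas: "f \<in> borel_measurable borel"
        unfolding f_def using borel_measurable_continuous_on_indicator[OF _ f_cont] Oopen by auto
      define s0 where "s0 = 2 * ln T - ln N"
      have E0: "exp (\<mu> * s0) = exp (2 * \<mu> * ln T) * N powr (- \<mu>)"
        using N by (simp add: s0_def powr_def exp_add[symmetric] algebra_simps)
      have E1: "exp ((\<mu> - 1) * s0) / N = exp (2 * (\<mu> - 1) * ln T) * N powr (- \<mu>)"
      proof -
        have "exp ((\<mu> - 1) * s0) = exp (2 * (\<mu> - 1) * ln T) * exp (- \<mu> * ln N) * exp (ln N)"
          unfolding exp_add[symmetric] by (simp add: s0_def algebra_simps)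
        thus ?thesis using N by (simp add: powr_def)
      qed
      \<comment> \<open>The pointwise bound in the second conjunct comes from the same formula for f
        along the orbit, the amplitude being at most the Jacobian; it is what makes f
        integrable.\<close>
      have local: "norm (\<integral>s. exp (s * trace E) *\<^sub>R f (mexp (s *\<^sub>R E) *v \<eta>) \<partial>lborel) \<le> B * N powr (- \<mu>)
          \<and> (\<forall>s. norm (f (mexp (s *\<^sub>R E) *v \<eta>)) \<le> 1)"
        if \<eta>: "\<eta> \<in> A" for \<eta>
      proof -
        let ?X = "\<lambda>s. mexp (s *\<^sub>R E) *v \<eta>"
        have q1: "1 \<le> \<bar>Q \<eta>\<bar>" "\<bar>Q \<eta>\<bar> \<le> exp 1" using \<eta> by (auto simp: A_def)
        define s1 where "s1 = ln (\<delta> / \<bar>Q \<eta>\<bar>)"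
        have e1: "exp s1 = \<delta> / \<bar>Q \<eta>\<bar>" using q1 \<delta>(1) by (simp add: s1_def)
        have lt_iff: "\<bar>Q (?X s)\<bar> < \<delta> \<longleftrightarrow> s < s1" for s
        proof -
          have "\<bar>Q (?X s)\<bar> < \<delta> \<longleftrightarrow> exp s < exp s1"
            unfolding e1 Qflow abs_mult using q1 by (simp add: field_simps)
          thus ?thesis by simp
        qed
        have le: "\<bar>Q (?X s)\<bar> \<le> \<delta>" "exp s \<le> \<delta>" if "s \<le> s1" for s
        proof -
          have "exp s \<le> exp s1" using that by simp
          thus "\<bar>Q (?X s)\<bar> \<le> \<delta>" unfolding e1 Qflow abs_mult using q1 by (simp add: field_simps)
          have "\<delta> / \<bar>Q \<eta>\<bar> \<le> \<delta>" using q1 \<delta>(1) by (simp add: field_simps)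
          thus "exp s \<le> \<delta>" using \<open>exp s \<le> exp s1\<close> e1 by linarith
        qed
        have kle: "exp (k * s) < \<tau>r" if "s \<le> s1" for s
        proof -
          have "exp (k * s) = exp s powr k" by (simp add: exp_powr_real mult.commute)
          also have "\<dots> \<le> ((\<tau>r / 2) powr (1 / k)) powr k"
            using le(2)[OF that] \<delta> k by (intro powr_mono2) auto
          also have "\<dots> = \<tau>r / 2" using k rr(1) by (simp add: powr_powr)
          finally show ?thesis using rr(1) by simp
        qed
        obtain h1 h2 where h: "\<And>s. exp s < \<tau>q \<Longrightarrow> ?X s \<in> Uq \<Longrightarrow>
          ((\<lambda>s. Qt (?X s)) has_real_derivative h1 s) (at s) \<and>
          (h1 has_real_derivative h2 s) (at s) \<and> \<bar>h1 s\<bar> \<le> 1/4 * exp s \<and> \<bar>h2 s\<bar> \<le> 2 * (1/4) * exp s"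
          using q(4)[OF \<eta>] by blast
        have hq: "((\<lambda>s. Qt (?X s)) has_real_derivative h1 s) (at s)" "(h1 has_real_derivative h2 s) (at s)"
            "\<bar>h1 s\<bar> \<le> 1/4 * exp s" "\<bar>h2 s\<bar> \<le> 1/2 * exp s" if "s \<le> s1" for s
        proof -
          have "exp s < \<tau>q" using le(2)[OF that] \<delta>(3) by linarith
          moreover have "?X s \<in> Uq" using sub[OF le(1)[OF that]] by blast
          ultimately show "((\<lambda>s. Qt (?X s)) has_real_derivative h1 s) (at s)" "(h1 has_real_derivative h2 s) (at s)"
            "\<bar>h1 s\<bar> \<le> 1/4 * exp s" "\<bar>h2 s\<bar> \<le> 1/2 * exp s" using h[of s] by auto
        qed
        obtain g1 where g1: "\<And>s. exp s < \<tau>r \<Longrightarrow> mexp (s *\<^sub>R ((1 / k) *\<^sub>R E)) *v \<eta> \<in> Ur \<Longrightarrow>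
          ((\<lambda>s. Rt (mexp (s *\<^sub>R ((1 / k) *\<^sub>R E)) *v \<eta>)) has_real_derivative g1 s) (at s) \<and> \<bar>g1 s\<bar> \<le> c * exp s \<and>
          \<bar>Rt (mexp (s *\<^sub>R ((1 / k) *\<^sub>R E)) *v \<eta>)\<bar> \<le> c * exp s"
          using rr(4)[OF \<eta>] by blast
        have kX: "mexp ((k * s) *\<^sub>R ((1 / k) *\<^sub>R E)) *v \<eta> = ?X s" for s using k by simp
        have hr: "((\<lambda>s. Rt (?X s)) has_real_derivative g1 (k * s) * k) (at s)"
            "\<bar>g1 (k * s)\<bar> \<le> c * exp (k * s)" "\<bar>Rt (?X s)\<bar> \<le> c * exp (k * s)" if "s \<le> s1" for s
        proof -
          have "?X s \<in> Ur" using sub[OF le(1)[OF that]] by blast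
          hence *: "((\<lambda>s. Rt (mexp (s *\<^sub>R ((1 / k) *\<^sub>R E)) *v \<eta>)) has_real_derivative g1 (k * s)) (at (k * s))"
            "\<bar>g1 (k * s)\<bar> \<le> c * exp (k * s)" "\<bar>Rt (?X s)\<bar> \<le> c * exp (k * s)"
            using g1[of "k * s", unfolded kX] kle[OF that] by auto
          have "((*) k has_real_derivative k) (at s)" by (auto intro!: derivative_eq_intros)
          from DERIV_chain2[OF *(1) this]
          show "((\<lambda>s. Rt (?X s)) has_real_derivative g1 (k * s) * k) (at s)" unfolding kX .
          show "\<bar>g1 (k * s)\<bar> \<le> c * exp (k * s)" "\<bar>Rt (?X s)\<bar> \<le> c * exp (k * s)" using * by auto
        qed
        define p where "p = (\<lambda>s. y \<bullet> ?X s - N * (exp s * Q \<eta> + Qt (?X s)))"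
        define p' where "p' = (\<lambda>s. y \<bullet> (mexp (s *\<^sub>R E) *v (E *v \<eta>)) - N * (exp s * Q \<eta> + h1 s))"
        define p'' where "p'' = (\<lambda>s. y \<bullet> (mexp (s *\<^sub>R E) *v (E *v (E *v \<eta>))) - N * (exp s * Q \<eta> + h2 s))"
        define e where "e = (\<lambda>s. exp (k * s) * R \<eta> + Rt (?X s))"
        define e' where "e' = (\<lambda>s. k * exp (k * s) * R \<eta> + g1 (k * s) * k)"
        define a1 where "a1 = (\<lambda>s. exp (\<mu> * s - N * e s))"
        define a1' where "a1' = (\<lambda>s. (\<mu> - N * e' s) * a1 s)"
        have inner_d: "((\<lambda>s. y \<bullet> (mexp (s *\<^sub>R E) *v x)) has_real_derivative y \<bullet> (mexp (s *\<^sub>R E) *v (E *v x))) (at s)" for x s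
          using bounded_linear.has_vector_derivative[OF bounded_linear_inner_right mexp_mv_has_vector_derivative]
          by (simp add: has_real_derivative_iff_has_vector_derivative)
        have dp: "(p has_real_derivative p' s) (at s)" if "s \<le> s1" for s
          unfolding p_def p'_def using hq(1)[OF that] by (auto intro!: derivative_eq_intros inner_d)
        have dp': "(p' has_real_derivative p'' s) (at s)" if "s \<le> s1" for s
          unfolding p'_def p''_def using hq(2)[OF that] by (auto intro!: derivative_eq_intros inner_d)
        have de: "(e has_real_derivative e' s) (at s)" if "s \<le> s1" for s
          unfolding e_def e'_def using hr(1)[OF that] by (auto intro!: derivative_eq_intros)
        have da: "(a1 has_real_derivative a1' s) (at s)" if "s \<le> s1" for s
          unfolding a1_def a1'_def using de[OF that] by (auto intro!: derivative_eq_intros)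
        have e_ge: "c * exp (k * s) \<le> e s" if "s \<le> s1" for s
        proof -
          have "2 * (c * exp (k * s)) = exp (k * s) * (2 * c)" by simp
          also have "\<dots> \<le> exp (k * s) * R \<eta>" using Rge[OF \<eta>] by (intro mult_left_mono) auto
          finally show ?thesis using hr(3)[OF that] unfolding e_def by linarith
        qed
        have e'_le: "\<bar>e' s\<bar> \<le> k * (Rm + c) * exp (k * s)" if "s \<le> s1" for s
        proof -
          have "\<bar>e' s\<bar> \<le> k * exp (k * s) * \<bar>R \<eta>\<bar> + \<bar>g1 (k * s)\<bar> * k"
            unfolding e'_def using k by (intro order_trans[OF abs_triangle_ineq]) (simp add: abs_mult)
          also have "\<dots> \<le> k * exp (k * s) * Rm + (c * exp (k * s)) * k"
            using k hr(2)[OF that] Rm(2)[rule_format, OF \<eta>] by (intro add_mono mult_left_mono mult_right_mono) auto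
          finally show ?thesis by (simp add: algebra_simps)
        qed
        have a1_le: "\<bar>a1 s\<bar> \<le> exp (\<mu> * s)" if "s \<le> s1" for s
        proof -
          have "0 \<le> N * e s" using e_ge[OF that] N c by (intro mult_nonneg_nonneg) (auto intro: order_trans[rotated])
          thus ?thesis by (simp add: a1_def)
        qed
        have a1'_le: "\<bar>a1' s\<bar> \<le> C1 * exp (\<mu> * s)" if s: "s \<le> s1" for s
        proof -
          \<comment> \<open>Differentiating the damping costs a factor of size N e^(ks), which is
            not bounded in N. The damping itself pays for it, since x e^(-cx) \<le> 1/c.\<close>
          let ?x = "N * exp (k * s)"
          have "a1 s \<le> exp (\<mu> * s) * exp (- (c * ?x))"
            using mult_left_mono[OF e_ge[OF s], of N] N unfolding a1_def exp_add[symmetric] by (simp add: mult_ac)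
          hence "N * \<bar>e' s\<bar> * a1 s \<le> N * (k * (Rm + c) * exp (k * s)) * (exp (\<mu> * s) * exp (- (c * ?x)))"
            using N e'_le[OF s] by (intro mult_mono mult_left_mono) (auto simp: a1_def)
          also have "\<dots> = k * (Rm + c) * exp (\<mu> * s) * (?x * exp (- (c * ?x)))" by (simp add: mult_ac)
          also have "\<dots> \<le> k * (Rm + c) * exp (\<mu> * s) * (1 / c)"
            using k Rm c by (intro mult_left_mono mult_exp_neg_le) auto
          finally have 1: "N * \<bar>e' s\<bar> * a1 s \<le> k * (Rm + c) / c * exp (\<mu> * s)" by simp
          have "\<bar>a1' s\<bar> \<le> (\<mu> + N * \<bar>e' s\<bar>) * a1 s"
          proof -
            have "\<bar>\<mu> - N * e' s\<bar> \<le> \<mu> + N * \<bar>e' s\<bar>"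
              using mu N abs_triangle_ineq4[of \<mu> "N * e' s"] by (simp add: abs_mult)
            thus ?thesis unfolding a1'_def abs_mult by (intro mult_mono) (auto simp: a1_def)
          qed
          also have "\<dots> = \<mu> * a1 s + N * \<bar>e' s\<bar> * a1 s" by (simp add: algebra_simps)
          also have "\<dots> \<le> \<mu> * exp (\<mu> * s) + k * (Rm + c) / c * exp (\<mu> * s)"
            using 1 a1_le[OF s] mu by (intro add_mono mult_left_mono) auto
          finally show ?thesis by (simp add: C1_def algebra_simps)
        qed
        have pair: "\<bar>y \<bullet> (mexp (s *\<^sub>R E) *v x)\<bar> \<le> M * norm x / T * (N * exp s)" if "s0 \<le> s" for s x
          unfolding M_def by (rule flow_pairing_bound[OF C0(3) K(2) C0(1) K(1) C0(2) \<rho> N T(1) y]) (use that in \<open>auto simp: s0_def\<close>)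
        have p'_ge: "N * exp s / 2 \<le> \<bar>p' s\<bar>" if s: "s0 \<le> s" "s \<le> s1" for s
        proof -
          have "M * norm (E *v \<eta>) / T \<le> 1 / 4"
          proof -
            have "M * norm (E *v \<eta>) \<le> M * V1" using M V1(2) \<eta> by (intro mult_left_mono) auto
            thus ?thesis using T by (simp add: field_simps)
          qed
          hence "M * norm (E *v \<eta>) / T * (N * exp s) \<le> 1 / 4 * (N * exp s)"
            using N by (intro mult_right_mono) auto
          hence 1: "\<bar>y \<bullet> (mexp (s *\<^sub>R E) *v (E *v \<eta>))\<bar> \<le> 1 / 4 * (N * exp s)"
            using pair[OF s(1), of "E *v \<eta>"] by linarith
          have 2: "\<bar>N * h1 s\<bar> \<le> 1 / 4 * (N * exp s)"
            using mult_left_mono[OF hq(3)[OF s(2)], of N] N by (simp add: abs_mult)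
          have 3: "N * exp s \<le> \<bar>N * (exp s * Q \<eta>)\<bar>"
            using q1(1) N by (simp add: abs_mult)
          show ?thesis using 1 2 3 unfolding p'_def distrib_left by linarith
        qed
        have p''_le: "\<bar>p'' s\<bar> \<le> C2 * N * exp s" if s: "s0 \<le> s" "s \<le> s1" for s
        proof -
          have "M * norm (E *v (E *v \<eta>)) / T \<le> M * V2"
          proof -
            have "M * norm (E *v (E *v \<eta>)) / T \<le> M * norm (E *v (E *v \<eta>)) / 1"
              using T M by (intro divide_left_mono) auto
            also have "\<dots> \<le> M * V2" using M V2(2) \<eta> by (simp add: matrix_vector_mul_assoc)
            finally show ?thesis .
          qed
          hence "M * norm (E *v (E *v \<eta>)) / T * (N * exp s) \<le> M * V2 * (N * exp s)"
            using N by (intro mult_right_mono) auto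
          hence 1: "\<bar>y \<bullet> (mexp (s *\<^sub>R E) *v (E *v (E *v \<eta>)))\<bar> \<le> M * V2 * (N * exp s)"
            using pair[OF s(1), of "E *v (E *v \<eta>)"] by linarith
          have 2: "\<bar>N * h2 s\<bar> \<le> 1 * (N * exp s)"
            using mult_left_mono[OF hq(4)[OF s(2)], of N] N by (simp add: abs_mult)
          have 3: "\<bar>N * (exp s * Q \<eta>)\<bar> \<le> exp 1 * (N * exp s)"
            using mult_left_mono[OF q1(2), of "N * exp s"] N by (simp add: abs_mult mult_ac)
          have "C2 * N * exp s = M * V2 * (N * exp s) + exp 1 * (N * exp s) + 1 * (N * exp s)"
            by (simp add: C2_def algebra_simps)
          thus ?thesis using 1 2 3 unfolding p''_def distrib_left by linarith
        qed
        have fX: "exp (s * trace E) *\<^sub>R f (?X s) = indicator {..<s1} s *\<^sub>R (a1 s *\<^sub>R cis (p s))" for s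
        proof (cases "s < s1")
          case True
          hence i: "indicator ?O (?X s) = (1::real)" using lt_iff[of s] by simp
          have "exp (s * trace E) * exp (- N * (exp (k * s) * R \<eta> + Rt (?X s))) = a1 s"
            unfolding a1_def e_def \<mu>_def exp_add[symmetric] by (simp add: mult.commute)
          thus ?thesis using True by (simp add: f_def i p_def Qflow Rflow)
        next
          case False
          hence i: "indicator ?O (?X s) = (0::real)" using lt_iff[of s] by simp
          show ?thesis using False by (simp add: f_def i)
        qed
        have "norm (\<integral>s. indicator {..<s1} s *\<^sub>R (a1 s *\<^sub>R cis (p s)) \<partial>lborel) \<le> exp (\<mu> * s0) / \<mu> + L * exp ((\<mu> - 1) * s0) / N"
        proof (rule half_line_integral_bound[OF mu(1)])
          show "norm (a1 s *\<^sub>R cis (p s)) \<le> exp (\<mu> * s)" if "s \<le> s1" for s using a1_le[OF that] by simp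
          have "continuous_on {..s1} a1" "continuous_on {..s1} p"
            by (rule DERIV_continuous_on[OF has_field_derivative_at_within[OF da]] DERIV_continuous_on[OF has_field_derivative_at_within[OF dp]], simp)+
          thus "continuous_on {..s1} (\<lambda>s. a1 s *\<^sub>R cis (p s))" by (intro continuous_intros)
          show "norm (integral {s0..s1} (\<lambda>s. a1 s *\<^sub>R cis (p s))) \<le> L * exp ((\<mu> - 1) * s0) / N" if "s0 \<le> s1"
            unfolding L_def
            by (rule oscillatory_integral_bound[OF that mu(2), where p'=p' and p''=p'' and a'=a1'])
               (use N C12 a1_le a1'_le p'_ge p''_le in \<open>auto intro!: has_field_derivative_at_within[OF dp]
                  has_field_derivative_at_within[OF dp'] has_field_derivative_at_within[OF da]\<close>)
          show "0 \<le> L * exp ((\<mu> - 1) * s0) / N" using L N by simp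
        qed
        also have "\<dots> = B * N powr (- \<mu>)"
          unfolding E0 times_divide_eq_right[symmetric] E1 by (simp add: B_def algebra_simps)
        finally have 1: "norm (\<integral>s. exp (s * trace E) *\<^sub>R f (?X s) \<partial>lborel) \<le> B * N powr (- \<mu>)" unfolding fX .
        have "norm (f (?X s)) \<le> 1" for s
        proof -
          have "exp (s * trace E) * norm (f (?X s)) \<le> exp (s * trace E)"
            using arg_cong[OF fX[of s], of norm] a1_le[of s] by (auto simp: \<mu>_def mult.commute split: split_indicator_asm)
          thus ?thesis by simp
        qed
        with 1 show ?thesis by blast
      qed
      have f_le: "norm (f \<xi>) \<le> 1 \<or> \<xi> = 0" for \<xi>
      proof (cases "\<xi> = 0")
        case False
        obtain \<eta> where \<eta>: "\<bar>Q \<eta>\<bar> = 1" "\<xi> = mexp (ln \<bar>Q \<xi>\<bar> *\<^sub>R E) *v \<eta>"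
          by (rule G.unit_representative[OF False]) blast
        have "\<eta> \<in> A" using \<eta>(1) by (simp add: A_def)
        thus ?thesis using local[of \<eta>] \<eta>(2) by metis
      qed simp
      have f_int: "integrable lborel f"
      proof -
        \<comment> \<open>Orbits of the shell miss the origin, so the value there enters the bound
          separately.\<close>
        have "norm (f \<xi>) \<le> max 1 (norm (f 0))" for \<xi> using f_le[of \<xi>] by auto
        moreover have "f = (\<lambda>\<xi>. indicator ?O \<xi> *\<^sub>R f \<xi>)" by (auto simp: f_def split: split_indicator)
        ultimately show ?thesis
          using integrable_indicator_bounded[OF _ Ofin f_meas, of "max 1 (norm (f 0))"] Oopen by auto
      qed
      have "norm (integral\<^sup>L lborel f) \<le> (B * N powr (- \<mu>)) * measure lborel A"
        unfolding A_def
        by (rule polar_integral_bound[OF G.cont G.nonneg G.zero_iff G.flow f_int])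
           (use Abnd local in \<open>auto simp: A_def\<close>)
      thus ?thesis by (simp add: f_def)
    qed
    show "\<exists>\<delta>>0. \<exists>C>0. {\<xi>. \<bar>Q \<xi>\<bar> < \<delta>} \<subseteq> ball 0 r \<and>
     (\<forall>N\<ge>1. \<forall>y. norm y \<le> \<rho> + N powr a \<longrightarrow>
       norm (\<integral>\<xi>. indicator {\<xi>. \<bar>Q \<xi>\<bar> < \<delta>} \<xi> *\<^sub>R (exp (- N * (R \<xi> + Rt \<xi>)) *\<^sub>R cis (y \<bullet> \<xi> - N * (Q \<xi> + Qt \<xi>))) \<partial>lborel)
         \<le> C * N powr (- trace E))"
    proof (rule exI[of _ \<delta>], rule conjI, rule \<delta>(1), rule exI[of _ "B * measure lborel A + 1"], intro conjI allI impI)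
      show "?O \<subseteq> ball 0 r" using sub by (auto dest: less_imp_le)
      show "0 < B * measure lborel A + 1" using Bpos by (intro add_nonneg_pos mult_nonneg_nonneg) auto
      fix N :: real and y :: "real^'d" assume "1 \<le> N" "norm y \<le> \<rho> + N powr a"
      from main[OF this] show "norm (\<integral>\<xi>. indicator ?O \<xi> *\<^sub>R (exp (- N * (R \<xi> + Rt \<xi>)) *\<^sub>R cis (y \<bullet> \<xi> - N * (Q \<xi> + Qt \<xi>))) \<partial>lborel)
         \<le> (B * measure lborel A + 1) * N powr (- trace E)"
        by (rule order_trans) (simp add: \<mu>_def algebra_simps)
    qed
  qed
qed


section \<open>Local behaviour of the Fourier transform\<close>

lemma homogeneous_gaugeI:
  assumes "positive_homogeneous P" "homogeneous_wrt P E" "contracting E"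
  shows "homogeneous_gauge P E"
  using assms unfolding positive_homogeneous_def homogeneous_gauge_def by simp

lemma Gamma_rep_fhat:
  assumes sum: "(\<lambda>x. norm (\<phi> x)) summable_on UNIV" and one: "norm (fhat \<phi> \<xi>0) = 1"
    and rep: "Gamma_rep \<phi> \<xi>0 \<alpha> Q R Qt Rt"
  obtains r where "r > 0" "\<And>\<xi>. norm \<xi> < r \<Longrightarrow>
    fhat \<phi> (\<xi>0 + \<xi>) = fhat \<phi> \<xi>0 * (exp (- (R \<xi> + Rt \<xi>)) *\<^sub>R cis (\<alpha> \<bullet> \<xi> - (Q \<xi> + Qt \<xi>)))"
proof -
  obtain r1 where r1: "r1 > 0" "\<And>\<xi>. \<xi> \<in> ball 0 r1 \<Longrightarrow> Ln (fhat \<phi> (\<xi> + \<xi>0) / fhat \<phi> \<xi>0) =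
      \<i> * complex_of_real (\<alpha> \<bullet> \<xi>) - \<i> * complex_of_real (Q \<xi> + Qt \<xi>) - complex_of_real (R \<xi> + Rt \<xi>)"
    using rep unfolding Gamma_rep_def by blast
  \<comment> \<open>exp (Ln z) = z fails at z = 0, so the ball is shrunk until the transform has no
    zero in it.\<close>
  have "open {\<xi>. fhat \<phi> \<xi> \<noteq> 0}"
    by (intro open_Collect_neq continuous_on_fhat sum continuous_on_const)
  moreover have nz: "fhat \<phi> \<xi>0 \<noteq> 0" using one by auto
  ultimately obtain r2 where r2: "r2 > 0" "ball \<xi>0 r2 \<subseteq> {\<xi>. fhat \<phi> \<xi> \<noteq> 0}"
    unfolding open_contains_ball by blast
  show ?thesis
  proof (rule that[of "min r1 r2"])
    show "min r1 r2 > 0" using r1 r2 by simp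
    fix \<xi> :: "real^'a" assume \<xi>: "norm \<xi> < min r1 r2"
    have "\<xi>0 + \<xi> \<in> ball \<xi>0 r2" using \<xi> by (simp add: dist_norm)
    hence "fhat \<phi> (\<xi> + \<xi>0) \<noteq> 0" using r2(2) by (auto simp: add.commute)
    hence "fhat \<phi> (\<xi> + \<xi>0) / fhat \<phi> \<xi>0 = exp (Ln (fhat \<phi> (\<xi> + \<xi>0) / fhat \<phi> \<xi>0))" using nz by simp
    also have "\<dots> = exp (complex_of_real (- (R \<xi> + Rt \<xi>))) * exp (\<i> * complex_of_real (\<alpha> \<bullet> \<xi> - (Q \<xi> + Qt \<xi>)))"
      using \<xi> by (subst r1(2)) (auto simp: algebra_simps simp flip: exp_add)
    also have "\<dots> = exp (- (R \<xi> + Rt \<xi>)) *\<^sub>R cis (\<alpha> \<bullet> \<xi> - (Q \<xi> + Qt \<xi>))"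
      by (simp only: exp_of_real cis_conv_exp scaleR_conv_of_real)
    finally have "fhat \<phi> (\<xi> + \<xi>0) / fhat \<phi> \<xi>0 = exp (- (R \<xi> + Rt \<xi>)) *\<^sub>R cis (\<alpha> \<bullet> \<xi> - (Q \<xi> + Qt \<xi>))" .
    thus "fhat \<phi> (\<xi>0 + \<xi>) = fhat \<phi> \<xi>0 * (exp (- (R \<xi> + Rt \<xi>)) *\<^sub>R cis (\<alpha> \<bullet> \<xi> - (Q \<xi> + Qt \<xi>)))"
      using nz by (simp add: divide_eq_eq add.commute mult.commute)
  qed
qed

text \<open>The gauge \<open>P\<close> is \<open>R\<close> at a point of positive type and \<open>|Q|\<close> at a point of imaginary type.\<close>

definition local_form :: "(int^'d::finite \<Rightarrow> complex) \<Rightarrow> real^'d \<Rightarrow> real^'d \<Rightarrow> real \<Rightarrow> bool" where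
  "local_form \<phi> \<xi>0 \<alpha> \<mu> \<longleftrightarrow> (\<exists>P E u v r c. homogeneous_gauge P E \<and> \<mu> = trace E \<and> 0 < r \<and> r \<le> 1 \<and> 0 < c \<and>
     (\<forall>\<xi>. norm \<xi> \<le> 1 \<longrightarrow> P \<xi> \<le> c * (norm \<xi>)\<^sup>2) \<and>
     (\<forall>\<xi>. norm \<xi> < r \<longrightarrow> fhat \<phi> (\<xi>0 + \<xi>) = fhat \<phi> \<xi>0 * (exp (- v \<xi>) *\<^sub>R cis (\<alpha> \<bullet> \<xi> - u \<xi>))) \<and>
     (\<forall>\<xi>. norm \<xi> < r \<longrightarrow> \<bar>u \<xi>\<bar> \<le> c * P \<xi> \<and> 0 \<le> v \<xi> \<and> (\<xi> \<noteq> 0 \<longrightarrow> 0 < v \<xi>) \<and> v \<xi> \<le> c * P \<xi>))"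

lemma local_formI:
  assumes gauge: "homogeneous_gauge P E" and "\<mu> = trace E" "0 < \<delta>" "0 < c"
    and quad: "\<And>\<xi>. norm \<xi> \<le> 1 \<Longrightarrow> P \<xi> \<le> c * (norm \<xi>)\<^sup>2"
    and form: "\<And>\<xi>. P \<xi> < \<delta> \<Longrightarrow> fhat \<phi> (\<xi>0 + \<xi>) = fhat \<phi> \<xi>0 * (exp (- v \<xi>) *\<^sub>R cis (\<alpha> \<bullet> \<xi> - u \<xi>))"
    and bounds: "\<And>\<xi>. P \<xi> < \<delta> \<Longrightarrow> \<bar>u \<xi>\<bar> \<le> c * P \<xi> \<and> 0 \<le> v \<xi> \<and> (\<xi> \<noteq> 0 \<longrightarrow> 0 < v \<xi>) \<and> v \<xi> \<le> c * P \<xi>"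
  shows "local_form \<phi> \<xi>0 \<alpha> \<mu>"
proof -
  interpret homogeneous_gauge P E by (rule gauge)
  have "open {\<xi>. P \<xi> < \<delta>}" using cont by (intro open_Collect_less continuous_intros) auto
  moreover have "0 \<in> {\<xi>. P \<xi> < \<delta>}" using zero_iff[of 0] \<open>0 < \<delta>\<close> by simp
  ultimately obtain r where r: "r > 0" "ball 0 r \<subseteq> {\<xi>. P \<xi> < \<delta>}" unfolding open_contains_ball by blast
  have P: "P \<xi> < \<delta>" if "norm \<xi> < min r 1" for \<xi> using that r(2) by (auto simp: subset_iff)
  have 1: "\<forall>\<xi>. norm \<xi> \<le> 1 \<longrightarrow> P \<xi> \<le> c * (norm \<xi>)\<^sup>2" using quad by blast
  have 2: "\<forall>\<xi>. norm \<xi> < min r 1 \<longrightarrow> fhat \<phi> (\<xi>0 + \<xi>) = fhat \<phi> \<xi>0 * (exp (- v \<xi>) *\<^sub>R cis (\<alpha> \<bullet> \<xi> - u \<xi>))"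
    using form[OF P] by blast
  have 3: "\<forall>\<xi>. norm \<xi> < min r 1 \<longrightarrow> \<bar>u \<xi>\<bar> \<le> c * P \<xi> \<and> 0 \<le> v \<xi> \<and> (\<xi> \<noteq> 0 \<longrightarrow> 0 < v \<xi>) \<and> v \<xi> \<le> c * P \<xi>"
    using bounds[OF P] by blast
  have 4: "0 < min r 1" "min r 1 \<le> 1" using r(1) by auto
  show ?thesis
    unfolding local_form_def
    by (rule exI[of _ P], rule exI[of _ E], rule exI[of _ u], rule exI[of _ v], rule exI[of _ "min r 1"], rule exI[of _ c])
       (intro conjI gauge assms(2,4) 1 2 3 4)
qed

text \<open>Used with k = 1 for Q against R at positive type, and with k > 1 for R against |Q| at
  imaginary type, where P^k \<le> P as long as P \<le> 1.\<close>

lemma (in homogeneous_gauge) homogeneous_abs_le: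
  assumes "continuous_on UNIV Q" "homogeneous_wrt Q ((1 / k) *\<^sub>R E)" "k \<ge> 1" "Q 0 = 0"
  obtains c where "c > 0" "\<And>\<xi>. P \<xi> \<le> 1 \<Longrightarrow> \<bar>Q \<xi>\<bar> \<le> c * P \<xi>"
proof -
  have "bounded (Q ` {\<xi>. P \<xi> = 1})"
    by (intro compact_imp_bounded compact_continuous_image continuous_on_subset[OF assms(1)] compact_unit) auto
  then obtain c where c: "c > 0" "\<And>\<xi>. P \<xi> = 1 \<Longrightarrow> \<bar>Q \<xi>\<bar> \<le> c"
    unfolding bounded_pos by auto
  show ?thesis
  proof (rule that[OF c(1)])
    fix \<xi> assume P1: "P \<xi> \<le> 1"
    show "\<bar>Q \<xi>\<bar> \<le> c * P \<xi>"
    proof (cases "\<xi> = 0")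
      case False
      obtain \<eta> where \<eta>: "P \<eta> = 1" "\<xi> = mexp (ln (P \<xi>) *\<^sub>R E) *v \<eta>"
        by (rule unit_representative[OF False]) blast
      have p: "0 < P \<xi>" by (rule pos[OF False])
      have "\<xi> = mexp ((k * ln (P \<xi>)) *\<^sub>R ((1 / k) *\<^sub>R E)) *v \<eta>"
        using \<eta>(2) assms(3) by simp
      hence "Q \<xi> = exp (k * ln (P \<xi>)) * Q \<eta>"
        by (metis homogeneous_wrt_flow[OF assms(2)])
      hence "\<bar>Q \<xi>\<bar> = exp (k * ln (P \<xi>)) * \<bar>Q \<eta>\<bar>" by (simp add: abs_mult)
      also have "\<dots> \<le> exp (1 * ln (P \<xi>)) * c"
      proof (intro mult_mono)
        show "exp (k * ln (P \<xi>)) \<le> exp (1 * ln (P \<xi>))"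
          unfolding exp_le_cancel_iff using p P1 assms(3) by (intro mult_right_mono_neg) auto
      qed (use c(2)[OF \<eta>(1)] in auto)
      finally show ?thesis using p by (simp add: mult.commute)
    qed (use assms zero_iff[of 0] in simp)
  qed
qed

lemma poly_nolin_0:
  assumes "poly_nolin P" shows "P 0 = 0"
proof -
  obtain C where "\<And>\<xi>. norm \<xi> \<le> 1 \<Longrightarrow> \<bar>P \<xi>\<bar> \<le> C * (norm \<xi>)\<^sup>2"
    by (rule poly_nolin_quadratic[OF assms]) blast
  from this[of 0] show ?thesis by simp
qed

lemma pos_type_local_form:
  assumes sum: "(\<lambda>x. norm (\<phi> x)) summable_on UNIV" and one: "norm (fhat \<phi> \<xi>0) = 1"
    and "pos_type \<phi> \<xi>0 \<alpha> \<mu>"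
  shows "local_form \<phi> \<xi>0 \<alpha> \<mu>"
proof -
  obtain Q R Qt Rt E where rep: "Gamma_rep \<phi> \<xi>0 \<alpha> Q R Qt Rt" and R: "positive_homogeneous R" "E \<in> ExpSet R"
    and Q: "homogeneous_wrt Q E" and Qt: "subhomogeneous Qt E" and Rt: "subhomogeneous Rt E" and \<mu>: "\<mu> = hom_order R"
    using assms(3) unfolding pos_type_def by blast
  have poly: "poly_nolin Q" "poly_nolin R" "Qt 0 = 0" "Rt 0 = 0" using rep unfolding Gamma_rep_def by auto
  interpret G: homogeneous_gauge R E
    using R Qt by (intro homogeneous_gaugeI) (auto simp: ExpSet_def subhomogeneous_def)
  obtain r where r: "r > 0" "\<And>\<xi>. norm \<xi> < r \<Longrightarrow>
    fhat \<phi> (\<xi>0 + \<xi>) = fhat \<phi> \<xi>0 * (exp (- (R \<xi> + Rt \<xi>)) *\<^sub>R cis (\<alpha> \<bullet> \<xi> - (Q \<xi> + Qt \<xi>)))"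
    by (rule Gamma_rep_fhat[OF sum one rep]) blast
  obtain d1 where d1: "d1 > 0" "\<And>\<xi>. R \<xi> \<le> d1 \<Longrightarrow> norm \<xi> < r" by (rule G.small_sublevel[OF r(1)]) blast
  obtain d2 where d2: "d2 > 0" "\<And>\<xi>. R \<xi> < d2 \<Longrightarrow> \<bar>Qt \<xi>\<bar> \<le> 1 * R \<xi>"
    by (rule G.subhomogeneous_le[OF Qt poly(3), of 1]) auto
  obtain d3 where d3: "d3 > 0" "\<And>\<xi>. R \<xi> < d3 \<Longrightarrow> \<bar>Rt \<xi>\<bar> \<le> 1/2 * R \<xi>"
    by (rule G.subhomogeneous_le[OF Rt poly(4), of "1/2"]) auto
  obtain cQ where cQ: "cQ > 0" "\<And>\<xi>. R \<xi> \<le> 1 \<Longrightarrow> \<bar>Q \<xi>\<bar> \<le> cQ * R \<xi>"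
    by (rule G.homogeneous_abs_le[of Q 1]) (use poly Q in \<open>auto intro: poly_nolin_continuous poly_nolin_0\<close>)
  obtain cR where cR: "cR > 0" "\<And>\<xi>. norm \<xi> \<le> 1 \<Longrightarrow> \<bar>R \<xi>\<bar> \<le> cR * (norm \<xi>)\<^sup>2"
    by (rule poly_nolin_quadratic[OF poly(2)]) blast
  \<comment> \<open>One constant for three bounds: cR for the quadratic bound on R, cQ + 1 for the
    phase, and 3/2 for the damping.\<close>
  define c where "c = max cR (cQ + 2)"
  define \<delta> where "\<delta> = min 1 (min d1 (min d2 d3))"
  have bounds: "\<bar>Q \<xi> + Qt \<xi>\<bar> \<le> c * R \<xi> \<and> 0 \<le> R \<xi> + Rt \<xi> \<and> (\<xi> \<noteq> 0 \<longrightarrow> 0 < R \<xi> + Rt \<xi>) \<and> R \<xi> + Rt \<xi> \<le> c * R \<xi>"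
    if "R \<xi> < \<delta>" for \<xi>
  proof -
    have *: "\<bar>Q \<xi>\<bar> \<le> cQ * R \<xi>" "\<bar>Qt \<xi>\<bar> \<le> 1 * R \<xi>" "\<bar>Rt \<xi>\<bar> \<le> 1/2 * R \<xi>"
      using that by (auto simp: \<delta>_def intro!: cQ d2(2)[simplified] d3(2)[simplified])
    have n: "0 \<le> R \<xi>" by (rule G.nonneg)
    have cc: "(cQ + 2) * R \<xi> \<le> c * R \<xi>" using n by (intro mult_right_mono) (auto simp: c_def)
    have "0 \<le> cQ * R \<xi>" using cQ(1) n by simp
    thus ?thesis using * n cc G.pos[of \<xi>] unfolding distrib_right by linarith
  qed
  have quad: "R \<xi> \<le> c * (norm \<xi>)\<^sup>2" if "norm \<xi> \<le> 1" for \<xi>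
  proof -
    have "R \<xi> \<le> cR * (norm \<xi>)\<^sup>2" using cR(2)[OF that] by linarith
    also have "\<dots> \<le> c * (norm \<xi>)\<^sup>2" by (intro mult_right_mono) (auto simp: c_def)
    finally show ?thesis .
  qed
  have "\<mu> = trace E" using \<mu> G.hom_order_eq by simp
  moreover have "\<delta> > 0" "c > 0" using d1 d2 d3 cR by (auto simp: \<delta>_def c_def)
  moreover have "fhat \<phi> (\<xi>0 + \<xi>) = fhat \<phi> \<xi>0 * (exp (- (R \<xi> + Rt \<xi>)) *\<^sub>R cis (\<alpha> \<bullet> \<xi> - (Q \<xi> + Qt \<xi>)))" if "R \<xi> < \<delta>" for \<xi>
    by (rule r(2), rule d1(2)) (use that in \<open>simp add: \<delta>_def\<close>)
  ultimately show ?thesis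
    by (intro local_formI[OF G.homogeneous_gauge_axioms _ _ _ quad _ bounds])
qed

lemma imag_type_local_form:
  assumes sum: "(\<lambda>x. norm (\<phi> x)) summable_on UNIV" and one: "norm (fhat \<phi> \<xi>0) = 1"
    and "imag_type \<phi> \<xi>0 \<alpha> \<mu>"
  shows "local_form \<phi> \<xi>0 \<alpha> \<mu>"
proof -
  obtain Q R Qt Rt E k where rep: "Gamma_rep \<phi> \<xi>0 \<alpha> Q R Qt Rt" and Q: "positive_homogeneous (\<lambda>\<xi>. \<bar>Q \<xi>\<bar>)" "E \<in> ExpSet (\<lambda>\<xi>. \<bar>Q \<xi>\<bar>)"
    and R: "positive_homogeneous R" "homogeneous_wrt R ((1 / k) *\<^sub>R E)" and k: "1 < k"
    and Qt: "strongly_subhomogeneous Qt E 2" and Rt: "strongly_subhomogeneous Rt ((1 / k) *\<^sub>R E) 1"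
    and \<mu>: "\<mu> = hom_order (\<lambda>\<xi>. \<bar>Q \<xi>\<bar>)"
    using assms(3) unfolding imag_type_def by blast
  have poly: "poly_nolin Q" "poly_nolin R" "Qt 0 = 0" "Rt 0 = 0" using rep unfolding Gamma_rep_def by auto
  interpret G: homogeneous_gauge "\<lambda>\<xi>. \<bar>Q \<xi>\<bar>" E
    using Q Qt by (intro homogeneous_gaugeI) (auto simp: ExpSet_def strongly_subhomogeneous_def)
  interpret GR: homogeneous_gauge R "(1 / k) *\<^sub>R E"
    using R Rt by (intro homogeneous_gaugeI) (auto simp: strongly_subhomogeneous_def)
  obtain r where r: "r > 0" "\<And>\<xi>. norm \<xi> < r \<Longrightarrow>
    fhat \<phi> (\<xi>0 + \<xi>) = fhat \<phi> \<xi>0 * (exp (- (R \<xi> + Rt \<xi>)) *\<^sub>R cis (\<alpha> \<bullet> \<xi> - (Q \<xi> + Qt \<xi>)))"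
    by (rule Gamma_rep_fhat[OF sum one rep]) blast
  obtain d1 where d1: "d1 > 0" "\<And>\<xi>. \<bar>Q \<xi>\<bar> \<le> d1 \<Longrightarrow> norm \<xi> < r" by (rule G.small_sublevel[OF r(1)]) blast
  obtain d2 where d2: "d2 > 0" "\<And>\<xi>. \<bar>Q \<xi>\<bar> < d2 \<Longrightarrow> \<bar>Qt \<xi>\<bar> \<le> 1 * \<bar>Q \<xi>\<bar>"
    by (rule G.subhomogeneous_le[OF strongly_subhomogeneous_imp_subhomogeneous[OF Qt] poly(3), of 1]) auto
  obtain d3 where d3: "d3 > 0" "\<And>\<xi>. R \<xi> < d3 \<Longrightarrow> \<bar>Rt \<xi>\<bar> \<le> 1/2 * R \<xi>"
    by (rule GR.subhomogeneous_le[OF strongly_subhomogeneous_imp_subhomogeneous[OF Rt] poly(4), of "1/2"]) auto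
  obtain cR where cR: "cR > 0" "\<And>\<xi>. \<bar>Q \<xi>\<bar> \<le> 1 \<Longrightarrow> \<bar>R \<xi>\<bar> \<le> cR * \<bar>Q \<xi>\<bar>"
    by (rule G.homogeneous_abs_le[of R k]) (use poly R k in \<open>auto intro: poly_nolin_continuous poly_nolin_0\<close>)
  obtain cQ where cQ: "cQ > 0" "\<And>\<xi>. norm \<xi> \<le> 1 \<Longrightarrow> \<bar>Q \<xi>\<bar> \<le> cQ * (norm \<xi>)\<^sup>2"
    by (rule poly_nolin_quadratic[OF poly(1)]) blast
  define c where "c = max cQ (2 * cR + 2)"
  \<comment> \<open>\<open>Rt\<close> is controlled on sublevel sets of R. Dividing d3 by cR turns
    this into a sublevel set of |Q|, because R \<le> cR |Q| there.\<close>
  define \<delta> where "\<delta> = min 1 (min d1 (min d2 (d3 / cR)))"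
  have bounds: "\<bar>Q \<xi> + Qt \<xi>\<bar> \<le> c * \<bar>Q \<xi>\<bar> \<and> 0 \<le> R \<xi> + Rt \<xi> \<and> (\<xi> \<noteq> 0 \<longrightarrow> 0 < R \<xi> + Rt \<xi>) \<and> R \<xi> + Rt \<xi> \<le> c * \<bar>Q \<xi>\<bar>"
    if "\<bar>Q \<xi>\<bar> < \<delta>" for \<xi>
  proof -
    have Rle: "R \<xi> \<le> cR * \<bar>Q \<xi>\<bar>" using that cR(2)[of \<xi>] by (auto simp: \<delta>_def)
    also have "\<dots> < cR * (d3 / cR)" using that cR(1) by (intro mult_strict_left_mono) (auto simp: \<delta>_def)
    also have "\<dots> = d3" using cR(1) by simp
    finally have "\<bar>Rt \<xi>\<bar> \<le> 1/2 * R \<xi>" by (rule d3(2))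
    moreover have "\<bar>Qt \<xi>\<bar> \<le> 1 * \<bar>Q \<xi>\<bar>" using that by (intro d2) (simp add: \<delta>_def)
    moreover have cc: "(2 * cR + 2) * \<bar>Q \<xi>\<bar> \<le> c * \<bar>Q \<xi>\<bar>" by (intro mult_right_mono) (auto simp: c_def)
    moreover have "0 \<le> cR * \<bar>Q \<xi>\<bar>" using cR(1) by simp
    ultimately show ?thesis using Rle GR.nonneg[of \<xi>] GR.pos[of \<xi>] unfolding distrib_right by linarith
  qed
  have quad: "\<bar>Q \<xi>\<bar> \<le> c * (norm \<xi>)\<^sup>2" if "norm \<xi> \<le> 1" for \<xi>
  proof -
    have "\<bar>Q \<xi>\<bar> \<le> cQ * (norm \<xi>)\<^sup>2" using cQ(2)[OF that] by linarith
    also have "\<dots> \<le> c * (norm \<xi>)\<^sup>2" by (intro mult_right_mono) (auto simp: c_def)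
    finally show ?thesis .
  qed
  have "\<mu> = trace E" using \<mu> G.hom_order_eq by simp
  moreover have "\<delta> > 0" "c > 0" using d1 d2 d3 cQ cR by (auto simp: \<delta>_def c_def)
  moreover have "fhat \<phi> (\<xi>0 + \<xi>) = fhat \<phi> \<xi>0 * (exp (- (R \<xi> + Rt \<xi>)) *\<^sub>R cis (\<alpha> \<bullet> \<xi> - (Q \<xi> + Qt \<xi>)))" if "\<bar>Q \<xi>\<bar> < \<delta>" for \<xi>
    by (rule r(2), rule d1(2)) (use that in \<open>simp add: \<delta>_def\<close>)
  ultimately show ?thesis
    by (intro local_formI[OF G.homogeneous_gauge_axioms _ _ _ quad _ bounds])
qed

text \<open>Two representations of the same values differ by a unimodular factor equal to 1, whose
  phase vanishes near 0. Hence (\<alpha> - \<alpha>') \<bullet> \<xi> is bounded by a multiple of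
  |\<xi>|^2, which is impossible along multiples of a nonzero \<alpha> - \<alpha>'.\<close>

lemma local_form_drift_unique:
  assumes one: "norm (fhat \<phi> \<xi>0) = 1" and f1: "local_form \<phi> \<xi>0 \<alpha> \<mu>" and f2: "local_form \<phi> \<xi>0 \<alpha>' \<mu>'"
  shows "\<alpha> = \<alpha>'"
proof -
  obtain P E u v r c where A: "homogeneous_gauge P E" "0 < r" "r \<le> 1" "0 < c"
    "\<forall>\<xi>. norm \<xi> \<le> 1 \<longrightarrow> P \<xi> \<le> c * (norm \<xi>)\<^sup>2"
    "\<forall>\<xi>. norm \<xi> < r \<longrightarrow> fhat \<phi> (\<xi>0 + \<xi>) = fhat \<phi> \<xi>0 * (exp (- v \<xi>) *\<^sub>R cis (\<alpha> \<bullet> \<xi> - u \<xi>))"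
    "\<forall>\<xi>. norm \<xi> < r \<longrightarrow> \<bar>u \<xi>\<bar> \<le> c * P \<xi> \<and> 0 \<le> v \<xi> \<and> (\<xi> \<noteq> 0 \<longrightarrow> 0 < v \<xi>) \<and> v \<xi> \<le> c * P \<xi>"
    using f1 unfolding local_form_def by (elim exE conjE) (rule that)
  obtain P' E' u' v' r' c' where A': "homogeneous_gauge P' E'" "0 < r'" "r' \<le> 1" "0 < c'"
    "\<forall>\<xi>. norm \<xi> \<le> 1 \<longrightarrow> P' \<xi> \<le> c' * (norm \<xi>)\<^sup>2"
    "\<forall>\<xi>. norm \<xi> < r' \<longrightarrow> fhat \<phi> (\<xi>0 + \<xi>) = fhat \<phi> \<xi>0 * (exp (- v' \<xi>) *\<^sub>R cis (\<alpha>' \<bullet> \<xi> - u' \<xi>))"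
    "\<forall>\<xi>. norm \<xi> < r' \<longrightarrow> \<bar>u' \<xi>\<bar> \<le> c' * P' \<xi> \<and> 0 \<le> v' \<xi> \<and> (\<xi> \<noteq> 0 \<longrightarrow> 0 < v' \<xi>) \<and> v' \<xi> \<le> c' * P' \<xi>"
    using f2 unfolding local_form_def by (elim exE conjE) (rule that)
  define D where "D = c * c + c' * c'"
  have u_le: "\<bar>u \<xi> - u' \<xi>\<bar> \<le> D * (norm \<xi>)\<^sup>2" if "norm \<xi> < r" "norm \<xi> < r'" for \<xi>
  proof -
    have "norm \<xi> \<le> 1" using that A(3) by linarith
    have "\<bar>u \<xi>\<bar> \<le> c * (c * (norm \<xi>)\<^sup>2)"
      using A(7)[rule_format, OF that(1), THEN conjunct1] mult_left_mono[OF A(5)[rule_format, OF \<open>norm \<xi> \<le> 1\<close>], of c] A(4) by linarith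
    moreover have "\<bar>u' \<xi>\<bar> \<le> c' * (c' * (norm \<xi>)\<^sup>2)"
      using A'(7)[rule_format, OF that(2), THEN conjunct1] mult_left_mono[OF A'(5)[rule_format, OF \<open>norm \<xi> \<le> 1\<close>], of c'] A'(4) by linarith
    moreover have "D * (norm \<xi>)\<^sup>2 = c * (c * (norm \<xi>)\<^sup>2) + c' * (c' * (norm \<xi>)\<^sup>2)" by (simp add: D_def algebra_simps)
    ultimately show ?thesis by linarith
  qed
  define \<beta> where "\<beta> = \<alpha> - \<alpha>'"
  have D0: "D \<ge> 0" by (simp add: D_def)
  have lin: "\<beta> \<bullet> \<xi> \<le> D * (norm \<xi>)\<^sup>2" if x: "norm \<xi> < r" "norm \<xi> < r'" "norm \<beta> * norm \<xi> < 1" "D * (norm \<xi>)\<^sup>2 < 1" for \<xi>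
  proof -
    have nz: "fhat \<phi> \<xi>0 \<noteq> 0" using one by auto
    have eq: "exp (- v \<xi>) *\<^sub>R cis (\<alpha> \<bullet> \<xi> - u \<xi>) = exp (- v' \<xi>) *\<^sub>R cis (\<alpha>' \<bullet> \<xi> - u' \<xi>)"
      using mult_left_cancel[OF nz, THEN iffD1, OF trans[OF sym[OF A(6)[rule_format, OF x(1)]] A'(6)[rule_format, OF x(2)]]] .
    from arg_cong[OF this, of norm] have ve: "exp (- v \<xi>) = exp (- v' \<xi>)" by simp
    have ceq: "cis (\<alpha> \<bullet> \<xi> - u \<xi>) = cis (\<alpha>' \<bullet> \<xi> - u' \<xi>)"
      using eq unfolding ve scaleR_cancel_left by simp
    let ?t = "\<beta> \<bullet> \<xi> - (u \<xi> - u' \<xi>)"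
    have "cis ?t = cis (\<alpha> \<bullet> \<xi> - u \<xi>) / cis (\<alpha>' \<bullet> \<xi> - u' \<xi>)"
      unfolding cis_divide by (rule arg_cong[of _ _ cis]) (simp add: \<beta>_def inner_diff_left)
    also have "\<dots> = 1" unfolding ceq by simp
    finally have c1: "cis ?t = 1" .
    have "sin ?t = 0" using arg_cong[OF c1, of Im] by simp
    \<comment> \<open>sin = 0 alone allows every multiple of pi; the smallness of both parts of the
      phase leaves only 0.\<close>
    have "\<bar>?t\<bar> < 2"
      using Cauchy_Schwarz_ineq2[of \<beta> \<xi>] x(3,4) u_le[OF x(1,2)] by linarith
    hence "- pi < ?t" "?t < pi" using pi_gt3 by linarith+
    hence "?t = 0" using \<open>sin ?t = 0\<close> by (rule sin_eq_0_pi)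
    thus ?thesis using u_le[OF x(1,2)] by linarith
  qed
  have "\<beta> = 0"
  proof (rule ccontr)
    assume "\<beta> \<noteq> 0"
    define b where "b = norm \<beta>"
    have b: "b > 0" using \<open>\<beta> \<noteq> 0\<close> by (simp add: b_def)
    \<comment> \<open>The bounds serve, in order, D t \<le> 1/2, which gives the contradiction,
      membership in the two balls, and smallness of the linear part of the phase.\<close>
    define t where "t = min (1 / (2 * (D + 1))) (min (r / (2 * b)) (min (r' / (2 * b)) (1 / (2 * b\<^sup>2))))"
    have t: "t > 0" "t \<le> 1 / (2 * (D + 1))" "t \<le> r / (2 * b)" "t \<le> r' / (2 * b)" "t \<le> 1 / (2 * b\<^sup>2)"
      using b D0 A(2) A'(2) by (auto simp: t_def)
    have tb1: "t * b \<le> r / 2" using mult_right_mono[OF t(3), of b] b by simp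
    have tb2: "t * b \<le> r' / 2" using mult_right_mono[OF t(4), of b] b by simp
    have tb3: "t * b\<^sup>2 \<le> 1 / 2" using mult_right_mono[OF t(5), of "b\<^sup>2"] b by simp
    have "t * (D + 1) \<le> 1 / 2"
    proof -
      have "t * (D + 1) \<le> 1 / (2 * (D + 1)) * (D + 1)" using t(2) D0 by (intro mult_right_mono) auto
      also have "\<dots> = 1 / 2" using D0 by (simp only: times_divide_eq_left mult_1 nonzero_mult_divide_mult_cancel_right) auto
      finally show ?thesis .
    qed
    hence tb4: "D * t \<le> 1 / 2" using t(1) unfolding distrib_left mult.commute[of D t] by linarith
    have nt: "norm (t *\<^sub>R \<beta>) = t * b" using t(1) by (simp add: b_def)
    have sq: "D * (t * b)\<^sup>2 = (D * t) * (t * b\<^sup>2)" by (simp add: power2_eq_square)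
    have "(D * t) * (t * b\<^sup>2) \<le> 1 / 2 * (1 / 2)" using tb3 tb4 t(1) D0 by (intro mult_mono) auto
    hence Dt: "D * (t * b)\<^sup>2 < 1" unfolding sq by simp
    have "\<beta> \<bullet> (t *\<^sub>R \<beta>) \<le> D * (norm (t *\<^sub>R \<beta>))\<^sup>2"
    proof (rule lin)
      show "norm (t *\<^sub>R \<beta>) < r" "norm (t *\<^sub>R \<beta>) < r'" unfolding nt using tb1 tb2 A(2) A'(2) by linarith+
      have "norm \<beta> * norm (t *\<^sub>R \<beta>) = t * b\<^sup>2" unfolding nt by (simp add: b_def power2_eq_square)
      thus "norm \<beta> * norm (t *\<^sub>R \<beta>) < 1" using tb3 by simp
      show "D * (norm (t *\<^sub>R \<beta>))\<^sup>2 < 1" unfolding nt by (rule Dt)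
    qed
    moreover have "\<beta> \<bullet> (t *\<^sub>R \<beta>) = t * b\<^sup>2" by (simp add: b_def power2_norm_eq_inner)
    ultimately have "t * b\<^sup>2 \<le> (D * t) * (t * b\<^sup>2)" unfolding nt sq by linarith
    moreover have "(D * t) * (t * b\<^sup>2) \<le> 1 / 2 * (t * b\<^sup>2)"
      using tb4 t(1) by (intro mult_right_mono) auto
    moreover have "t * b\<^sup>2 > 0" using t(1) b by simp
    ultimately show False by linarith
  qed
  thus ?thesis by (simp add: \<beta>_def)
qed

lemma local_form_isolated:
  assumes one: "norm (fhat \<phi> \<xi>0) = 1" and f: "local_form \<phi> \<xi>0 \<alpha> \<mu>"
  obtains r where "r > 0" "\<And>\<xi>. \<xi> \<noteq> 0 \<Longrightarrow> norm \<xi> < r \<Longrightarrow> norm (fhat \<phi> (\<xi>0 + \<xi>)) < 1"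
proof -
  obtain P E u v r c where A: "homogeneous_gauge P E" "0 < r" "r \<le> 1" "0 < c"
    "\<forall>\<xi>. norm \<xi> \<le> 1 \<longrightarrow> P \<xi> \<le> c * (norm \<xi>)\<^sup>2"
    "\<forall>\<xi>. norm \<xi> < r \<longrightarrow> fhat \<phi> (\<xi>0 + \<xi>) = fhat \<phi> \<xi>0 * (exp (- v \<xi>) *\<^sub>R cis (\<alpha> \<bullet> \<xi> - u \<xi>))"
    "\<forall>\<xi>. norm \<xi> < r \<longrightarrow> \<bar>u \<xi>\<bar> \<le> c * P \<xi> \<and> 0 \<le> v \<xi> \<and> (\<xi> \<noteq> 0 \<longrightarrow> 0 < v \<xi>) \<and> v \<xi> \<le> c * P \<xi>"
    using f unfolding local_form_def by (elim exE conjE) (rule that)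
  show ?thesis
  proof (rule that[OF A(2)])
    fix \<xi> :: "real^'a" assume "\<xi> \<noteq> 0" "norm \<xi> < r"
    thus "norm (fhat \<phi> (\<xi>0 + \<xi>)) < 1"
      using A(6)[rule_format, of \<xi>] A(7)[rule_format, of \<xi>] one by (simp add: norm_mult)
  qed
qed

lemma local_form_order_pos:
  assumes "local_form \<phi> \<xi>0 \<alpha> \<mu>" shows "\<mu> > 0"
  using assms unfolding local_form_def by (elim exE conjE) (simp add: homogeneous_gauge.trace_pos)


section \<open>The upper bound\<close>

lemma cis_scaleR_power: "(e *\<^sub>R cis t) ^ n = (e ^ n) *\<^sub>R cis (real n * t)"
  by (simp add: scaleR_power Complex.DeMoivre)

text \<open>r0 is at the caller's disposal, so that neighbourhoods of different points can be made
  disjoint and kept inside a period box. U and C may depend on r0 and \<rho>, the rate a on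
  neither.\<close>

definition local_decay :: "(int^'d::finite \<Rightarrow> complex) \<Rightarrow> real^'d \<Rightarrow> real \<Rightarrow> real^'d \<Rightarrow> real \<Rightarrow> bool" where
  "local_decay \<phi> \<alpha> \<mu> z a \<longleftrightarrow> (\<forall>r0>0. \<forall>\<rho>\<ge>0. \<exists>U C. open U \<and> 0 \<in> U \<and> U \<subseteq> ball 0 r0 \<and> C > 0 \<and> (\<forall>n\<ge>1. \<forall>x.
      norm (zvec x - real n *\<^sub>R \<alpha>) \<le> \<rho> + real n powr a \<longrightarrow>
      norm (\<integral>\<xi>. indicator U \<xi> *\<^sub>R (fhat \<phi> (z + \<xi>) ^ n * cis (- (zvec x \<bullet> \<xi>))) \<partial>lborel) \<le> C * real n powr (- \<mu>)))"

lemma local_decayE: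
  assumes "local_decay \<phi> \<alpha> \<mu> z a" "r0 > 0" "\<rho> \<ge> 0"
  obtains U C where "open U" "0 \<in> U" "U \<subseteq> ball 0 r0" "C > 0"
    "\<And>n x. n \<ge> 1 \<Longrightarrow> norm (zvec x - real n *\<^sub>R \<alpha>) \<le> \<rho> + real n powr a \<Longrightarrow>
      norm (\<integral>\<xi>. indicator U \<xi> *\<^sub>R (fhat \<phi> (z + \<xi>) ^ n * cis (- (zvec x \<bullet> \<xi>))) \<partial>lborel) \<le> C * real n powr (- \<mu>)"
proof -
  from assms(1)[unfolded local_decay_def, rule_format, OF assms(2,3)] obtain U C
    where U: "open U" "0 \<in> U" "U \<subseteq> ball 0 r0" "C > 0" and b: "\<forall>n\<ge>1. \<forall>x.
      norm (zvec x - real n *\<^sub>R \<alpha>) \<le> \<rho> + real n powr a \<longrightarrow>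
      norm (\<integral>\<xi>. indicator U \<xi> *\<^sub>R (fhat \<phi> (z + \<xi>) ^ n * cis (- (zvec x \<bullet> \<xi>))) \<partial>lborel) \<le> C * real n powr (- \<mu>)"
    by (elim exE conjE) (rule that)
  show ?thesis by (rule that[OF U b[rule_format]])
qed

lemma local_decay_mono:
  assumes dec: "local_decay \<phi> \<alpha> \<mu> z a" and le: "s \<le> a" "\<mu>0 \<le> \<mu>"
  shows "local_decay \<phi> \<alpha> \<mu>0 z s"
  unfolding local_decay_def
proof (intro allI impI)
  fix r0 \<rho> :: real assume r0: "r0 > 0" "\<rho> \<ge> 0"
  obtain U C where U: "open U" "0 \<in> U" "U \<subseteq> ball 0 r0" "C > 0"
    and b: "\<And>n x. n \<ge> 1 \<Longrightarrow> norm (zvec x - real n *\<^sub>R \<alpha>) \<le> \<rho> + real n powr a \<Longrightarrow>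
      norm (\<integral>\<xi>. indicator U \<xi> *\<^sub>R (fhat \<phi> (z + \<xi>) ^ n * cis (- (zvec x \<bullet> \<xi>))) \<partial>lborel) \<le> C * real n powr (- \<mu>)"
    by (rule local_decayE[OF dec r0]) blast
  have "norm (\<integral>\<xi>. indicator U \<xi> *\<^sub>R (fhat \<phi> (z + \<xi>) ^ n * cis (- (zvec x \<bullet> \<xi>))) \<partial>lborel) \<le> C * real n powr (- \<mu>0)"
    if n: "n \<ge> 1" and x: "norm (zvec x - real n *\<^sub>R \<alpha>) \<le> \<rho> + real n powr s" for n x
  proof -
    have "real n powr s \<le> real n powr a" using le(1) n by (intro powr_mono) auto
    hence "norm (\<integral>\<xi>. indicator U \<xi> *\<^sub>R (fhat \<phi> (z + \<xi>) ^ n * cis (- (zvec x \<bullet> \<xi>))) \<partial>lborel) \<le> C * real n powr (- \<mu>)"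
      using x by (intro b[OF n]) linarith
    also have "\<dots> \<le> C * real n powr (- \<mu>0)" using U(4) n le(2) by (intro mult_left_mono powr_mono) auto
    finally show ?thesis .
  qed
  thus "\<exists>U C. open U \<and> 0 \<in> U \<and> U \<subseteq> ball 0 r0 \<and> C > 0 \<and> (\<forall>n\<ge>1. \<forall>x.
      norm (zvec x - real n *\<^sub>R \<alpha>) \<le> \<rho> + real n powr s \<longrightarrow>
      norm (\<integral>\<xi>. indicator U \<xi> *\<^sub>R (fhat \<phi> (z + \<xi>) ^ n * cis (- (zvec x \<bullet> \<xi>))) \<partial>lborel) \<le> C * real n powr (- \<mu>0))"
    by (intro exI[of _ U] exI[of _ C] conjI U allI impI)
qed

text \<open>Only the modulus of the integrand is estimated, so the bound holds at every lattice
  point. This is why \<beta> and a are arbitrary: points of positive type may drift differently from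
  the common \<alpha>.\<close>

lemma pos_type_upper_bound:
  assumes sum: "(\<lambda>x. norm (\<phi> x)) summable_on UNIV" and one: "norm (fhat \<phi> \<xi>0) = 1"
    and type: "pos_type \<phi> \<xi>0 \<alpha> \<mu>"
  shows "local_decay \<phi> \<beta> \<mu> \<xi>0 a"
  unfolding local_decay_def
proof (intro allI impI)
  fix r0 \<rho> :: real assume r0: "r0 > 0"
  obtain Q R Qt Rt E where rep: "Gamma_rep \<phi> \<xi>0 \<alpha> Q R Qt Rt" and R: "positive_homogeneous R" "E \<in> ExpSet R"
    and Rt: "subhomogeneous Rt E" and \<mu>: "\<mu> = hom_order R"
    using type unfolding pos_type_def by blast
  have Rt0: "Rt 0 = 0" using rep unfolding Gamma_rep_def by auto
  interpret G: homogeneous_gauge R E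
    using R Rt by (intro homogeneous_gaugeI) (auto simp: ExpSet_def subhomogeneous_def)
  obtain r where r: "r > 0" "\<And>\<xi>. norm \<xi> < r \<Longrightarrow>
    fhat \<phi> (\<xi>0 + \<xi>) = fhat \<phi> \<xi>0 * (exp (- (R \<xi> + Rt \<xi>)) *\<^sub>R cis (\<alpha> \<bullet> \<xi> - (Q \<xi> + Qt \<xi>)))"
    by (rule Gamma_rep_fhat[OF sum one rep]) blast
  obtain d1 where d1: "d1 > 0" "\<And>\<xi>. R \<xi> \<le> d1 \<Longrightarrow> norm \<xi> < min r r0"
    by (rule G.small_sublevel[of "min r r0"]) (use r r0 in auto)
  obtain d3 where d3: "d3 > 0" "\<And>\<xi>. R \<xi> < d3 \<Longrightarrow> \<bar>Rt \<xi>\<bar> \<le> 1/2 * R \<xi>"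
    by (rule G.subhomogeneous_le[OF Rt Rt0, of "1/2"]) auto
  define d where "d = min d1 d3"
  have d: "d > 0" using d1 d3 by (simp add: d_def)
  define U where "U = {\<xi>. R \<xi> < d}"
  obtain C where C: "C > 0" "\<And>N f. N \<ge> 1 \<Longrightarrow> integrable lborel f \<Longrightarrow> (\<And>\<xi>. norm (f \<xi> :: complex) \<le> exp (- N * R \<xi> / 2))
    \<Longrightarrow> norm (integral\<^sup>L lborel f) \<le> C * N powr (- trace E)"
    by (rule G.gaussian_bound) blast
  have U: "open U" "0 \<in> U" "U \<subseteq> ball 0 r0"
  proof -
    show "open U" unfolding U_def using G.cont by (intro open_Collect_less continuous_intros) auto
    show "0 \<in> U" using d G.zero_iff[of 0] by (simp add: U_def)
    show "U \<subseteq> ball 0 r0"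
    proof
      fix \<xi> assume "\<xi> \<in> U"
      hence "norm \<xi> < min r r0" by (intro d1) (simp add: U_def d_def)
      thus "\<xi> \<in> ball 0 r0" by simp
    qed
  qed
  have Ufin: "emeasure lborel U < \<infinity>"
    by (rule emeasure_bounded_finite[OF bounded_subset[OF bounded_ball U(3)]])
  have fhat_le: "norm (fhat \<phi> (\<xi>0 + \<xi>)) \<le> exp (- R \<xi> / 2)" if "\<xi> \<in> U" for \<xi>
  proof -
    have "norm \<xi> < min r r0" using that by (intro d1) (simp add: U_def d_def)
    hence "norm (fhat \<phi> (\<xi>0 + \<xi>)) = exp (- (R \<xi> + Rt \<xi>))" using r(2)[of \<xi>] one by (simp add: norm_mult)
    moreover have "\<bar>Rt \<xi>\<bar> \<le> 1/2 * R \<xi>" using that by (intro d3) (simp add: U_def d_def)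
    ultimately show ?thesis by simp
  qed
  have "norm (\<integral>\<xi>. indicator U \<xi> *\<^sub>R (fhat \<phi> (\<xi>0 + \<xi>) ^ n * cis (- (zvec x \<bullet> \<xi>))) \<partial>lborel) \<le> C * real n powr (- \<mu>)"
    if n: "n \<ge> 1" for n x
  proof -
    let ?g = "\<lambda>\<xi>. fhat \<phi> (\<xi>0 + \<xi>) ^ n * cis (- (zvec x \<bullet> \<xi>))"
    have g_le: "norm (?g \<xi>) \<le> exp (- real n * R \<xi> / 2)" if "\<xi> \<in> U" for \<xi>
    proof -
      have "norm (?g \<xi>) \<le> exp (- R \<xi> / 2) ^ n"
        using fhat_le[OF that] by (simp add: norm_mult norm_power power_mono)
      also have "\<dots> = exp (- real n * R \<xi> / 2)" by (simp add: exp_of_nat_mult[symmetric])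
      finally show ?thesis .
    qed
    have g_le1: "norm (?g \<xi>) \<le> 1" if "\<xi> \<in> U" for \<xi>
      by (rule order_trans[OF g_le[OF that]]) (simp add: G.nonneg)
    have gm: "?g \<in> borel_measurable borel"
      by (intro borel_measurable_continuous_onI continuous_intros continuous_on_compose2[OF continuous_on_fhat[OF sum]]) auto
    have "norm (\<integral>\<xi>. indicator U \<xi> *\<^sub>R ?g \<xi> \<partial>lborel) \<le> C * real n powr (- trace E)"
    proof (rule C(2))
      show "integrable lborel (\<lambda>\<xi>. indicator U \<xi> *\<^sub>R ?g \<xi>)"
        by (rule integrable_indicator_bounded[OF _ Ufin gm g_le1]) (use U in auto)
      show "norm (indicator U \<xi> *\<^sub>R ?g \<xi>) \<le> exp (- real n * R \<xi> / 2)" for \<xi>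
        using g_le[of \<xi>] by (cases "\<xi> \<in> U") auto
    qed (use n in simp)
    thus ?thesis using \<mu> G.hom_order_eq by simp
  qed
  thus "\<exists>U C. open U \<and> 0 \<in> U \<and> U \<subseteq> ball 0 r0 \<and> C > 0 \<and> (\<forall>n\<ge>1. \<forall>x.
      norm (zvec x - real n *\<^sub>R \<beta>) \<le> \<rho> + real n powr a \<longrightarrow>
      norm (\<integral>\<xi>. indicator U \<xi> *\<^sub>R (fhat \<phi> (\<xi>0 + \<xi>) ^ n * cis (- (zvec x \<bullet> \<xi>))) \<partial>lborel) \<le> C * real n powr (- \<mu>))"
    by (intro exI[of _ U] exI[of _ C] conjI U C(1) allI impI)
qed

lemma smooth_near0_continuous:
  assumes "smooth_near0 f" obtains U where "open U" "0 \<in> U" "continuous_on U f"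
proof -
  obtain U where "open U" "0 \<in> U" "\<forall>k. Ck_on k U f" using assms unfolding smooth_near0_def by blast
  thus ?thesis using that[of U] by (metis Ck_on.simps(1))
qed

lemma imag_type_upper_bound:
  assumes sum: "(\<lambda>x. norm (\<phi> x)) summable_on UNIV" and one: "norm (fhat \<phi> \<xi>0) = 1"
    and type: "imag_type \<phi> \<xi>0 \<alpha> \<mu>" and mu1: "\<mu> < 1"
  shows "\<exists>a>0. local_decay \<phi> \<alpha> \<mu> \<xi>0 a"
proof -
  obtain Q R Qt Rt E k where rep: "Gamma_rep \<phi> \<xi>0 \<alpha> Q R Qt Rt" and Q: "positive_homogeneous (\<lambda>\<xi>. \<bar>Q \<xi>\<bar>)" "E \<in> ExpSet (\<lambda>\<xi>. \<bar>Q \<xi>\<bar>)"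
    and R: "positive_homogeneous R" "homogeneous_wrt R ((1 / k) *\<^sub>R E)" and k: "1 < k"
    and Qt: "strongly_subhomogeneous Qt E 2" and Rt: "strongly_subhomogeneous Rt ((1 / k) *\<^sub>R E) 1"
    and \<mu>: "\<mu> = hom_order (\<lambda>\<xi>. \<bar>Q \<xi>\<bar>)"
    using type unfolding imag_type_def by blast
  have poly: "poly_nolin Q" "poly_nolin R" "smooth_near0 Qt" "smooth_near0 Rt" using rep unfolding Gamma_rep_def by auto
  interpret G: homogeneous_gauge "\<lambda>\<xi>. \<bar>Q \<xi>\<bar>" E
    using Q Qt by (intro homogeneous_gaugeI) (auto simp: ExpSet_def strongly_subhomogeneous_def)
  interpret GR: homogeneous_gauge R "(1 / k) *\<^sub>R E"
    using R Rt by (intro homogeneous_gaugeI) (auto simp: strongly_subhomogeneous_def)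
  have tr: "trace E = \<mu>" using \<mu> G.hom_order_eq by simp
  obtain r where r: "r > 0" "\<And>\<xi>. norm \<xi> < r \<Longrightarrow>
    fhat \<phi> (\<xi>0 + \<xi>) = fhat \<phi> \<xi>0 * (exp (- (R \<xi> + Rt \<xi>)) *\<^sub>R cis (\<alpha> \<bullet> \<xi> - (Q \<xi> + Qt \<xi>)))"
    by (rule Gamma_rep_fhat[OF sum one rep]) blast
  obtain W1 where W1: "open W1" "0 \<in> W1" "continuous_on W1 Qt" by (rule smooth_near0_continuous[OF poly(3)])
  obtain W2 where W2: "open W2" "0 \<in> W2" "continuous_on W2 Rt" by (rule smooth_near0_continuous[OF poly(4)])
  have W: "open (W1 \<inter> W2)" "0 \<in> W1 \<inter> W2" "continuous_on (W1 \<inter> W2) Qt" "continuous_on (W1 \<inter> W2) Rt"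
    using W1 W2 by (auto intro: continuous_on_subset)
  obtain a where a: "a > 0" "\<And>r \<rho>. r > 0 \<Longrightarrow> \<rho> \<ge> 0 \<Longrightarrow> \<exists>\<delta>>0. \<exists>C>0. {\<xi>. \<bar>Q \<xi>\<bar> < \<delta>} \<subseteq> ball 0 r \<and>
     (\<forall>N\<ge>1. \<forall>y. norm y \<le> \<rho> + N powr a \<longrightarrow>
       norm (\<integral>\<xi>. indicator {\<xi>. \<bar>Q \<xi>\<bar> < \<delta>} \<xi> *\<^sub>R (exp (- N * (R \<xi> + Rt \<xi>)) *\<^sub>R cis (y \<bullet> \<xi> - N * (Q \<xi> + Qt \<xi>))) \<partial>lborel)
         \<le> C * N powr (- trace E))"
    by (rule imaginary_type_integral_bound[OF G.homogeneous_gauge_axioms poly(1,2) GR.pos _ R(2) Qt Rt _ W])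
       (use k mu1 tr in auto)
  have "local_decay \<phi> \<alpha> \<mu> \<xi>0 a"
    unfolding local_decay_def
  proof (intro allI impI)
    fix r0 \<rho> :: real assume r0: "r0 > 0" and \<rho>: "\<rho> \<ge> 0"
    obtain \<delta> C where \<delta>: "\<delta> > 0" and C: "C > 0" and sub: "{\<xi>. \<bar>Q \<xi>\<bar> < \<delta>} \<subseteq> ball 0 (min r r0)"
      and bnd: "\<forall>N\<ge>1. \<forall>y. norm y \<le> \<rho> + N powr a \<longrightarrow>
       norm (\<integral>\<xi>. indicator {\<xi>. \<bar>Q \<xi>\<bar> < \<delta>} \<xi> *\<^sub>R (exp (- N * (R \<xi> + Rt \<xi>)) *\<^sub>R cis (y \<bullet> \<xi> - N * (Q \<xi> + Qt \<xi>))) \<partial>lborel)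
         \<le> C * N powr (- trace E)"
      using a(2)[of "min r r0" \<rho>] r(1) r0 \<rho> by auto
    define U where "U = {\<xi>. \<bar>Q \<xi>\<bar> < \<delta>}"
    have "open U" unfolding U_def using G.cont by (intro open_Collect_less continuous_on_const) auto
    moreover have "0 \<in> U" using \<delta> G.zero_iff[of 0] by (simp add: U_def)
    moreover have "U \<subseteq> ball 0 r0" using sub by (auto simp: U_def)
    moreover have "norm (\<integral>\<xi>. indicator U \<xi> *\<^sub>R (fhat \<phi> (\<xi>0 + \<xi>) ^ n * cis (- (zvec x \<bullet> \<xi>))) \<partial>lborel) \<le> C * real n powr (- \<mu>)"
      if n: "n \<ge> 1" and x: "norm (zvec x - real n *\<^sub>R \<alpha>) \<le> \<rho> + real n powr a" for n x
    proof -
      \<comment> \<open>The n-th power of the local drift and the inversion character merge into one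
        linear phase, while the n-th power of the value at \<open>\<xi>0\<close> is unimodular and
        leaves the integral.\<close>
      let ?y = "real n *\<^sub>R \<alpha> - zvec x"
      let ?h = "\<lambda>\<xi>. indicator U \<xi> *\<^sub>R (exp (- real n * (R \<xi> + Rt \<xi>)) *\<^sub>R cis (?y \<bullet> \<xi> - real n * (Q \<xi> + Qt \<xi>)))"
      have eq: "indicator U \<xi> *\<^sub>R (fhat \<phi> (\<xi>0 + \<xi>) ^ n * cis (- (zvec x \<bullet> \<xi>))) = fhat \<phi> \<xi>0 ^ n * ?h \<xi>" for \<xi>
      proof (cases "\<xi> \<in> U")
        case True
        hence "\<xi> \<in> ball 0 (min r r0)" using sub unfolding U_def by blast
        hence "norm \<xi> < r" by simp
        from r(2)[OF this] have "fhat \<phi> (\<xi>0 + \<xi>) ^ n = fhat \<phi> \<xi>0 ^ n *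
            ((exp (- (R \<xi> + Rt \<xi>)) ^ n) *\<^sub>R cis (real n * (\<alpha> \<bullet> \<xi> - (Q \<xi> + Qt \<xi>))))"
          by (simp only: power_mult_distrib cis_scaleR_power)
        also have "exp (- (R \<xi> + Rt \<xi>)) ^ n = exp (- real n * (R \<xi> + Rt \<xi>))"
          unfolding exp_of_nat_mult[symmetric] by (simp add: algebra_simps)
        finally have "fhat \<phi> (\<xi>0 + \<xi>) ^ n * cis (- (zvec x \<bullet> \<xi>)) = fhat \<phi> \<xi>0 ^ n *
            (exp (- real n * (R \<xi> + Rt \<xi>)) *\<^sub>R (cis (real n * (\<alpha> \<bullet> \<xi> - (Q \<xi> + Qt \<xi>))) * cis (- (zvec x \<bullet> \<xi>))))"
          by (simp only: mult.assoc mult_scaleR_left)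
        also have "cis (real n * (\<alpha> \<bullet> \<xi> - (Q \<xi> + Qt \<xi>))) * cis (- (zvec x \<bullet> \<xi>)) = cis (?y \<bullet> \<xi> - real n * (Q \<xi> + Qt \<xi>))"
          unfolding cis_mult by (rule arg_cong[of _ _ cis]) (simp add: inner_diff_left algebra_simps)
        finally show ?thesis using True by simp
      qed simp
      have "norm (\<integral>\<xi>. indicator U \<xi> *\<^sub>R (fhat \<phi> (\<xi>0 + \<xi>) ^ n * cis (- (zvec x \<bullet> \<xi>))) \<partial>lborel) = norm (integral\<^sup>L lborel ?h)"
        unfolding eq integral_mult_right_zero by (simp add: norm_mult norm_power one)
      also have "\<dots> \<le> C * real n powr (- trace E)"
        unfolding U_def by (rule bnd[rule_format]) (use n x in \<open>auto simp: norm_minus_commute\<close>)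
      finally show ?thesis using tr by simp
    qed
    ultimately show "\<exists>U C. open U \<and> 0 \<in> U \<and> U \<subseteq> ball 0 r0 \<and> C > 0 \<and> (\<forall>n\<ge>1. \<forall>x.
      norm (zvec x - real n *\<^sub>R \<alpha>) \<le> \<rho> + real n powr a \<longrightarrow>
      norm (\<integral>\<xi>. indicator U \<xi> *\<^sub>R (fhat \<phi> (\<xi>0 + \<xi>) ^ n * cis (- (zvec x \<bullet> \<xi>))) \<partial>lborel) \<le> C * real n powr (- \<mu>))"
      using C by (intro exI[of _ U] exI[of _ C]) simp
  qed
  thus ?thesis using a(1) by blast
qed

section \<open>Reduction to \<open>Omega\<close>, and the values picked by
  \<open>SOME\<close>\<close>

lemma translate_to_Omega:
  assumes "norm (fhat \<phi> z) = 1"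
  obtains \<xi>0 where "\<xi>0 \<in> Omega \<phi>" "\<And>\<xi>. fhat \<phi> (z + \<xi>) = fhat \<phi> (\<xi>0 + \<xi>)"
proof -
  \<comment> \<open>The ceiling, not the floor: t minus its ceiling lies in (-1, 0], and this
    becomes the half-open interval (-pi, pi].\<close>
  define m where "m = (\<chi> j. - \<lceil>(z $ j - pi) / (2 * pi)\<rceil>)"
  define \<xi>0 where "\<xi>0 = z + (2 * pi) *\<^sub>R zvec m"
  have per: "fhat \<phi> (z + \<xi>) = fhat \<phi> (\<xi>0 + \<xi>)" for \<xi>
    using fhat_periodic[of \<phi> "z + \<xi>" m] by (simp add: \<xi>0_def add_ac)
  have "- pi < \<xi>0 $ j \<and> \<xi>0 $ j \<le> pi" for j
  proof -
    define t where "t = (z $ j - pi) / (2 * pi)"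
    have zj: "z $ j = 2 * pi * t + pi" by (simp add: t_def)
    have x: "\<xi>0 $ j = 2 * pi * (t - of_int \<lceil>t\<rceil>) + pi"
      by (simp add: \<xi>0_def zvec_def m_def zj t_def[symmetric] algebra_simps)
    have "- 1 < t - of_int \<lceil>t\<rceil>" "t - of_int \<lceil>t\<rceil> \<le> 0" by linarith+
    hence "2 * pi * (- 1) < 2 * pi * (t - of_int \<lceil>t\<rceil>)" "2 * pi * (t - of_int \<lceil>t\<rceil>) \<le> 2 * pi * 0"
      by (intro mult_strict_left_mono mult_left_mono; simp)+
    thus ?thesis unfolding x by linarith
  qed
  moreover have "norm (fhat \<phi> \<xi>0) = 1" using per[of 0] assms by simp
  ultimately have "\<xi>0 \<in> Omega \<phi>" by (simp add: Omega_def)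
  thus ?thesis using per by (rule that)
qed

lemma finite_common_bound:
  fixes P :: "'a \<Rightarrow> real \<Rightarrow> bool"
  assumes "finite Z" and "\<And>z. z \<in> Z \<Longrightarrow> \<exists>r>0. P z r" and "\<And>z r s. P z r \<Longrightarrow> 0 < s \<Longrightarrow> s \<le> r \<Longrightarrow> P z s"
  obtains r where "r > 0" "\<And>z. z \<in> Z \<Longrightarrow> P z r"
proof -
  have "\<exists>r>0. \<forall>z\<in>Z. P z r"
    using assms(1,2)
  proof (induction Z rule: finite_induct)
    case (insert z Z)
    obtain r1 where "r1 > 0" "\<forall>z\<in>Z. P z r1" using insert.IH insert.prems by blast
    moreover obtain r2 where "r2 > 0" "P z r2" using insert.prems[of z] by blast
    ultimately show ?case using assms(3) by (intro exI[of _ "min r1 r2"]) (auto intro: assms(3)[of _ r1] assms(3)[of _ r2])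
  qed (auto intro: exI[of _ 1])
  thus ?thesis using that by blast
qed


text \<open>The picked order comes with a representation of that very order, and the estimates are
  drawn from it rather than from a given one.\<close>

lemma type_order_cases:
  assumes "(\<exists>\<alpha> \<mu>. pos_type \<phi> \<xi>0 \<alpha> \<mu>) \<or> (\<exists>\<alpha> \<mu>. imag_type \<phi> \<xi>0 \<alpha> \<mu>)"
  obtains \<alpha> where "pos_type \<phi> \<xi>0 \<alpha> (type_order \<phi> \<xi>0) \<or> imag_type \<phi> \<xi>0 \<alpha> (type_order \<phi> \<xi>0)"
proof -
  have "\<exists>\<mu>. \<exists>\<alpha>. pos_type \<phi> \<xi>0 \<alpha> \<mu> \<or> imag_type \<phi> \<xi>0 \<alpha> \<mu>" using assms by blast
  hence "\<exists>\<alpha>. pos_type \<phi> \<xi>0 \<alpha> (type_order \<phi> \<xi>0) \<or> imag_type \<phi> \<xi>0 \<alpha> (type_order \<phi> \<xi>0)"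
    unfolding type_order_def by (rule someI_ex)
  thus ?thesis using that by (elim exE)
qed

text \<open>The picked drift may belong to another representation, even one of positive type.
  \<open>local_form\<close> is common to both types and determines the drift.\<close>

lemma drift_eq:
  assumes sum: "(\<lambda>x. norm (\<phi> x)) summable_on UNIV" and one: "norm (fhat \<phi> \<xi>0) = 1"
    and type: "imag_type \<phi> \<xi>0 \<alpha> \<mu>"
  shows "drift \<phi> \<xi>0 = \<alpha>"
proof -
  have "\<exists>\<alpha>. \<exists>\<mu>. pos_type \<phi> \<xi>0 \<alpha> \<mu> \<or> imag_type \<phi> \<xi>0 \<alpha> \<mu>" using type by blast
  hence "\<exists>\<mu>. pos_type \<phi> \<xi>0 (drift \<phi> \<xi>0) \<mu> \<or> imag_type \<phi> \<xi>0 (drift \<phi> \<xi>0) \<mu>"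
    unfolding drift_def by (rule someI_ex)
  then obtain \<mu>' where "pos_type \<phi> \<xi>0 (drift \<phi> \<xi>0) \<mu>' \<or> imag_type \<phi> \<xi>0 (drift \<phi> \<xi>0) \<mu>'"
    by (elim exE)
  hence "local_form \<phi> \<xi>0 (drift \<phi> \<xi>0) \<mu>'"
    using pos_type_local_form[OF sum one] imag_type_local_form[OF sum one] by blast
  thus ?thesis by (rule local_form_drift_unique[OF one _ imag_type_local_form[OF sum one type]])
qed

text \<open>Even at a point of \<open>Omega_i\<close> the picked order may stem from a
  representation of positive type. Either case decays; the common drift and the order below 1 enter
  only when the representation is imaginary.\<close>

lemma Omega_point_upper_bound:
  assumes sum: "(\<lambda>x. norm (\<phi> x)) summable_on UNIV" and one: "norm (fhat \<phi> \<xi>0) = 1"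
    and type: "(\<exists>\<alpha> \<mu>. pos_type \<phi> \<xi>0 \<alpha> \<mu>) \<or> (\<exists>\<alpha> \<mu>. imag_type \<phi> \<xi>0 \<alpha> \<mu>)"
    and imag: "\<And>\<alpha>' \<mu>'. imag_type \<phi> \<xi>0 \<alpha>' \<mu>' \<Longrightarrow> type_order \<phi> \<xi>0 < 1 \<and> drift \<phi> \<xi>0 = \<alpha>"
    and \<mu>0: "\<mu>0 \<le> type_order \<phi> \<xi>0"
  shows "\<exists>a>0. local_decay \<phi> \<alpha> \<mu>0 \<xi>0 a"
proof -
  obtain \<alpha>1 where "pos_type \<phi> \<xi>0 \<alpha>1 (type_order \<phi> \<xi>0) \<or> imag_type \<phi> \<xi>0 \<alpha>1 (type_order \<phi> \<xi>0)"
    by (rule type_order_cases[OF type])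
  hence "\<exists>a>0. local_decay \<phi> \<alpha> (type_order \<phi> \<xi>0) \<xi>0 a"
  proof
    assume "pos_type \<phi> \<xi>0 \<alpha>1 (type_order \<phi> \<xi>0)"
    thus ?thesis by (intro exI[of _ 1] conjI pos_type_upper_bound[OF sum one]) auto
  next
    assume it: "imag_type \<phi> \<xi>0 \<alpha>1 (type_order \<phi> \<xi>0)"
    have \<alpha>1: "\<alpha>1 = \<alpha>" using drift_eq[OF sum one it] imag[OF it] by simp
    show ?thesis by (rule imag_type_upper_bound[OF sum one it[unfolded \<alpha>1] imag[OF it, THEN conjunct1]])
  qed
  then obtain a where "a > 0" "local_decay \<phi> \<alpha> (type_order \<phi> \<xi>0) \<xi>0 a" by (elim exE conjE) (rule that)
  thus ?thesis using local_decay_mono[OF _ order_refl \<mu>0] by (intro exI[of _ a] conjI)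
qed

section \<open>Assembling the local estimates\<close>

lemma finite_islimpt_free_inter:
  assumes "closed W" and "\<And>z. z \<in> W \<Longrightarrow> \<exists>r>0. \<forall>\<xi>. \<xi> \<noteq> 0 \<longrightarrow> norm \<xi> < r \<longrightarrow> z + \<xi> \<notin> W" and "compact (A :: 'a::real_normed_vector set)"
  shows "finite (A \<inter> W)"
proof (rule finite_not_islimpt_in_compact[OF assms(3)])
  fix z
  show "\<not> z islimpt W"
  proof
    assume lim: "z islimpt W"
    hence "z \<in> W" using assms(1) closed_limpt by blast
    then obtain r where r: "r > 0" "\<forall>\<xi>. \<xi> \<noteq> 0 \<longrightarrow> norm \<xi> < r \<longrightarrow> z + \<xi> \<notin> W"
      using assms(2)[OF \<open>z \<in> W\<close>] by (elim exE conjE) (rule that)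
    obtain y where "y \<in> W" "y \<noteq> z" "dist y z < r"
      using lim[unfolded islimpt_approachable, rule_format, OF r(1)] by (elim bexE conjE) (rule that)
    thus False using r(2)[rule_format, of "y - z"] by (simp add: dist_norm)
  qed
qed

lemma power_le_powr_minus:
  fixes q \<mu> :: real
  assumes q: "0 < q" "q < 1" and \<mu>: "\<mu> > 0"
  obtains C where "C > 0" "\<And>n. n \<ge> 1 \<Longrightarrow> q ^ n \<le> C * real n powr (- \<mu>)"
proof (rule that[of "(2 * \<mu>) powr \<mu> * (2 * (- ln q)) powr (- \<mu>)"])
  have l: "- ln q > 0" using q by simp
  show "(2 * \<mu>) powr \<mu> * (2 * (- ln q)) powr (- \<mu>) > 0" using \<mu> l by (intro mult_pos_pos) auto
  fix n :: nat assume n: "n \<ge> 1"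
  have "q ^ n = exp (real n * ln q)" using q by (simp add: exp_of_nat_mult)
  also have "\<dots> = exp (- (2 * (- ln q) * real n) / 2)" by simp
  also have "\<dots> \<le> (2 * \<mu>) powr \<mu> * (2 * (- ln q) * real n) powr (- \<mu>)"
    using l n \<mu> by (intro exp_neg_half_le_powr mult_pos_pos) auto
  also have "(2 * (- ln q) * real n) powr (- \<mu>) = (2 * (- ln q)) powr (- \<mu>) * real n powr (- \<mu>)"
    by (rule powr_mult)
  finally show "q ^ n \<le> (2 * \<mu>) powr \<mu> * (2 * (- ln q)) powr (- \<mu>) * real n powr (- \<mu>)" by (simp add: mult.assoc)
qed

lemma lborel_integral_translation:
  fixes f :: "'a::euclidean_space \<Rightarrow> complex"
  assumes [measurable]: "f \<in> borel_measurable borel"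
  shows "integral\<^sup>L lborel f = (\<integral>x. f (z + x) \<partial>lborel)"
  by (subst lborel_distr_plus[of z, symmetric]) (simp add: integral_distr)

lemma conv_pow_upper_bound:
  fixes \<phi> :: "int^'d::finite \<Rightarrow> complex"
  assumes sum: "(\<lambda>x. norm (\<phi> x)) summable_on UNIV" and le1: "\<And>\<xi>. norm (fhat \<phi> \<xi>) \<le> 1" and \<mu>: "\<mu> > 0"
    and isol: "\<And>z. norm (fhat \<phi> z) = 1 \<Longrightarrow> \<exists>r>0. \<forall>\<xi>. \<xi> \<noteq> 0 \<longrightarrow> norm \<xi> < r \<longrightarrow> norm (fhat \<phi> (z + \<xi>)) < 1"
    and local: "\<And>z. norm (fhat \<phi> z) = 1 \<Longrightarrow> \<exists>a>0. local_decay \<phi> \<alpha> \<mu> z a"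
  shows "\<exists>a>0. \<forall>\<rho>\<ge>0. \<exists>C>0. \<forall>n\<ge>1. \<forall>x. norm (zvec x - real n *\<^sub>R \<alpha>) \<le> \<rho> + real n powr a \<longrightarrow>
      norm (conv_pow \<phi> n x) \<le> C * real n powr (- \<mu>)"
proof -
  define W where "W = {\<xi>. norm (fhat \<phi> \<xi>) = 1}"
  have contf: "continuous_on UNIV (fhat \<phi>)" by (rule continuous_on_fhat[OF sum])
  have Wcl: "closed W" unfolding W_def by (intro closed_Collect_eq continuous_intros contf)
  have fin: "finite (A \<inter> W)" if "compact A" for A
  proof (rule finite_islimpt_free_inter[OF Wcl _ that])
    fix z assume "z \<in> W"
    hence "norm (fhat \<phi> z) = 1" by (simp add: W_def)
    from isol[OF this] obtain r where "r > 0" "\<forall>\<xi>. \<xi> \<noteq> 0 \<longrightarrow> norm \<xi> < r \<longrightarrow> norm (fhat \<phi> (z + \<xi>)) < 1"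
      by (elim exE conjE) (rule that)
    thus "\<exists>r>0. \<forall>\<xi>. \<xi> \<noteq> 0 \<longrightarrow> norm \<xi> < r \<longrightarrow> z + \<xi> \<notin> W" unfolding W_def by (intro exI[of _ r]) auto
  qed
  have "W = (\<Union>n::nat. cball 0 (real n) \<inter> W)"
    using real_arch_simple by auto
  moreover have "countable (\<Union>n::nat. cball 0 (real n) \<inter> W)"
    by (intro countable_UN countableI_type countable_finite fin) auto
  ultimately have "countable W" by simp
  \<comment> \<open>Isolated points are finite in number on compact sets, hence countable
    altogether, so some real c0 is a coordinate of none of them.\<close>
  hence "countable (\<Union>j. (\<lambda>\<xi>. \<xi> $ j) ` W)"
    by (intro countable_UN countable_image) auto
  then obtain c0 where c0: "c0 \<notin> (\<Union>j. (\<lambda>\<xi>. \<xi> $ j) ` W)"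
    using uncountable_UNIV_real by (metis UNIV_eq_I)
  have c0': "z $ j \<noteq> c0" if "z \<in> W" for z j using c0 that by auto
  let ?D = "period_box c0 :: (real^'d) set"
  define Z where "Z = ?D \<inter> W"
  have Zfin: "finite Z" unfolding Z_def by (rule fin) simp
  have Z1: "norm (fhat \<phi> z) = 1" if "z \<in> Z" for z using that by (simp add: Z_def W_def)
  have inner: "\<exists>r>0. ball z r \<subseteq> ?D \<and> (\<forall>z'\<in>Z. z' \<noteq> z \<longrightarrow> 2 * r \<le> dist z z')" if z: "z \<in> Z" for z
  proof -
    \<comment> \<open>A point on an upper face would have a periodic copy on the opposite lower
      face, which c0 excludes.\<close>
    have "z $ j \<noteq> c0 + 2 * pi" for j
    proof
      assume eq: "z $ j = c0 + 2 * pi"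
      let ?m = "axis j (- 1) :: int^'d"
      have "z + (2 * pi) *\<^sub>R zvec ?m \<in> W" using z fhat_periodic[of \<phi> z ?m] by (simp add: Z_def W_def)
      moreover have "(z + (2 * pi) *\<^sub>R zvec ?m) $ j = c0" by (simp add: zvec_def eq)
      ultimately show False using c0' by blast
    qed
    moreover have "z $ j \<noteq> c0" for j using c0' z by (simp add: Z_def)
    moreover have "c0 \<le> z $ j \<and> z $ j \<le> c0 + 2 * pi" for j using z by (simp add: Z_def period_box_def)
    ultimately have "c0 < z $ j \<and> z $ j < c0 + 2 * pi" for j by (metis order_le_less)
    hence zb: "z \<in> box (\<chi> _. c0) (\<chi> _. c0 + 2 * pi)" by (simp add: mem_box_cart)
    obtain r1 where r1: "r1 > 0" "ball z r1 \<subseteq> box (\<chi> _. c0) (\<chi> _. c0 + 2 * pi)"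
      using open_box[unfolded open_contains_ball, rule_format, OF zb] by (elim exE conjE) (rule that)
    obtain d where d: "d > 0" "\<And>x. x \<in> Z \<Longrightarrow> x \<noteq> z \<Longrightarrow> d \<le> dist z x"
      using finite_set_avoid[OF Zfin, of z] by auto
    have "ball z (min r1 (d / 2)) \<subseteq> ?D"
      using r1(2) box_subset_cbox unfolding period_box_cbox by force
    thus ?thesis using r1(1) d by (intro exI[of _ "min r1 (d / 2)"]) force
  qed
  obtain r where r: "r > 0" "\<And>z. z \<in> Z \<Longrightarrow> ball z r \<subseteq> ?D \<and> (\<forall>z'\<in>Z. z' \<noteq> z \<longrightarrow> 2 * r \<le> dist z z')"
    by (rule finite_common_bound[OF Zfin inner]) (assumption, force, blast)
  \<comment> \<open>Lowering the rate weakens \<open>local_decay\<close>, so the least of finitely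
    many rates works; it is fixed before \<rho>.\<close>
  obtain a where a: "a > 0" "\<And>z. z \<in> Z \<Longrightarrow> local_decay \<phi> \<alpha> \<mu> z a"
    by (rule finite_common_bound[OF Zfin, of "local_decay \<phi> \<alpha> \<mu>"])
       (erule local[OF Z1], erule local_decay_mono[OF _ _ order_refl], assumption, blast)
  show ?thesis
  proof (rule exI[of _ a], rule conjI, rule a(1), intro allI impI)
    fix \<rho> :: real assume \<rho>: "\<rho> \<ge> 0"
    have "\<forall>z\<in>Z. \<exists>U C. open U \<and> 0 \<in> U \<and> U \<subseteq> ball 0 r \<and> C > 0 \<and> (\<forall>n\<ge>1. \<forall>x.
      norm (zvec x - real n *\<^sub>R \<alpha>) \<le> \<rho> + real n powr a \<longrightarrow>
      norm (\<integral>\<xi>. indicator U \<xi> *\<^sub>R (fhat \<phi> (z + \<xi>) ^ n * cis (- (zvec x \<bullet> \<xi>))) \<partial>lborel) \<le> C * real n powr (- \<mu>))"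
      using a(2) r(1) \<rho> unfolding local_decay_def by simp
    from bchoice[OF this] obtain U where U0: "\<forall>z\<in>Z. \<exists>C. open (U z) \<and> 0 \<in> U z \<and> U z \<subseteq> ball 0 r \<and> C > 0 \<and> (\<forall>n\<ge>1. \<forall>x.
      norm (zvec x - real n *\<^sub>R \<alpha>) \<le> \<rho> + real n powr a \<longrightarrow>
      norm (\<integral>\<xi>. indicator (U z) \<xi> *\<^sub>R (fhat \<phi> (z + \<xi>) ^ n * cis (- (zvec x \<bullet> \<xi>))) \<partial>lborel) \<le> C * real n powr (- \<mu>))" ..
    from bchoice[OF this] obtain Cz where U1: "\<forall>z\<in>Z. open (U z) \<and> 0 \<in> U z \<and> U z \<subseteq> ball 0 r \<and> Cz z > 0 \<and> (\<forall>n\<ge>1. \<forall>x.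
      norm (zvec x - real n *\<^sub>R \<alpha>) \<le> \<rho> + real n powr a \<longrightarrow>
      norm (\<integral>\<xi>. indicator (U z) \<xi> *\<^sub>R (fhat \<phi> (z + \<xi>) ^ n * cis (- (zvec x \<bullet> \<xi>))) \<partial>lborel) \<le> Cz z * real n powr (- \<mu>))" ..
    have U: "open (U z)" "0 \<in> U z" "U z \<subseteq> ball 0 r" "Cz z > 0" if "z \<in> Z" for z
      using U1[rule_format, OF that] by simp_all
    have Ub: "norm (\<integral>\<xi>. indicator (U z) \<xi> *\<^sub>R (fhat \<phi> (z + \<xi>) ^ n * cis (- (zvec x \<bullet> \<xi>))) \<partial>lborel) \<le> Cz z * real n powr (- \<mu>)"
      if "z \<in> Z" "n \<ge> 1" "norm (zvec x - real n *\<^sub>R \<alpha>) \<le> \<rho> + real n powr a" for z n x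
      by (rule U1[rule_format, OF that(1), THEN conjunct2, THEN conjunct2, THEN conjunct2, THEN conjunct2, rule_format, OF that(2,3)])
    define V where "V = (\<lambda>z. (+) z ` U z)"
    have Vopen: "open (V z)" if "z \<in> Z" for z unfolding V_def by (rule open_translation[OF U(1)[OF that]])
    have Vball: "V z \<subseteq> ball z r" if "z \<in> Z" for z
    proof
      fix y assume "y \<in> V z"
      then obtain \<xi> where "\<xi> \<in> U z" "y = z + \<xi>" by (auto simp: V_def)
      moreover have "\<xi> \<in> ball 0 r" using U(3)[OF that] \<open>\<xi> \<in> U z\<close> by blast
      ultimately show "y \<in> ball z r" by (simp add: dist_norm)
    qed
    have Vdisj: "disjoint_family_on V Z"
      unfolding disjoint_family_on_def
    proof (intro ballI impI)
      fix z z' assume zz: "z \<in> Z" "z' \<in> Z" "z \<noteq> z'"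
      have "2 * r \<le> dist z z'" using r(2)[OF zz(1)] zz by metis
      hence "ball z r \<inter> ball z' r = {}" by (intro disjoint_ballI) simp
      thus "V z \<inter> V z' = {}" using Vball[OF zz(1)] Vball[OF zz(2)] by blast
    qed
    define Y where "Y = ?D - (\<Union>z\<in>Z. V z)"
    have VD: "(\<Union>z\<in>Z. V z) \<subseteq> ?D" using Vball r(2) by blast
    have Ycpt: "compact Y" unfolding Y_def by (intro compact_diff period_box_props open_UN ballI Vopen)
    have Ylt: "norm (fhat \<phi> \<xi>) < 1" if "\<xi> \<in> Y" for \<xi>
    proof (rule ccontr)
      assume "\<not> norm (fhat \<phi> \<xi>) < 1"
      hence "\<xi> \<in> Z" using le1[of \<xi>] that by (simp add: Z_def W_def Y_def)
      moreover from this have "\<xi> \<in> V \<xi>" unfolding V_def using U(2) by (force simp: image_iff)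
      ultimately show False using that by (auto simp: Y_def)
    qed
    have "\<exists>q. 0 < q \<and> q < 1 \<and> (\<forall>\<xi>\<in>Y. norm (fhat \<phi> \<xi>) \<le> q)"
    proof (cases "Y = {}")
      case False
      have "continuous_on Y (\<lambda>\<xi>. norm (fhat \<phi> \<xi>))" by (intro continuous_intros continuous_on_subset[OF contf]) auto
      from continuous_attains_sup[OF Ycpt False this] obtain \<xi>1 where "\<xi>1 \<in> Y" "\<forall>\<xi>\<in>Y. norm (fhat \<phi> \<xi>) \<le> norm (fhat \<phi> \<xi>1)" by blast
      \<comment> \<open>The maximum with 1/2 keeps q positive, as the comparison of q^n with a power
        of n uses ln q.\<close>
      thus ?thesis using Ylt[of \<xi>1] by (intro exI[of _ "max (1 / 2) (norm (fhat \<phi> \<xi>1))"]) (auto simp: le_max_iff_disj)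
    qed (auto intro: exI[of _ "1 / 2"])
    then obtain q where q: "0 < q" "q < 1" "\<forall>\<xi>\<in>Y. norm (fhat \<phi> \<xi>) \<le> q" by blast
    obtain Cq where Cq: "Cq > 0" "\<And>n. n \<ge> 1 \<Longrightarrow> q ^ n \<le> Cq * real n powr (- \<mu>)"
      by (rule power_le_powr_minus[OF q(1,2) \<mu>]) blast
    define L :: real where "L = (2 * pi) ^ CARD('d)"
    have L: "L > 0" by (simp add: L_def)
    define C where "C = ((\<Sum>z\<in>Z. Cz z) + Cq * measure lborel Y + 1) / L"
    have Cpos: "C > 0"
      unfolding C_def using L U(4) Cq(1) by (intro divide_pos_pos add_nonneg_pos add_nonneg_nonneg sum_nonneg mult_nonneg_nonneg) (auto simp: less_imp_le)
    have "norm (conv_pow \<phi> n x) \<le> C * real n powr (- \<mu>)"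
      if n: "n \<ge> 1" and x: "norm (zvec x - real n *\<^sub>R \<alpha>) \<le> \<rho> + real n powr a" for n x
    proof -
      define g where "g = (\<lambda>\<xi>. fhat \<phi> \<xi> ^ n * cis (- (zvec x \<bullet> \<xi>)))"
      have gm: "g \<in> borel_measurable borel"
        unfolding g_def by (intro borel_measurable_continuous_onI continuous_intros contf)
      have g1: "norm (g \<xi>) \<le> 1" for \<xi> using le1[of \<xi>] by (simp add: g_def norm_mult norm_power power_le_one)
      have Vm: "V z \<in> sets borel" "emeasure lborel (V z) < \<infinity>" if "z \<in> Z" for z
        using Vopen[OF that] emeasure_bounded_finite[OF bounded_subset[OF bounded_ball Vball[OF that]]] by auto
      have Ym: "Y \<in> sets borel" "emeasure lborel Y < \<infinity>"
        using borel_compact[OF Ycpt] emeasure_bounded_finite[OF compact_imp_bounded[OF Ycpt]] by auto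
      have gint: "integrable lborel (\<lambda>\<xi>. indicator (V z) \<xi> *\<^sub>R g \<xi>)" if "z \<in> Z" for z
        by (rule integrable_indicator_bounded[OF Vm[OF that] gm g1])
      have gintY: "integrable lborel (\<lambda>\<xi>. indicator Y \<xi> *\<^sub>R g \<xi>)"
        by (rule integrable_indicator_bounded[OF Ym gm g1])
      have ind: "indicator ?D \<xi> = (\<Sum>z\<in>Z. indicator (V z) \<xi>) + (indicator Y \<xi> :: real)" for \<xi>
      proof -
        have "indicator (\<Union>z\<in>Z. V z) \<xi> = (\<Sum>z\<in>Z. indicator (V z) \<xi> :: real)"
          by (rule indicator_UN_disjoint[OF Zfin Vdisj])
        moreover have "indicator ?D \<xi> = indicator (\<Union>z\<in>Z. V z) \<xi> + (indicator Y \<xi> :: real)"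
          using VD by (auto simp: Y_def indicator_def)
        ultimately show ?thesis by simp
      qed
      have transl: "(\<integral>\<xi>. indicator (V z) \<xi> *\<^sub>R g \<xi> \<partial>lborel) =
         cis (- (zvec x \<bullet> z)) * (\<integral>\<xi>. indicator (U z) \<xi> *\<^sub>R (fhat \<phi> (z + \<xi>) ^ n * cis (- (zvec x \<bullet> \<xi>))) \<partial>lborel)" if "z \<in> Z" for z
      proof -
        have "(\<lambda>\<xi>. indicator (V z) \<xi> *\<^sub>R g \<xi>) \<in> borel_measurable borel"
          using gint[OF that] by auto
        from lborel_integral_translation[OF this, of z]
        have "(\<integral>\<xi>. indicator (V z) \<xi> *\<^sub>R g \<xi> \<partial>lborel) = (\<integral>\<xi>. indicator (V z) (z + \<xi>) *\<^sub>R g (z + \<xi>) \<partial>lborel)" .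
        also have "\<dots> = (\<integral>\<xi>. cis (- (zvec x \<bullet> z)) * (indicator (U z) \<xi> *\<^sub>R (fhat \<phi> (z + \<xi>) ^ n * cis (- (zvec x \<bullet> \<xi>)))) \<partial>lborel)"
        proof (intro Bochner_Integration.integral_cong refl)
          fix \<xi>
          have "indicator (V z) (z + \<xi>) = (indicator (U z) \<xi> :: real)" by (auto simp: V_def indicator_def)
          moreover have "g (z + \<xi>) = cis (- (zvec x \<bullet> z)) * (fhat \<phi> (z + \<xi>) ^ n * cis (- (zvec x \<bullet> \<xi>)))"
          proof -
            have "cis (- (zvec x \<bullet> (z + \<xi>))) = cis (- (zvec x \<bullet> z)) * cis (- (zvec x \<bullet> \<xi>))"
              unfolding cis_mult by (simp add: inner_add_right)
            thus ?thesis by (simp add: g_def mult_ac)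
          qed
          ultimately show "indicator (V z) (z + \<xi>) *\<^sub>R g (z + \<xi>) =
            cis (- (zvec x \<bullet> z)) * (indicator (U z) \<xi> *\<^sub>R (fhat \<phi> (z + \<xi>) ^ n * cis (- (zvec x \<bullet> \<xi>))))" by simp
        qed
        also have "\<dots> = cis (- (zvec x \<bullet> z)) * (\<integral>\<xi>. indicator (U z) \<xi> *\<^sub>R (fhat \<phi> (z + \<xi>) ^ n * cis (- (zvec x \<bullet> \<xi>))) \<partial>lborel)"
          by (rule integral_mult_right_zero)
        finally show ?thesis .
      qed
      have "of_real L * conv_pow \<phi> n x = (\<integral>\<xi>. indicator ?D \<xi> *\<^sub>R g \<xi> \<partial>lborel)"
        using fourier_inversion[OF conv_pow_summable_fhat(1)[OF sum, of n], of c0 x]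
        unfolding conv_pow_summable_fhat(2)[OF sum] by (simp add: g_def L_def)
      also have "\<dots> = (\<integral>\<xi>. (\<Sum>z\<in>Z. indicator (V z) \<xi> *\<^sub>R g \<xi>) + indicator Y \<xi> *\<^sub>R g \<xi> \<partial>lborel)"
        unfolding ind scaleR_add_left scaleR_sum_left ..
      also have "\<dots> = (\<Sum>z\<in>Z. \<integral>\<xi>. indicator (V z) \<xi> *\<^sub>R g \<xi> \<partial>lborel) + (\<integral>\<xi>. indicator Y \<xi> *\<^sub>R g \<xi> \<partial>lborel)"
        using gint gintY by (simp add: Bochner_Integration.integral_add Bochner_Integration.integral_sum Bochner_Integration.integrable_sum)
      also have "norm \<dots> \<le> (\<Sum>z\<in>Z. Cz z * real n powr (- \<mu>)) + q ^ n * measure lborel Y"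
      proof (intro order_trans[OF norm_triangle_ineq] add_mono sum_norm_le)
        show "norm (\<integral>\<xi>. indicator (V z) \<xi> *\<^sub>R g \<xi> \<partial>lborel) \<le> Cz z * real n powr (- \<mu>)" if "z \<in> Z" for z
          unfolding transl[OF that] using Ub[OF that n x] by (simp add: norm_mult)
        show "norm (\<integral>\<xi>. indicator Y \<xi> *\<^sub>R g \<xi> \<partial>lborel) \<le> q ^ n * measure lborel Y"
          by (rule norm_integral_indicator_le[OF Ym gm])
             (use q(3) in \<open>auto simp: g_def norm_mult norm_power intro!: power_mono\<close>)
      qed
      also have "\<dots> \<le> (\<Sum>z\<in>Z. Cz z) * real n powr (- \<mu>) + (Cq * real n powr (- \<mu>)) * measure lborel Y"
        unfolding sum_distrib_right[symmetric] using Cq(2)[OF n] by (intro add_mono mult_right_mono) auto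
      also have "\<dots> \<le> (C * L) * real n powr (- \<mu>)"
      proof -
        have "C * L = (\<Sum>z\<in>Z. Cz z) + Cq * measure lborel Y + 1" using L by (simp add: C_def)
        thus ?thesis by (simp add: algebra_simps)
      qed
      finally have "L * norm (conv_pow \<phi> n x) \<le> L * (C * real n powr (- \<mu>))"
        using L by (simp add: norm_mult mult_ac)
      thus ?thesis using L by simp
    qed
    thus "\<exists>C>0. \<forall>n\<ge>1. \<forall>x. norm (zvec x - real n *\<^sub>R \<alpha>) \<le> \<rho> + real n powr a \<longrightarrow>
      norm (conv_pow \<phi> n x) \<le> C * real n powr (- \<mu>)"
      by (intro exI[of _ C] conjI Cpos allI impI)
  qed
qed


section \<open>The lower bound and the theorem\<close>

text \<open>1/4 is below pi/6, so the cosine is at least sqrt 3 / 2 \<ge> 2/3, and the exponential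
  is at least 3/4; their product is 1/2.\<close>

lemma exp_neg_cos_ge_half:
  fixes x y :: real
  assumes "\<bar>x\<bar> \<le> 1 / 4" "y \<le> 1 / 4"
  shows "1 / 2 \<le> exp (- y) * cos x"
proof -
  have "cos (pi / 6) \<le> cos \<bar>x\<bar>" using assms(1) pi_gt3 by (intro cos_monotone_0_pi_le) auto
  moreover have "4 / 3 \<le> sqrt 3" by (rule real_le_rsqrt) (simp add: power2_eq_square)
  ultimately have "2 / 3 \<le> cos x" by (simp add: cos_30)
  moreover have "3 / 4 \<le> exp (- y)" using exp_ge_add_one_self[of "- y"] assms(2) by linarith
  ultimately have "3 / 4 * (2 / 3) \<le> exp (- y) * cos x" by (intro mult_mono) auto
  thus ?thesis by simp
qed

text \<open>A real \<open>SUP\<close> bounds its members only when the family is bounded above,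
  which summability ensures.\<close>

lemma conv_pow_sup:
  fixes \<phi> :: "int^'d::finite \<Rightarrow> complex"
  assumes sum: "(\<lambda>x. norm (\<phi> x)) summable_on UNIV"
  shows "norm (conv_pow \<phi> n x) \<le> (SUP x. norm (conv_pow \<phi> n x))"
proof (rule cSUP_upper)
  have "norm (conv_pow \<phi> n y) \<le> (\<Sum>\<^sub>\<infinity>x. norm (conv_pow \<phi> n x))" for y
    using finite_sum_le_infsum[OF conv_pow_summable_fhat(1)[OF sum, of n], of "{y}"] by simp
  thus "bdd_above (range (\<lambda>x. norm (conv_pow \<phi> n x)))" by (rule bdd_aboveI2)
qed simp

lemma conv_pow_lower_bound:
  fixes \<phi> :: "int^'d::finite \<Rightarrow> complex"
  assumes sum: "(\<lambda>x. norm (\<phi> x)) summable_on UNIV" and one: "norm (fhat \<phi> \<xi>0) = 1"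
    and lf: "local_form \<phi> \<xi>0 \<alpha> \<mu>"
  shows "\<exists>C>0. \<forall>n\<ge>1. C * real n powr (- \<mu>) \<le> (SUP x. norm (conv_pow \<phi> n x))"
proof -
  obtain P E u v r c where A: "homogeneous_gauge P E" "\<mu> = trace E" "0 < r" "0 < c"
    "\<forall>\<xi>. norm \<xi> < r \<longrightarrow> fhat \<phi> (\<xi>0 + \<xi>) = fhat \<phi> \<xi>0 * (exp (- v \<xi>) *\<^sub>R cis (\<alpha> \<bullet> \<xi> - u \<xi>))"
    "\<forall>\<xi>. norm \<xi> < r \<longrightarrow> \<bar>u \<xi>\<bar> \<le> c * P \<xi> \<and> 0 \<le> v \<xi> \<and> (\<xi> \<noteq> 0 \<longrightarrow> 0 < v \<xi>) \<and> v \<xi> \<le> c * P \<xi>"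
    using lf unfolding local_form_def by (elim exE conjE) (rule that)
  interpret G: homogeneous_gauge P E by (rule A(1))
  obtain C0 a where C0: "C0 > 0" "a > 0" "\<And>s x. s \<le> 0 \<Longrightarrow> norm (mexp (s *\<^sub>R E) *v x) \<le> C0 * exp (a * s) * norm x"
    by (rule contracting_decay[OF G.contr]) blast
  \<comment> \<open>Chosen so that c P \<le> 1/4 on the sublevel set, the tolerance allowed for both
    phase and damping.\<close>
  define \<kappa> where "\<kappa> = 1 / (4 * c)"
  have \<kappa>: "\<kappa> > 0" "c * \<kappa> = 1 / 4" using A(4) by (auto simp: \<kappa>_def)
  have "open {\<xi>. P \<xi> < \<kappa>}" using G.cont by (intro open_Collect_less continuous_intros) auto
  moreover have "0 \<in> {\<xi>. P \<xi> < \<kappa>}" using G.zero_iff[of 0] \<kappa> by simp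
  ultimately obtain b0 where b0: "b0 > 0" "ball 0 b0 \<subseteq> {\<xi>. P \<xi> < \<kappa>}" unfolding open_contains_ball by blast
  \<comment> \<open>b < b0 keeps P below \<kappa>. After the dilation, which enlarges norms by at
    most C0, the entry r keeps differences where the local form holds, and 3 keeps S inside the
    period box, as 3/2 < pi.\<close>
  define b where "b = min (b0 / 2) (min r 3 / (2 * C0))"
  have b: "b > 0" "b < b0" using b0 A(3) C0(1) by (auto simp: b_def)
  have C0b: "C0 * b \<le> r / 2" "C0 * b \<le> 3 / 2"
  proof -
    have "C0 * b \<le> C0 * (min r 3 / (2 * C0))" using C0(1) by (intro mult_left_mono) (auto simp: b_def)
    also have "\<dots> = min r 3 / 2" using C0(1) by simp
    finally show "C0 * b \<le> r / 2" "C0 * b \<le> 3 / 2" by auto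
  qed
  have Pw: "P w < \<kappa>" if "norm w \<le> b" for w using that b(2) b0(2) by (auto simp: subset_iff)
  define m0 where "m0 = measure lborel (cball (0 :: real^'d) (b / 2))"
  have m0: "m0 > 0" unfolding m0_def using b(1) by (simp add: content_cball_pos)
  define L :: real where "L = (2 * pi) ^ CARD('d)"
  have L: "L > 0" by (simp add: L_def)
  have "m0 / (4 * L) * real n powr (- \<mu>) \<le> (SUP x. norm (conv_pow \<phi> n x))" if n: "n \<ge> 1" for n
  proof -
    define X where "X = mexp ((- ln (real n)) *\<^sub>R E)"
    have lnn: "- ln (real n) \<le> 0" using n by simp
    have XC: "norm (X *v w) \<le> C0 * norm w" for w
    proof -
      have "norm (X *v w) \<le> C0 * exp (a * (- ln (real n))) * norm w" unfolding X_def by (rule C0(3)[OF lnn])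
      also have "\<dots> \<le> C0 * 1 * norm w"
        using C0 lnn by (intro mult_right_mono mult_left_mono) (auto simp: mult_nonneg_nonpos)
      finally show ?thesis by simp
    qed
    have PX: "real n * P (X *v w) = P w" for w
      unfolding X_def G.flow using n by (simp add: exp_minus)
    \<comment> \<open>Half the radius, because the pairing evaluates the transform at differences of
      two points of S.\<close>
    define S where "S = (*v) X ` cball 0 (b / 2)"
    have det: "det X = real n powr (- \<mu>)" unfolding X_def det_mexp using n A(2) by (simp add: powr_def mult.commute)
    have detnz: "det X \<noteq> 0" unfolding X_def det_mexp by simp
    have Sm: "S \<in> sets borel" "measure lborel S = real n powr (- \<mu>) * m0"
      using measure_lborel_matrix_image[OF detnz, of "cball 0 (b / 2)"] by (simp_all add: S_def m0_def det)
    have Sbox: "S \<subseteq> period_box (- pi)"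
    proof
      fix y assume "y \<in> S"
      then obtain w where w: "norm w \<le> b / 2" "y = X *v w" by (auto simp: S_def)
      have "norm y \<le> C0 * norm w" using XC w by simp
      also have "\<dots> \<le> C0 * b" using w(1) C0(1) b(1) by (intro mult_left_mono) auto
      finally have "norm y \<le> 3 / 2" using C0b(2) by linarith
      hence "\<bar>y $ j\<bar> \<le> 3 / 2" for j using component_le_norm_cart[of y j] by linarith
      hence "- pi \<le> y $ j \<and> y $ j \<le> pi" for j
      proof -
        have "\<bar>y $ j\<bar> \<le> 3 / 2" by fact
        thus ?thesis using pi_gt3 by linarith
      qed
      thus "y \<in> period_box (- pi)" by (simp add: period_box_def)
    qed
    \<comment> \<open>The conjugate power cancels the phase at \<open>\<xi>0\<close> and the centre
      n \<alpha> cancels the drift. What remains is n u and n v, both at most n c P(X w) = c P(w) by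
      homogeneity.\<close>
    have Re_ge: "1 / 2 \<le> Re (cnj (fhat \<phi> \<xi>0) ^ n * fhat (conv_pow \<phi> n) (\<xi>0 + (\<eta> - \<zeta>)) * cis (- ((real n *\<^sub>R \<alpha>) \<bullet> (\<eta> - \<zeta>))))"
      if mem: "\<eta> \<in> S" "\<zeta> \<in> S" for \<eta> \<zeta>
    proof -
      obtain w1 w2 where w12: "norm w1 \<le> b / 2" "norm w2 \<le> b / 2" "\<eta> = X *v w1" "\<zeta> = X *v w2"
        using mem by (auto simp: S_def)
      define w where "w = w1 - w2"
      have w: "norm w \<le> b" using norm_triangle_ineq4[of w1 w2] w12(1,2) by (simp add: w_def)
      define \<xi> where "\<xi> = X *v w"
      have \<xi>: "\<eta> - \<zeta> = \<xi>" unfolding w12 \<xi>_def w_def by (simp add: matrix_vector_mult_diff_distrib)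
      have "norm \<xi> \<le> C0 * norm w" unfolding \<xi>_def by (rule XC)
      also have "\<dots> \<le> C0 * b" using w C0(1) by (intro mult_left_mono) auto
      finally have nr: "norm \<xi> < r" using C0b(1) A(3) by linarith
      have uv: "\<bar>u \<xi>\<bar> \<le> c * P \<xi>" "v \<xi> \<le> c * P \<xi>" using A(6)[rule_format, OF nr] by auto
      have "real n * (c * P \<xi>) = c * P w" using PX[of w] by (simp add: \<xi>_def mult.left_commute)
      also have "\<dots> \<le> c * \<kappa>" using Pw[OF w] A(4) by (intro mult_left_mono) auto
      finally have nc: "real n * (c * P \<xi>) \<le> 1 / 4" using \<kappa>(2) by simp
      have nu: "\<bar>real n * u \<xi>\<bar> \<le> 1 / 4"
        using mult_left_mono[OF uv(1), of "real n"] nc by (simp add: abs_mult)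
      have nv: "real n * v \<xi> \<le> 1 / 4"
        using mult_left_mono[OF uv(2), of "real n"] nc by simp
      have "cnj (fhat \<phi> \<xi>0) ^ n * fhat \<phi> \<xi>0 ^ n = 1"
      proof -
        have "fhat \<phi> \<xi>0 * cnj (fhat \<phi> \<xi>0) = 1" using one complex_norm_square[of "fhat \<phi> \<xi>0"] by simp
        thus ?thesis by (metis mult.commute power_mult_distrib power_one)
      qed
      hence "cnj (fhat \<phi> \<xi>0) ^ n * fhat \<phi> (\<xi>0 + \<xi>) ^ n = exp (- v \<xi>) ^ n *\<^sub>R cis (real n * (\<alpha> \<bullet> \<xi> - u \<xi>))"
        unfolding A(5)[rule_format, OF nr] power_mult_distrib cis_scaleR_power by (simp flip: mult.assoc)
      hence "cnj (fhat \<phi> \<xi>0) ^ n * fhat (conv_pow \<phi> n) (\<xi>0 + \<xi>) * cis (- ((real n *\<^sub>R \<alpha>) \<bullet> \<xi>))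
          = exp (- v \<xi>) ^ n *\<^sub>R (cis (real n * (\<alpha> \<bullet> \<xi> - u \<xi>)) * cis (- ((real n *\<^sub>R \<alpha>) \<bullet> \<xi>)))"
        unfolding conv_pow_summable_fhat(2)[OF sum] by simp
      also have "cis (real n * (\<alpha> \<bullet> \<xi> - u \<xi>)) * cis (- ((real n *\<^sub>R \<alpha>) \<bullet> \<xi>)) = cis (- (real n * u \<xi>))"
        unfolding cis_mult by (rule arg_cong[of _ _ cis]) (simp add: algebra_simps)
      also have "exp (- v \<xi>) ^ n = exp (- (real n * v \<xi>))" unfolding exp_of_nat_mult[symmetric] by simp
      finally show ?thesis
        unfolding \<xi> using exp_neg_cos_ge_half[OF nu nv] by simp
    qed
    have "norm (cnj (fhat \<phi> \<xi>0) ^ n) = 1" by (simp add: norm_power one)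
    from measure_le_sup_coefficients[OF conv_pow_summable_fhat(1)[OF sum] Sm(1) Sbox conv_pow_sup[OF sum] this Re_ge]
    have "measure lborel S \<le> 4 * (2 * pi) ^ CARD('d) * (SUP x. norm (conv_pow \<phi> n x))" .
    thus ?thesis unfolding Sm(2) L_def[symmetric] using L by (simp add: field_simps)
  qed
  moreover have "m0 / (4 * L) > 0" using m0 L by simp
  ultimately show ?thesis by (intro exI[of _ "m0 / (4 * L)"] conjI allI impI)
qed

theorem mainTheorem14:
  fixes \<phi> :: "int^'d::finite \<Rightarrow> complex" and \<alpha> :: "real^'d"
  assumes Sd: "in_Sd \<phi>"
    and sup1: "(SUP \<xi>. norm (fhat \<phi> \<xi>)) = 1"
    and types: "\<forall>\<xi>\<in>Omega \<phi>. (\<exists>\<alpha>' \<mu>. pos_type \<phi> \<xi> \<alpha>' \<mu>) \<or> (\<exists>\<alpha>' \<mu>. imag_type \<phi> \<xi> \<alpha>' \<mu>)"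
    and Oi_ne: "Omega_i \<phi> \<noteq> {}"
    and hyp_i: "\<forall>\<xi>\<in>Omega_i \<phi>. type_order \<phi> \<xi> < 1"
    and hyp_ii: "\<exists>\<xi>\<in>Omega_i \<phi>. type_order \<phi> \<xi> = mu_phi \<phi>"
    and hyp_iii: "\<forall>\<xi>\<in>Omega_i \<phi>. drift \<phi> \<xi> = \<alpha>"
  shows "(\<forall>K::(real^'d) set. compact K \<longrightarrow>
            (\<exists>C'>0. \<exists>Kn :: nat \<Rightarrow> (real^'d) set.
               (\<forall>n. compact (Kn n) \<and> K \<subseteq> Kn n \<and> Kn n \<subseteq> Kn (Suc n)) \<and>
               (\<Union>n. Kn n) = UNIV \<and>
               (\<forall>n\<ge>1. \<forall>x::int^'d. zvec x - real n *\<^sub>R \<alpha> \<in> Kn n \<longrightarrow>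
                   norm (conv_pow \<phi> n x) \<le> C' * real n powr (- mu_phi \<phi>))))
       \<and> (\<exists>C>0. \<forall>n\<ge>1. C * real n powr (- mu_phi \<phi>) \<le> (SUP x. norm (conv_pow \<phi> n x)))"
proof -
  have sum: "(\<lambda>x. norm (\<phi> x)) summable_on UNIV" by (rule in_Sd_summable[OF Sd])
  have "bdd_above (range (\<lambda>\<xi>. norm (fhat \<phi> \<xi>)))" by (rule bdd_aboveI2[OF norm_fhat_le[OF sum]])
  hence le1: "norm (fhat \<phi> \<xi>) \<le> 1" for \<xi> using cSUP_upper[of \<xi> UNIV "\<lambda>\<xi>. norm (fhat \<phi> \<xi>)"] sup1 by simp
  have one: "norm (fhat \<phi> \<xi>) = 1" if "\<xi> \<in> Omega \<phi>" for \<xi> using that by (simp add: Omega_def)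
  have lf: "\<exists>\<alpha>'. local_form \<phi> \<xi> \<alpha>' (type_order \<phi> \<xi>)" if \<xi>: "\<xi> \<in> Omega \<phi>" for \<xi>
  proof -
    obtain \<alpha>' where "pos_type \<phi> \<xi> \<alpha>' (type_order \<phi> \<xi>) \<or> imag_type \<phi> \<xi> \<alpha>' (type_order \<phi> \<xi>)"
      by (rule type_order_cases[OF types[rule_format, OF \<xi>]])
    thus ?thesis
      using pos_type_local_form[OF sum one[OF \<xi>]] imag_type_local_form[OF sum one[OF \<xi>]] by (intro exI[of _ \<alpha>']) auto
  qed
  have tpos: "0 < type_order \<phi> \<xi>" if "\<xi> \<in> Omega \<phi>" for \<xi> using lf[OF that] by (elim exE) (rule local_form_order_pos)
  \<comment> \<open>\<open>mu_phi\<close> is a real infimum and lies below its members only because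
    the orders are bounded below, here by 0.\<close>
  have mu_le: "mu_phi \<phi> \<le> type_order \<phi> \<xi>" if "\<xi> \<in> Omega \<phi>" for \<xi>
    unfolding mu_phi_def using that tpos by (intro cInf_lower bdd_belowI[of _ 0]) (auto simp: less_imp_le)
  obtain \<xi>1 where \<xi>1: "\<xi>1 \<in> Omega \<phi>" "type_order \<phi> \<xi>1 = mu_phi \<phi>" using hyp_ii by (auto simp: Omega_i_def)
  have mu_pos: "mu_phi \<phi> > 0" using tpos[OF \<xi>1(1)] \<xi>1(2) by simp
  \<comment> \<open>Needed at every point of modulus one, not only in \<open>Omega\<close>, since
    the period box is shifted later.\<close>
  have isol: "\<exists>r>0. \<forall>\<xi>. \<xi> \<noteq> 0 \<longrightarrow> norm \<xi> < r \<longrightarrow> norm (fhat \<phi> (z + \<xi>)) < 1" if z1: "norm (fhat \<phi> z) = 1" for z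
  proof -
    obtain \<xi>0 where \<xi>0: "\<xi>0 \<in> Omega \<phi>" "\<And>\<xi>. fhat \<phi> (z + \<xi>) = fhat \<phi> (\<xi>0 + \<xi>)"
      by (rule translate_to_Omega[OF z1]) blast
    obtain \<alpha>' where "local_form \<phi> \<xi>0 \<alpha>' (type_order \<phi> \<xi>0)" using lf[OF \<xi>0(1)] ..
    then obtain r where "r > 0" "\<And>\<xi>. \<xi> \<noteq> 0 \<Longrightarrow> norm \<xi> < r \<Longrightarrow> norm (fhat \<phi> (\<xi>0 + \<xi>)) < 1"
      by (rule local_form_isolated[OF one[OF \<xi>0(1)]]) blast
    thus ?thesis unfolding \<xi>0(2) by (intro exI[of _ r]) simp
  qed
  have local: "\<exists>a>0. local_decay \<phi> \<alpha> (mu_phi \<phi>) z a"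
    if z1: "norm (fhat \<phi> z) = 1" for z
  proof -
    obtain \<xi>0 where \<xi>0: "\<xi>0 \<in> Omega \<phi>" "\<And>\<xi>. fhat \<phi> (z + \<xi>) = fhat \<phi> (\<xi>0 + \<xi>)"
      by (rule translate_to_Omega[OF z1]) blast
    have "type_order \<phi> \<xi>0 < 1 \<and> drift \<phi> \<xi>0 = \<alpha>" if "imag_type \<phi> \<xi>0 \<alpha>' \<mu>'" for \<alpha>' \<mu>'
    proof -
      have "\<xi>0 \<in> Omega_i \<phi>" using \<xi>0(1) that unfolding Omega_i_def by blast
      thus ?thesis using hyp_i hyp_iii by simp
    qed
    from Omega_point_upper_bound[OF sum one[OF \<xi>0(1)] types[rule_format, OF \<xi>0(1)] this mu_le[OF \<xi>0(1)]]
    show ?thesis unfolding local_decay_def \<xi>0(2) .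
  qed
  have "\<exists>a>0. \<forall>\<rho>\<ge>0. \<exists>C>0. \<forall>n\<ge>1. \<forall>x. norm (zvec x - real n *\<^sub>R \<alpha>) \<le> \<rho> + real n powr a \<longrightarrow>
      norm (conv_pow \<phi> n x) \<le> C * real n powr (- mu_phi \<phi>)"
    by (rule conv_pow_upper_bound[OF sum le1 mu_pos]) (erule isol, erule local)
  then obtain a where a: "a > 0" and upper: "\<forall>\<rho>\<ge>0. \<exists>C>0. \<forall>n\<ge>1. \<forall>x. norm (zvec x - real n *\<^sub>R \<alpha>) \<le> \<rho> + real n powr a \<longrightarrow>
      norm (conv_pow \<phi> n x) \<le> C * real n powr (- mu_phi \<phi>)"
    by (elim exE conjE) (rule that)
  show ?thesis
  proof (intro conjI allI impI)
    fix K :: "(real^'d) set" assume "compact K"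
    then obtain \<rho> where \<rho>: "\<rho> > 0" "\<And>\<xi>. \<xi> \<in> K \<Longrightarrow> norm \<xi> \<le> \<rho>"
      using compact_imp_bounded[of K] unfolding bounded_pos by auto
    obtain C where C: "C > 0" "\<forall>n\<ge>1. \<forall>x. norm (zvec x - real n *\<^sub>R \<alpha>) \<le> \<rho> + real n powr a \<longrightarrow>
      norm (conv_pow \<phi> n x) \<le> C * real n powr (- mu_phi \<phi>)"
      using upper[rule_format, OF less_imp_le[OF \<rho>(1)]] by (elim exE conjE) (rule that)
    \<comment> \<open>The constant part of the radius contains K already at n = 0, where 0 powr a =
      0; the part n^a makes the balls nested and, as a > 0, exhausts the space.\<close>
    define Kn where "Kn = (\<lambda>n. cball (0::real^'d) (\<rho> + real n powr a))"
    have "compact (Kn n) \<and> K \<subseteq> Kn n \<and> Kn n \<subseteq> Kn (Suc n)" for n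
    proof (intro conjI)
      show "compact (Kn n)" by (simp add: Kn_def)
      show "K \<subseteq> Kn n"
      proof
        fix \<xi> assume "\<xi> \<in> K"
        from \<rho>(2)[OF this] show "\<xi> \<in> Kn n" by (simp add: Kn_def add_increasing2)
      qed
      have "real n powr a \<le> real (Suc n) powr a" using a by (intro powr_mono2) auto
      thus "Kn n \<subseteq> Kn (Suc n)" unfolding Kn_def by (intro subset_cball) simp
    qed
    moreover have "(\<Union>n. Kn n) = UNIV"
    proof (intro equalityI subsetI UNIV_I)
      fix \<xi> :: "real^'d"
      obtain n where n: "norm \<xi> powr (1 / a) \<le> real n" using real_arch_simple by blast
      have "norm \<xi> = (norm \<xi> powr (1 / a)) powr a" using a by (simp add: powr_powr)
      also have "\<dots> \<le> real n powr a" using n a by (intro powr_mono2) auto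
      finally have "\<xi> \<in> Kn n" using \<rho>(1) by (simp add: Kn_def)
      thus "\<xi> \<in> (\<Union>n. Kn n)" by blast
    qed
    moreover have "norm (conv_pow \<phi> n x) \<le> C * real n powr (- mu_phi \<phi>)"
      if "n \<ge> 1" "zvec x - real n *\<^sub>R \<alpha> \<in> Kn n" for n and x :: "int^'d"
      by (rule C(2)[rule_format, OF that(1)]) (use that(2) in \<open>simp add: Kn_def\<close>)
    ultimately show "\<exists>C'>0. \<exists>Kn. (\<forall>n. compact (Kn n) \<and> K \<subseteq> Kn n \<and> Kn n \<subseteq> Kn (Suc n)) \<and> (\<Union>n. Kn n) = UNIV \<and>
      (\<forall>n\<ge>1. \<forall>x::int^'d. zvec x - real n *\<^sub>R \<alpha> \<in> Kn n \<longrightarrow> norm (conv_pow \<phi> n x) \<le> C' * real n powr (- mu_phi \<phi>))"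
      using C(1) by (intro exI[of _ C] conjI exI[of _ Kn] allI impI) auto
  next
    obtain \<alpha>' where "local_form \<phi> \<xi>1 \<alpha>' (mu_phi \<phi>)" using lf[OF \<xi>1(1)] \<xi>1(2) by auto
    thus "\<exists>C>0. \<forall>n\<ge>1. C * real n powr (- mu_phi \<phi>) \<le> (SUP x. norm (conv_pow \<phi> n x))"
      by (rule conv_pow_lower_bound[OF sum one[OF \<xi>1(1)]])
  qed
qed

end
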